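(* Let $(P)$ and $(D)$ be the primal-dual pair of semidefinite programs of the context, and let $$X^*=\begin{pmatrix}0&0&0\\0&0&0\\0&0&\Lambda\end{pmatrix},\qquad Z^*=\begin{pmatrix}\Gamma&0&0\\0&0&0\\0&0&0\end{pmatrix},$$ where $\Lambda$ and $\Gamma$ are diagonal positive definite matrices of order $r\ge 1$ and $s\ge 1$, respectively, and $r+s<n$. Assume that $X^*$ is an optimal solution of $(P)$ and $Z^*$ is an optimal solution of $(D)$. Then the following are equivalent. (A) $X^*$ is a maximum rank optimal solution of $(P)$, and $Z^*$ is a maximum rank optimal solution of $(D)$. (B) There are positive integers $k$ and $\ell$ and a reformulation $$(P')\qquad \inf\ \langle C',X\rangle\quad\text{s.t.}\quad \langle A_i',X\rangle=b_i'\ (i=1,\dots,m),\quad X\succeq 0$$ of $(P)$ with the following properties: 1. (a) $b_1'=\dots=b_k'=0$; (b) $(Z^*,A_1',\dots,A_k')$ is a regular facial reduction sequence which reduces $\mathcal S^n_+$ to $\begin{pmatrix}0&0\\0&\oplus_r\end{pmatrix}$. 2. There are $Y_1,\dots,Y_\ell\in\mathcal S^n$ such that (a) $\langle A_i',Y_j\rangle=0$ for all $i=1,\dots,m$ and $\langle C',Y_j\rangle=0$, for $j=1,\dots,\ell$; (b) $(X^*,Y_1,\dots,Y_\ell)$ is a regular facial reduction sequence which reduces $\mathcal S^n_+$ to $\begin{pmatrix}\oplus_s&0\\0&0\end{pmatrix}$. 3. The only rotations used in the reformulation process are by admissible matrices.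
   Context: Notation. $\mathcal S^n$ is the space of $n\times n$ real symmetric matrices, $\mathcal S^n_+$ the cone of positive semidefinite (psd) ones, $\langle S,T\rangle=\mathrm{trace}(ST)$, and $S\preceq T$ means $T-S$ is psd. $[n]=\{1,\dots,n\}$. For a matrix $M$ and $R,S\subseteq[n]$, $M(R,S)$ is the submatrix with rows $R$ and columns $S$, and $M(R)=M(R,R)$. SDP pair. Given $A_1,\dots,A_m,C\in\mathcal S^n$ with $A_1,\dots,A_m$ linearly independent and $b\in\mathbb R^m$, $(P)$: $\inf\langle C,X\rangle$ s.t. $\langle A_i,X\rangle=b_i$ $(i=1,\dots,m)$, $X\succeq0$; $(D)$: $\sup\langle b,y\rangle$ s.t. $\sum_{i}y_iA_i\preceq C$. A matrix $Z$ is called feasible (optimal) in $(D)$ if there is $y\in\mathbb R^m$ feasible (optimal) in $(D)$ with $Z=C-\sum_i y_iA_i\succeq 0$. A maximum rank optimal solution is an optimal solution whose rank is largest among all optimal solutions. Reformulation. To rotate $(P)$ by an invertible matrix $T$ means to replace every $A_i$ by $T^\top A_iT$ and $C$ by $T^\top CT$ ($T$ need not be orthogonal). A reformulation of $(P)$ is any SDP obtained from it by finitely many of the following operations, in any order: (a) rotating by an invertible matrix; (b) exchanging two equations $\langle A_i,X\rangle=b_i$ and $\langle A_j,X\rangle=b_j$; (c) for some $i$ and some $y\in\mathbb R^m$ with $y_i\ne0$, replacing the equation $\langle A_i,X\rangle=b_i$ by $\langle\sum_t y_tA_t,X\rangle=\langle b,y\rangle$. Admissible. A matrix $T$ is admissible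 if $T=\begin{pmatrix}I_s&0&0\\0&U&0\\0&0&I_r\end{pmatrix}$ with $U$ invertible of order $n-r-s$. Regular facial reduction sequence. A sequence $(Y_1,\dots,Y_t)$ in $\mathcal S^n$ is a regular facial reduction sequence for $\mathcal S^n_+$ if there are pairwise disjoint (possibly empty) sets $P_1,\dots,P_t\subseteq[n]$ such that for every $i$: $Y_i(P_i)$ is diagonal positive definite, and all entries of the submatrix $Y_i([n]\setminus(P_1\cup\dots\cup P_{i-1}))$ outside the block $Y_i(P_i)$ are zero (the entries of $Y_i$ in rows or columns indexed by $P_1\cup\dots\cup P_{i-1}$ are arbitrary). It reduces $\mathcal S^n_+$ to the set $\mathcal S^n_+\cap Y_1^\perp\cap\dots\cap Y_t^\perp$, where $Y^\perp=\{X\in\mathcal S^n:\langle Y,X\rangle=0\}$. $\begin{pmatrix}0&0\\0&\oplus_r\end{pmatrix}$ denotes the set of matrices in $\mathcal S^n_+$ in which only the lower right $r\times r$ block may be nonzero; $\begin{pmatrix}\oplus_s&0\\0&0\end{pmatrix}$ denotes the set of matrices in $\mathcal S^n_+$ in which only the upper left $s\times s$ block may be nonzero. *)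

theory Defs
  imports
    "Jordan_Normal_Form.DL_Rank"
    "Jordan_Normal_Form.DL_Submatrix"
    "HOL-Library.Disjoint_Sets"
begin

(* Rows and columns are numbered from 0, so [n] is {..<n}; constraint indices and sequences
   (which are lists) are numbered from 0 as well. *)

definition sym_mats :: "nat \<Rightarrow> real mat set" where
  "sym_mats n = {S \<in> carrier_mat n n. transpose_mat S = S}"

definition psd_cone :: "nat \<Rightarrow> real mat set" where
  "psd_cone n = {X \<in> sym_mats n. \<forall>v \<in> carrier_vec n. 0 \<le> v \<bullet> (X *\<^sub>v v)}"

definition pd_mats :: "nat \<Rightarrow> real mat set" where
  "pd_mats n = {X \<in> sym_mats n. \<forall>v \<in> carrier_vec n. v \<noteq> 0\<^sub>v n \<longrightarrow> 0 < v \<bullet> (X *\<^sub>v v)}"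

definition loewner_le :: "nat \<Rightarrow> real mat \<Rightarrow> real mat \<Rightarrow> bool" where
  "loewner_le n S T \<longleftrightarrow> T - S \<in> psd_cone n"

definition mat_trace :: "real mat \<Rightarrow> real" where
  "mat_trace M = (\<Sum>i<dim_row M. M $$ (i, i))"

definition mat_inner :: "real mat \<Rightarrow> real mat \<Rightarrow> real" where
  "mat_inner S T = mat_trace (S * T)"

definition mat_perp :: "nat \<Rightarrow> real mat \<Rightarrow> real mat set" where
  "mat_perp n Y = {X \<in> sym_mats n. mat_inner Y X = 0}"

definition mat_lincomb :: "nat \<Rightarrow> real mat list \<Rightarrow> real vec \<Rightarrow> real mat" where
  "mat_lincomb n A y = mat n n (\<lambda>(p, q). \<Sum>i<length A. y $ i * (A ! i) $$ (p, q))"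

(* Independence of the family A, so a list with a repeated matrix is dependent. *)
definition mat_lin_indep :: "nat \<Rightarrow> real mat list \<Rightarrow> bool" where
  "mat_lin_indep n A \<longleftrightarrow>
     (\<forall>y \<in> carrier_vec (length A). mat_lincomb n A y = 0\<^sub>m n n \<longrightarrow> y = 0\<^sub>v (length A))"

(* The data (A, b, C) of the pair
     (P)  inf <C, X>  s.t.  <A_i, X> = b_i for all i,  X psd;
     (D)  sup <b, y>  s.t.  sum_i y_i A_i \<preceq> C.
   The number m of equations is the length of A. *)
type_synonym sdp = "real mat list \<times> real vec \<times> real mat"

definition is_sdp :: "nat \<Rightarrow> nat \<Rightarrow> sdp \<Rightarrow> bool" where
  "is_sdp n m = (\<lambda>(A, b, C).
     length A = m \<and> set A \<subseteq> sym_mats n \<and> mat_lin_indep n A \<and>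
     b \<in> carrier_vec m \<and> C \<in> sym_mats n)"

definition primal_feasible :: "nat \<Rightarrow> sdp \<Rightarrow> real mat \<Rightarrow> bool" where
  "primal_feasible n = (\<lambda>(A, b, C) X.
     X \<in> psd_cone n \<and> (\<forall>i<length A. mat_inner (A ! i) X = b $ i))"

definition primal_optimal :: "nat \<Rightarrow> sdp \<Rightarrow> real mat \<Rightarrow> bool" where
  "primal_optimal n = (\<lambda>(A, b, C) X.
     primal_feasible n (A, b, C) X \<and>
     (\<forall>X'. primal_feasible n (A, b, C) X' \<longrightarrow> mat_inner C X \<le> mat_inner C X'))"

definition dual_feasible :: "nat \<Rightarrow> sdp \<Rightarrow> real vec \<Rightarrow> bool" where
  "dual_feasible n = (\<lambda>(A, b, C) y.
     y \<in> carrier_vec (length A) \<and> loewner_le n (mat_lincomb n A y) C)"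

definition dual_optimal :: "nat \<Rightarrow> sdp \<Rightarrow> real vec \<Rightarrow> bool" where
  "dual_optimal n = (\<lambda>(A, b, C) y.
     dual_feasible n (A, b, C) y \<and>
     (\<forall>y'. dual_feasible n (A, b, C) y' \<longrightarrow> b \<bullet> y' \<le> b \<bullet> y))"

definition dual_slack_optimal :: "nat \<Rightarrow> sdp \<Rightarrow> real mat \<Rightarrow> bool" where
  "dual_slack_optimal n = (\<lambda>(A, b, C) Z.
     \<exists>y. dual_optimal n (A, b, C) y \<and> Z = C - mat_lincomb n A y)"

definition max_rank :: "nat \<Rightarrow> (real mat \<Rightarrow> bool) \<Rightarrow> real mat \<Rightarrow> bool" where
  "max_rank n Q X \<longleftrightarrow> Q X \<and> (\<forall>X'. Q X' \<longrightarrow> vec_space.rank n X' \<le> vec_space.rank n X)"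

(* One elementary operation of the reformulation process, in which rotations are restricted to
   matrices from the set R. *)
inductive reform_step :: "nat \<Rightarrow> real mat set \<Rightarrow> sdp \<Rightarrow> sdp \<Rightarrow> bool" for n R where
  rotate: "T \<in> R \<Longrightarrow> T \<in> carrier_mat n n \<Longrightarrow> invertible_mat T \<Longrightarrow>
    reform_step n R (A, b, C)
      (map (\<lambda>M. transpose_mat T * M * T) A, b, transpose_mat T * C * T)"
| exchange: "i < length A \<Longrightarrow> j < length A \<Longrightarrow>
    reform_step n R (A, b, C)
      (A[i := A ! j, j := A ! i], update_vec (update_vec b i (b $ j)) j (b $ i), C)"
| combine: "i < length A \<Longrightarrow> y \<in> carrier_vec (length A) \<Longrightarrow> y $ i \<noteq> 0 \<Longrightarrow>
    reform_step n R (A, b, C)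
      (A[i := mat_lincomb n A y], update_vec b i (b \<bullet> y), C)"

(* Finitely many operations; R = UNIV gives reformulations with arbitrary rotations. *)
definition reformulation_using :: "nat \<Rightarrow> real mat set \<Rightarrow> sdp \<Rightarrow> sdp \<Rightarrow> bool" where
  "reformulation_using n R = (reform_step n R)\<^sup>*\<^sup>*"

definition admissible_mats :: "nat \<Rightarrow> nat \<Rightarrow> nat \<Rightarrow> real mat set" where
  "admissible_mats n s r = {diag_block_mat [1\<^sub>m s, U, 1\<^sub>m r] | U.
     U \<in> carrier_mat (n - r - s) (n - r - s) \<and> invertible_mat U}"

definition regular_fr_seq :: "nat \<Rightarrow> real mat list \<Rightarrow> bool" where
  "regular_fr_seq n Ys \<longleftrightarrow> set Ys \<subseteq> sym_mats n \<and>
     (\<exists>P :: nat \<Rightarrow> nat set.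
        (\<forall>i<length Ys. P i \<subseteq> {..<n}) \<and>
        disjoint_family_on P {..<length Ys} \<and>
        (\<forall>i<length Ys.
           diagonal_mat (submatrix (Ys ! i) (P i) (P i)) \<and>
           submatrix (Ys ! i) (P i) (P i) \<in> pd_mats (card (P i)) \<and>
           (\<forall>p \<in> {..<n} - (\<Union>j<i. P j). \<forall>q \<in> {..<n} - (\<Union>j<i. P j).
              \<not> (p \<in> P i \<and> q \<in> P i) \<longrightarrow> (Ys ! i) $$ (p, q) = 0)))"

definition reduces_to :: "nat \<Rightarrow> real mat list \<Rightarrow> real mat set \<Rightarrow> bool" where
  "reduces_to n Ys F \<longleftrightarrow> psd_cone n \<inter> (\<Inter>Y \<in> set Ys. mat_perp n Y) = F"

definition lower_right_face :: "nat \<Rightarrow> nat \<Rightarrow> real mat set" where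
  "lower_right_face n r =
     {X \<in> psd_cone n. \<forall>p<n. \<forall>q<n. X $$ (p, q) \<noteq> 0 \<longrightarrow> n - r \<le> p \<and> n - r \<le> q}"

definition upper_left_face :: "nat \<Rightarrow> nat \<Rightarrow> real mat set" where
  "upper_left_face n s =
     {X \<in> psd_cone n. \<forall>p<n. \<forall>q<n. X $$ (p, q) \<noteq> 0 \<longrightarrow> p < s \<and> q < s}"

end

theory Submission
  imports "HOL-Analysis.Function_Topology" Defs "Jordan_Normal_Form.DL_Rank_Submatrix"
begin

text \<open>Write \<open>U\<close> for the span of the \<open>A\<^sub>i\<close>. By complementarity the primal optimal set consists of the
  psd \<open>X\<close> with \<open>X - X*\<close> orthogonal to \<open>U\<close> and \<open>\<langle>Z*, X\<rangle> = 0\<close>, and the dual one of the psd \<open>Z\<close> with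
  \<open>Z - Z*\<close> in \<open>U\<close> and \<open>\<langle>Z, X*\<rangle> = 0\<close>; the two descriptions are exchanged by passing from \<open>U\<close> to its
  orthogonal complement. Maximum rank means that the optimal set lies in the face spanned by \<open>X*\<close>
  (or \<open>Z*\<close>), and Gordan's alternative for the psd cone then yields facial reduction sequences
  which cut the face orthogonal to \<open>Z*\<close> (or \<open>X*\<close>) down to that face. Conversely, such sequences
  confine every optimal solution to the face.

  The primal sequence is a flag of forms on the middle block and the dual one a flag of forms on its
  dual space, and a single rotation has to diagonalize both. Its columns and those of its transposed
  inverse are chosen one pair at a time: each pair is a top singular pair for the pairing of the last
  nonzero kernel of the primal flag with the last kernel of the dual flag that does not annihilate it.\<close>

section \<open>Subspaces of functions on a finite index set\<close>

text \<open>A rotation acts on the equations through the columns of \<open>T\<close> and on the dual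
  matrices through the columns of its transposed inverse, so the two flags cannot be diagonalized
  separately. On the last nonzero primal kernel the current form is positive definite; the choice of
  the dual kernel makes every null vector of the dual form annihilate that space, which is what lets
  the criticality conditions of the pairing speak of the dual form itself. A vector taken at stage i
  is a null vector of all earlier forms on their kernels, and regularity leaves its entries in later
  forms arbitrary. Hence one orthogonality relation on each side suffices, and the pair can be split
  off.

  Only the middle block may be moved. The entries linking it to the surviving block vanish of
  themselves, since the unit vectors of that block stay in every kernel; the remaining outer block
  is removed by the leading member (\<open>Zs\<close> or \<open>Xs\<close>), after which its entries
  are arbitrary.

  Gordan's alternative is exact because the psd matrices of trace one form a compact set, so no
  closure has to be taken. It is homogeneous, while the equations are not; adding a multiple of the
  given optimal matrix and rescaling bridges the gap.\<close>

text \<open>The order \<open>n\<close> is not a type, so vectors are functions supported in a finite index set \<open>I\<close> and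
  matrices are functions supported in its square.\<close>

definition ip :: "'i set \<Rightarrow> ('i \<Rightarrow> real) \<Rightarrow> ('i \<Rightarrow> real) \<Rightarrow> real" where
  "ip I x y = (\<Sum>i\<in>I. x i * y i)"

definition vecs_on :: "'i set \<Rightarrow> ('i \<Rightarrow> real) set" where
  "vecs_on I = {x. \<forall>i. i \<notin> I \<longrightarrow> x i = 0}"

definition lin_sub :: "'i set \<Rightarrow> ('i \<Rightarrow> real) set \<Rightarrow> bool" where
  "lin_sub I E \<longleftrightarrow> E \<subseteq> vecs_on I \<and> (\<lambda>_. 0) \<in> E \<and>
     (\<forall>x\<in>E. \<forall>y\<in>E. \<forall>c. (\<lambda>i. x i + c * y i) \<in> E)"

lemma ip_commute: "ip I x y = ip I y x"
  by (simp add: ip_def mult.commute)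

lemma ip_add_left: "ip I (\<lambda>i. x i + c * y i) z = ip I x z + c * ip I y z"
  by (simp add: ip_def sum.distrib sum_distrib_left algebra_simps)

lemma ip_diff_left: "ip I (\<lambda>i. x i - y i) z = ip I x z - ip I y z"
  by (simp add: ip_def sum_subtractf algebra_simps)

lemma ip_scale_left: "ip I (\<lambda>i. c * x i) z = c * ip I x z"
  by (simp add: ip_def sum_distrib_left algebra_simps)

lemma ip_zero_left [simp]: "ip I (\<lambda>_. 0) z = 0"
  by (simp add: ip_def)

lemma ip_zero_right [simp]: "ip I z (\<lambda>_. 0) = 0"
  by (simp add: ip_def)

lemma ip_sum_left: "ip I (\<lambda>i. \<Sum>a\<in>S. c a * e a i) z = (\<Sum>a\<in>S. c a * ip I (e a) z)"
proof -
  have "ip I (\<lambda>i. \<Sum>a\<in>S. c a * e a i) z = (\<Sum>i\<in>I. \<Sum>a\<in>S. c a * (e a i * z i))"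
    by (simp add: ip_def sum_distrib_right mult.assoc)
  also have "\<dots> = (\<Sum>a\<in>S. \<Sum>i\<in>I. c a * (e a i * z i))"
    by (rule sum.swap)
  finally show ?thesis by (simp add: ip_def sum_distrib_left)
qed

lemma ip_nonneg: "0 \<le> ip I x x"
  by (simp add: ip_def sum_nonneg)

lemma ip_pos:
  assumes "finite I" "x \<in> vecs_on I" "x \<noteq> (\<lambda>_. 0)"
  shows "0 < ip I x x"
proof -
  obtain i where "x i \<noteq> 0" using assms(3) by auto
  then have "i \<in> I" using assms(2) by (auto simp: vecs_on_def)
  have "x i * x i \<le> ip I x x"
    unfolding ip_def using \<open>i \<in> I\<close> assms(1) by (intro member_le_sum) auto
  moreover have "0 < x i * x i" using \<open>x i \<noteq> 0\<close> by (auto simp: zero_less_mult_iff)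
  ultimately show ?thesis by linarith
qed

lemma ip_delta: "finite I \<Longrightarrow> i \<in> I \<Longrightarrow> ip I (\<lambda>j. if j = i then 1 else 0) x = x i"
  unfolding ip_def by (subst sum.remove[of I i]) auto

lemma lin_subD:
  assumes "lin_sub I E"
  shows lin_sub_vecs_on: "x \<in> E \<Longrightarrow> x \<in> vecs_on I"
    and lin_sub_zero: "(\<lambda>_. 0) \<in> E"
    and lin_sub_add: "x \<in> E \<Longrightarrow> y \<in> E \<Longrightarrow> (\<lambda>i. x i + c * y i) \<in> E"
    and lin_sub_scale: "x \<in> E \<Longrightarrow> (\<lambda>i. c * x i) \<in> E"
    and lin_sub_diff: "x \<in> E \<Longrightarrow> y \<in> E \<Longrightarrow> (\<lambda>i. x i - y i) \<in> E"
proof -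
  have add: "(\<lambda>i. x i + c * y i) \<in> E" if "x \<in> E" "y \<in> E" for x y c
    using assms that unfolding lin_sub_def by blast
  have z: "(\<lambda>_. 0) \<in> E" using assms unfolding lin_sub_def by blast
  show "x \<in> E \<Longrightarrow> x \<in> vecs_on I" using assms unfolding lin_sub_def by blast
  show "(\<lambda>_. 0) \<in> E" by (rule z)
  show "x \<in> E \<Longrightarrow> y \<in> E \<Longrightarrow> (\<lambda>i. x i + c * y i) \<in> E" by (rule add)
  show "x \<in> E \<Longrightarrow> (\<lambda>i. c * x i) \<in> E" using add[OF z, of x c] by simp
  show "x \<in> E \<Longrightarrow> y \<in> E \<Longrightarrow> (\<lambda>i. x i - y i) \<in> E" using add[of x y "-1"] by simp
qed

lemma lin_sub_sum:
  assumes "lin_sub I E" "finite S" "\<And>a. a \<in> S \<Longrightarrow> e a \<in> E"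
  shows "(\<lambda>i. \<Sum>a\<in>S. c a * e a i) \<in> E"
  using assms(2,3)
proof (induction S rule: finite_induct)
  case empty
  then show ?case using lin_sub_zero[OF assms(1)] by simp
next
  case (insert b S)
  then have "(\<lambda>i. (\<Sum>a\<in>S. c a * e a i) + c b * e b i) \<in> E"
    by (intro lin_sub_add[OF assms(1)]) auto
  then show ?case using insert.hyps by (simp add: add.commute)
qed

section \<open>Orthonormal families, projections and dimension\<close>

definition orthonormal :: "'i set \<Rightarrow> nat \<Rightarrow> (nat \<Rightarrow> 'i \<Rightarrow> real) \<Rightarrow> bool" where
  "orthonormal I k e \<longleftrightarrow> (\<forall>a<k. \<forall>b<k. ip I (e a) (e b) = (if a = b then 1 else 0))"

definition proj :: "'i set \<Rightarrow> nat \<Rightarrow> (nat \<Rightarrow> 'i \<Rightarrow> real) \<Rightarrow> ('i \<Rightarrow> real) \<Rightarrow> 'i \<Rightarrow> real" where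
  "proj I k e x = (\<lambda>i. \<Sum>a<k. ip I x (e a) * e a i)"

lemma ip_residual:
  assumes "orthonormal I k e" "b < k"
  shows "ip I (\<lambda>i. x i - proj I k e x i) (e b) = 0"
proof -
  have "ip I (proj I k e x) (e b) = (\<Sum>a<k. ip I x (e a) * ip I (e a) (e b))"
    unfolding proj_def by (rule ip_sum_left)
  also have "\<dots> = (\<Sum>a<k. if a = b then ip I x (e a) else 0)"
    using assms by (intro sum.cong) (auto simp: orthonormal_def)
  also have "\<dots> = ip I x (e b)" using assms(2) by simp
  finally show ?thesis by (simp add: ip_diff_left)
qed

text \<open>The residual of \<open>x\<close> is orthogonal to every projection, so pairing with a
  residual ignores the projected part. For \<open>x = y\<close> this expresses a squared distance as
  a pairing that is linear in one argument.\<close>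

lemma ip_residual_residual:
  assumes "orthonormal I k e"
  shows "ip I (\<lambda>i. x i - proj I k e x i) (\<lambda>i. y i - proj I k e y i)
    = ip I (\<lambda>i. x i - proj I k e x i) y"
proof -
  let ?w = "\<lambda>i. x i - proj I k e x i"
  have "ip I (proj I k e y) ?w = (\<Sum>a<k. ip I y (e a) * ip I (e a) ?w)"
    unfolding proj_def by (rule ip_sum_left)
  also have "\<dots> = 0" using ip_residual[OF assms, of _ x] by (simp add: ip_commute)
  finally have "ip I ?w (proj I k e y) = 0" by (simp add: ip_commute)
  moreover have "ip I ?w (\<lambda>i. y i - proj I k e y i) = ip I ?w y - ip I ?w (proj I k e y)"
    by (subst (1 2 3) ip_commute) (rule ip_diff_left)
  ultimately show ?thesis by simp
qed

lemma bessel: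
  assumes "orthonormal I k e"
  shows "(\<Sum>a<k. (ip I x (e a))\<^sup>2) \<le> ip I x x"
proof -
  have "0 \<le> ip I (\<lambda>i. x i - proj I k e x i) x"
    using ip_residual_residual[OF assms, of x x] ip_nonneg by metis
  also have "\<dots> = ip I x x - (\<Sum>a<k. ip I x (e a) * ip I (e a) x)"
    unfolding ip_diff_left proj_def ip_sum_left ..
  finally show ?thesis by (simp add: power2_eq_square ip_commute)
qed

text \<open>Bessel's inequality at the unit vector of \<open>i\<close> bounds the sum of
  \<open>(e a i)\<^sup>2\<close> over \<open>a\<close> by one; summing over \<open>i \<in> I\<close>
  turns the left side into \<open>k\<close>.\<close>

lemma orthonormal_card:
  fixes e :: "nat \<Rightarrow> 'i \<Rightarrow> real"
  assumes "orthonormal I k e" "finite I"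
  shows "k \<le> card I"
proof -
  have "real k = (\<Sum>a<k. ip I (e a) (e a))"
    using assms(1) by (simp add: orthonormal_def)
  also have "\<dots> = (\<Sum>i\<in>I. \<Sum>a<k. (e a i)\<^sup>2)"
    unfolding ip_def by (subst sum.swap) (simp add: power2_eq_square)
  also have "\<dots> \<le> (\<Sum>i\<in>I. 1)"
  proof (rule sum_mono)
    fix i assume i: "i \<in> I"
    show "(\<Sum>a<k. (e a i)\<^sup>2) \<le> 1"
      using bessel[OF assms(1), of "\<lambda>j. if j = i then 1 else 0"]
      by (simp add: ip_delta[OF assms(2) i])
  qed
  finally show ?thesis by simp
qed

text \<open>Dimension is counted by orthonormal families, so that a family of maximal size is at
  once a basis with its own projection. For finite \<open>I\<close> the maximum exists: 0 belongs to
  the set, and \<open>orthonormal_card\<close> bounds it by \<open>card I\<close>.\<close>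

definition edim :: "'i set \<Rightarrow> ('i \<Rightarrow> real) set \<Rightarrow> nat" where
  "edim I E = Max {k. \<exists>e. orthonormal I k e \<and> (\<forall>a<k. e a \<in> E)}"

lemma edim_finite:
  assumes "finite I"
  shows "finite {k. \<exists>e. orthonormal I k e \<and> (\<forall>a<k. e a \<in> E)}"
  by (rule finite_subset[of _ "{..card I}"]) (use orthonormal_card[OF _ assms] in auto)

lemma edim_extend:
  assumes "finite I" "lin_sub I E" "orthonormal I k e" "\<And>a. a < k \<Longrightarrow> e a \<in> E"
    and "w \<in> E" "w \<noteq> (\<lambda>_. 0)" "\<And>a. a < k \<Longrightarrow> ip I w (e a) = 0"
  shows "Suc k \<le> edim I E"
proof -
  have pos: "0 < ip I w w"
    using ip_pos[OF assms(1) lin_sub_vecs_on[OF assms(2,5)] assms(6)] .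
  define c where "c = 1 / sqrt (ip I w w)"
  have c: "c * c * ip I w w = 1" using pos by (simp add: c_def)
  define e' where "e' = e(k := (\<lambda>i. c * w i))"
  have wc: "ip I (\<lambda>i. c * w i) y = c * ip I w y" "ip I y (\<lambda>i. c * w i) = c * ip I w y" for y
    using ip_scale_left[of I c w y] by (simp_all add: ip_commute)
  have "orthonormal I (Suc k) e'"
    unfolding orthonormal_def
  proof (intro allI impI)
    fix a b assume "a < Suc k" "b < Suc k"
    then consider "a < k" "b < k" | "a = k" "b < k" | "a < k" "b = k" | "a = k" "b = k" by linarith
    then show "ip I (e' a) (e' b) = (if a = b then 1 else 0)"
    proof cases
      case 1 then show ?thesis using assms(3) by (simp add: e'_def orthonormal_def)
    next
      case 4 then show ?thesis using c by (simp add: e'_def wc mult.assoc)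
    qed (use assms(7) in \<open>auto simp: e'_def wc\<close>)
  qed
  moreover have "e' a \<in> E" if "a < Suc k" for a
    using that assms(4,5) lin_sub_scale[OF assms(2)] by (auto simp: e'_def less_Suc_eq)
  ultimately show ?thesis
    unfolding edim_def by (intro Max_ge edim_finite assms(1)) auto
qed

lemma lin_sub_proj:
  assumes "lin_sub I E" "\<And>a. a < k \<Longrightarrow> e a \<in> E"
  shows "proj I k e x \<in> E"
  unfolding proj_def by (rule lin_sub_sum[OF assms(1)]) (use assms(2) in auto)

text \<open>A nonzero residual of some \<open>x \<in> E\<close> could be normalized and appended to
  a family of maximal size.\<close>

lemma orthonormal_basis:
  assumes "finite I" "lin_sub I E"
  obtains e where "orthonormal I (edim I E) e" "\<And>a. a < edim I E \<Longrightarrow> e a \<in> E"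
    "\<And>x. x \<in> E \<Longrightarrow> proj I (edim I E) e x = x"
proof -
  let ?S = "{k. \<exists>e. orthonormal I k e \<and> (\<forall>a<k. e a \<in> E)}"
  have "0 \<in> ?S" by (simp add: orthonormal_def)
  then have "edim I E \<in> ?S" unfolding edim_def by (intro Max_in edim_finite assms(1)) blast
  then obtain e where e: "orthonormal I (edim I E) e" "\<And>a. a < edim I E \<Longrightarrow> e a \<in> E" by blast
  have "proj I (edim I E) e x = x" if x: "x \<in> E" for x
  proof (rule ccontr)
    assume neq: "proj I (edim I E) e x \<noteq> x"
    let ?w = "\<lambda>i. x i - proj I (edim I E) e x i"
    have "?w \<in> E" using lin_sub_diff[OF assms(2) x lin_sub_proj[OF assms(2) e(2)]] by simp
    moreover have "?w \<noteq> (\<lambda>_. 0)"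
    proof
      assume "?w = (\<lambda>_. 0)"
      then have "x = proj I (edim I E) e x" by (auto simp: fun_eq_iff)
      then show False using neq by simp
    qed
    ultimately have "Suc (edim I E) \<le> edim I E"
      using edim_extend[OF assms e(1) e(2), of ?w] ip_residual[OF e(1), of _ x] by blast
    then show False by simp
  qed
  then show ?thesis using that e by blast
qed

text \<open>An orthonormal basis of \<open>F\<close> is extended by the residual of a vector in
  \<open>E\<close> outside \<open>F\<close>.\<close>

lemma edim_less:
  assumes "finite I" "lin_sub I E" "lin_sub I F" "F \<subset> E"
  shows "edim I F < edim I E"
proof -
  obtain e where e: "orthonormal I (edim I F) e" "\<And>a. a < edim I F \<Longrightarrow> e a \<in> F"
    using orthonormal_basis[OF assms(1,3)] by blast
  obtain x where x: "x \<in> E" "x \<notin> F" using assms(4) by blast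
  have p: "proj I (edim I F) e x \<in> F" using lin_sub_proj[OF assms(3) e(2)] .
  let ?w = "\<lambda>i. x i - proj I (edim I F) e x i"
  have "?w \<in> E" using lin_sub_diff[OF assms(2) x(1)] p assms(4) by blast
  moreover have "?w \<noteq> (\<lambda>_. 0)"
  proof
    assume "?w = (\<lambda>_. 0)"
    then have "x = proj I (edim I F) e x" by (auto simp: fun_eq_iff)
    then show False using p x(2) by simp
  qed
  ultimately have "Suc (edim I F) \<le> edim I E"
    using e assms(4) by (intro edim_extend[OF assms(1,2) e(1) _ _ _ ip_residual[OF e(1)]]) auto
  then show ?thesis by simp
qed

section \<open>Closed subspaces and compact spheres\<close>

lemma continuous_on_ip [continuous_intros]:
  assumes "\<And>i. continuous_on S (\<lambda>z. f z i)" "\<And>i. continuous_on S (\<lambda>z. g z i)"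
  shows "continuous_on S (\<lambda>z. ip I (f z) (g z))"
  unfolding ip_def by (intro continuous_intros assms)

lemma continuous_on_coordinate [continuous_intros]: "continuous_on S (\<lambda>x. x i)"
  by (rule continuous_on_subset[OF continuous_on_product_coordinates]) auto

text \<open>A subspace is the fixed point set of its projection, which is continuous for pointwise
  convergence.\<close>

lemma closed_lin_sub:
  assumes "finite I" "lin_sub I E"
  shows "closed E"
proof -
  obtain e where e: "\<And>a. a < edim I E \<Longrightarrow> e a \<in> E" "\<And>x. x \<in> E \<Longrightarrow> proj I (edim I E) e x = x"
    using orthonormal_basis[OF assms] by blast
  have "E = {x. \<forall>i. x i = proj I (edim I E) e x i}"
  proof (intro equalityI subsetI)
    fix x assume "x \<in> E"
    then show "x \<in> {x. \<forall>i. x i = proj I (edim I E) e x i}" using e(2) by simp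
  next
    fix x assume "x \<in> {x. \<forall>i. x i = proj I (edim I E) e x i}"
    then have "x = proj I (edim I E) e x" by blast
    moreover have "proj I (edim I E) e x \<in> E" using e(1) by (rule lin_sub_proj[OF assms(2)])
    ultimately show "x \<in> E" by metis
  qed
  also have "closed \<dots>"
    unfolding proj_def by (intro closed_Collect_all closed_Collect_eq continuous_intros)
  finally show ?thesis .
qed

text \<open>This is Tychonoff's theorem: the index type may be infinite, and functions carry the
  topology of pointwise convergence.\<close>

lemma compact_cube: "compact {x::'i \<Rightarrow> real. \<forall>i. x i \<in> {-B..B}}"
proof -
  have "compactin (product_topology (\<lambda>i. euclidean) UNIV) (PiE UNIV (\<lambda>i::'i. {-B..B::real}))"
    unfolding compactin_PiE by simp
  moreover have "PiE UNIV (\<lambda>i::'i. {-B..B::real}) = {x. \<forall>i. x i \<in> {-B..B}}"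
    by (auto simp: PiE_def Pi_def)
  ultimately show ?thesis by (simp add: euclidean_product_topology)
qed

text \<open>Unit length bounds each coordinate in \<open>I\<close> by one and the coordinates
  outside \<open>I\<close> vanish, so the sphere is a closed part of a cube.\<close>

lemma compact_sphere:
  fixes E :: "('i \<Rightarrow> real) set"
  assumes "finite I" "lin_sub I E"
  shows "compact {x \<in> E. ip I x x = 1}"
proof -
  have "{x \<in> E. ip I x x = 1} = {x. \<forall>i. x i \<in> {-1..1}} \<inter> (E \<inter> {x. ip I x x = 1})"
  proof -
    have "x i \<in> {-1..1}" if x: "x \<in> E" "ip I x x = 1" for x i
    proof (cases "i \<in> I")
      case True
      have "x i * x i \<le> ip I x x"
        unfolding ip_def using True assms(1) by (intro member_le_sum) auto
      then have "(x i)\<^sup>2 \<le> 1" using x by (simp add: power2_eq_square)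
      then show ?thesis by (simp add: abs_square_le_1 abs_le_iff)
    next
      case False
      then show ?thesis using lin_sub_vecs_on[OF assms(2) x(1)] by (simp add: vecs_on_def)
    qed
    then show ?thesis by auto
  qed
  moreover have "closed {x::'i \<Rightarrow> real. ip I x x = 1}"
    by (intro closed_Collect_eq continuous_intros)
  ultimately show ?thesis
    using compact_cube[of 1] closed_lin_sub[OF assms] by (auto intro!: compact_Int_closed closed_Int)
qed

section \<open>Bilinear forms\<close>

definition bf :: "'i set \<Rightarrow> ('i \<times> 'i \<Rightarrow> real) \<Rightarrow> ('i \<Rightarrow> real) \<Rightarrow> ('i \<Rightarrow> real) \<Rightarrow> real" where
  "bf I a x y = (\<Sum>i\<in>I. \<Sum>j\<in>I. a (i, j) * x i * y j)"

definition symf :: "('i \<times> 'i \<Rightarrow> real) \<Rightarrow> bool" where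
  "symf a \<longleftrightarrow> (\<forall>i j. a (i, j) = a (j, i))"

lemma bf_add_left: "bf I a (\<lambda>i. x i + c * y i) z = bf I a x z + c * bf I a y z"
  by (simp add: bf_def sum.distrib sum_distrib_left algebra_simps)

lemma bf_add_right: "bf I a z (\<lambda>i. x i + c * y i) = bf I a z x + c * bf I a z y"
  by (simp add: bf_def sum.distrib sum_distrib_left algebra_simps)

lemma bf_scale_left: "bf I a (\<lambda>i. c * x i) z = c * bf I a x z"
  using bf_add_left[of I a "\<lambda>_. 0" c x z] by (simp add: bf_def)

lemma bf_scale_right: "bf I a z (\<lambda>i. c * x i) = c * bf I a z x"
  using bf_add_right[of I a z "\<lambda>_. 0" c x] by (simp add: bf_def)

lemma bf_zero [simp]: "bf I a (\<lambda>_. 0) z = 0" "bf I a z (\<lambda>_. 0) = 0"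
  by (simp_all add: bf_def)

lemma bf_commute: "symf a \<Longrightarrow> bf I a x y = bf I a y x"
  unfolding bf_def by (subst sum.swap) (simp add: symf_def mult.commute mult.left_commute)

lemma bf_eq_ip: "bf I a x y = ip (I \<times> I) a (\<lambda>(i, j). x i * y j)"
  by (simp add: bf_def ip_def sum.cartesian_product case_prod_unfold mult.assoc)

lemma bf_delta:
  assumes "finite I" "i \<in> I" "j \<in> I"
  shows "bf I a (\<lambda>p. if p = i then 1 else 0) (\<lambda>p. if p = j then 1 else 0) = a (i, j)"
proof -
  have "bf I a (\<lambda>p. if p = i then 1 else 0) (\<lambda>p. if p = j then 1 else 0)
    = (\<Sum>p\<in>I. \<Sum>q\<in>I. if q = j then (if p = i then a (p, q) else 0) else 0)"
    unfolding bf_def by (intro sum.cong) auto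
  then show ?thesis using assms by (simp add: sum.delta)
qed

lemma bf_expand:
  assumes "symf a"
  shows "bf I a (\<lambda>i. x i + t * y i) (\<lambda>i. x i + t * y i)
    = bf I a x x + 2 * t * bf I a x y + t\<^sup>2 * bf I a y y"
  unfolding bf_add_left bf_add_right bf_commute[OF assms, of I y x]
  by (simp add: algebra_simps power2_eq_square)

lemma linear_coeff_nonneg:
  fixes \<beta> \<gamma> :: real
  assumes "\<And>t. 0 < t \<Longrightarrow> t \<le> 1 \<Longrightarrow> 0 \<le> 2 * t * \<beta> + t\<^sup>2 * \<gamma>"
  shows "0 \<le> \<beta>"
proof (rule ccontr)
  assume neg: "\<not> 0 \<le> \<beta>"
  \<comment> \<open>This \<open>t\<close> lies in (0, 1] and gives t * \<gamma> at most - \<beta>,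
    so that 2 * \<beta> + t * \<gamma> is at most \<beta>, which is negative.\<close>
  define t where "t = - \<beta> / (\<bar>\<gamma>\<bar> - \<beta>)"
  have t: "0 < t" "t \<le> 1" using neg by (auto simp: t_def divide_simps)
  have "t * \<gamma> \<le> t * \<bar>\<gamma>\<bar>" using t by (intro mult_left_mono) auto
  also have "t * \<bar>\<gamma>\<bar> \<le> t * (\<bar>\<gamma>\<bar> - \<beta>)" using t neg by (intro mult_left_mono) auto
  also have "\<dots> = - \<beta>" using neg by (simp add: t_def)
  finally have "2 * \<beta> + t * \<gamma> < 0" using neg by linarith
  then have "t * (2 * \<beta> + t * \<gamma>) < 0" using t by (simp add: mult_pos_neg)
  then show False using assms[OF t] by (simp add: algebra_simps power2_eq_square)
qed

lemma linear_coeff_zero: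
  fixes \<beta> \<gamma> :: real
  assumes "\<And>t. 0 \<le> 2 * t * \<beta> + t\<^sup>2 * \<gamma>"
  shows "\<beta> = 0"
proof -
  have "0 \<le> 2 * t * (- \<beta>) + t\<^sup>2 * \<gamma>" for t using assms[of "- t"] by simp
  then have "0 \<le> - \<beta>" by (rule linear_coeff_nonneg)
  moreover have "0 \<le> \<beta>" using assms by (rule linear_coeff_nonneg)
  ultimately show ?thesis by simp
qed

text \<open>The quadratic t \<mapsto> a(x + t y, x + t y) is nonnegative and vanishes at t = 0,
  hence its linear coefficient is zero. The form has to be psd on \<open>E\<close> only, which is
  all that later members of a facial reduction sequence offer.\<close>

lemma psd_kernel:
  assumes "lin_sub I E" "symf a" "\<And>x. x \<in> E \<Longrightarrow> 0 \<le> bf I a x x"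
    and "x \<in> E" "bf I a x x = 0" "y \<in> E"
  shows "bf I a x y = 0"
proof (rule linear_coeff_zero)
  fix t
  show "0 \<le> 2 * t * bf I a x y + t\<^sup>2 * bf I a y y"
    using assms(3)[OF lin_sub_add[OF assms(1,4,6), of t]] assms(5) by (simp add: bf_expand[OF assms(2)])
qed

section \<open>Gordan's alternative for the psd cone\<close>

lemma bf_lin_mat: "bf I (\<lambda>p. a p + c * b p) x y = bf I a x y + c * bf I b x y"
  by (simp add: bf_def sum.distrib sum_distrib_left algebra_simps)

lemma proj_add: "proj I k e (\<lambda>i. x i + c * y i) = (\<lambda>i. proj I k e x i + c * proj I k e y i)"
  by (simp add: proj_def ip_add_left sum.distrib sum_distrib_left algebra_simps)

lemma ip_expand:
  "ip I (\<lambda>i. x i + t * y i) (\<lambda>i. x i + t * y i) = ip I x x + 2 * t * ip I x y + t\<^sup>2 * ip I y y"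
  by (simp add: ip_def sum.distrib sum_distrib_left algebra_simps power2_eq_square)

lemma bf_outer: "bf I (\<lambda>(i, j). x i * y j) u v = ip I x u * ip I y v"
  by (simp add: bf_def ip_def sum_product algebra_simps)

text \<open>The matrix \<open>M\<close> is the shortest vector leading from \<open>L\<close> to the compact set of psd matrices of trace one.\<close>

lemma gordan:
  assumes fin: "finite I" and L: "lin_sub (I \<times> I) L" and Lsym: "\<And>a. a \<in> L \<Longrightarrow> symf a"
    and no_psd: "\<And>a. a \<in> L \<Longrightarrow> (\<And>x. 0 \<le> bf I a x x) \<Longrightarrow> a = (\<lambda>_. 0)"
  obtains M where "M \<in> vecs_on (I \<times> I)" "symf M"
    "\<And>x. x \<in> vecs_on I \<Longrightarrow> x \<noteq> (\<lambda>_. 0) \<Longrightarrow> 0 < bf I M x x"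
    "\<And>a. a \<in> L \<Longrightarrow> ip (I \<times> I) M a = 0"
\<comment> \<open>With no index there is no matrix of trace one to minimize over, and definiteness
  is vacuous.\<close>
proof (cases "I = {}")
  case True
  then show ?thesis
    by (intro that[of "\<lambda>_. 0"]) (auto simp: vecs_on_def symf_def)
next
  case False
  have fin2: "finite (I \<times> I)" using fin by simp
  define S where "S = {X. X \<in> vecs_on (I \<times> I) \<and> symf X \<and> (\<forall>x. 0 \<le> bf I X x x) \<and> (\<Sum>i\<in>I. X (i, i)) = 1}"
  have bound: "X p \<in> {-1..1}" if X: "X \<in> S" for X p
  proof (cases "p \<in> I \<times> I")
    case True
    then obtain i j where p: "p = (i, j)" "i \<in> I" "j \<in> I" by auto
    have nn: "0 \<le> X (a, a)" if "a \<in> I" for a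
      using bf_delta[OF fin that that, of X] X unfolding S_def by (metis (no_types, lifting) mem_Collect_eq)
    have le1: "X (a, a) \<le> 1" if "a \<in> I" for a
    proof -
      have "X (a, a) \<le> (\<Sum>i\<in>I. X (i, i))" using that fin nn by (intro member_le_sum) auto
      then show ?thesis using X by (simp add: S_def)
    qed
    \<comment> \<open>Testing with the sum and the difference of two unit vectors bounds
      off-diagonal entries by the diagonal ones, which lie in [0, 1].\<close>
    have "0 \<le> X (i, i) + 2 * t * X (i, j) + t\<^sup>2 * X (j, j)" for t
    proof -
      have "symf X" using X by (simp add: S_def)
      have "0 \<le> bf I X (\<lambda>a. (if a = i then 1 else 0) + t * (if a = j then 1 else 0))
        (\<lambda>a. (if a = i then 1 else 0) + t * (if a = j then 1 else 0))"
        using X by (simp add: S_def)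
      then show ?thesis unfolding bf_expand[OF \<open>symf X\<close>] by (simp only: bf_delta fin p(2,3))
    qed
    from this[of 1] this[of "-1"] le1[OF p(2)] le1[OF p(3)] show ?thesis by (simp add: p(1))
  next
    case False
    then have "X p = 0" using X unfolding S_def vecs_on_def by blast
    then show ?thesis by simp
  qed
  have outer: "(\<lambda>(i, j). x i * x j) \<in> S" if "x \<in> vecs_on I" "ip I x x = 1" for x
    using that unfolding S_def
    by (auto simp: vecs_on_def symf_def bf_outer) (simp add: ip_def)
  have "compact S"
  proof -
    have "S = {X. \<forall>p. X p \<in> {-1..1}} \<inter> S" using bound by blast
    moreover have "closed S"
    proof -
      have "S = (\<Inter>p\<in>-(I \<times> I). {X. X p = 0}) \<inter> {X. \<forall>i j. X (i, j) = X (j, i)} \<inter>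
          {X. \<forall>x. 0 \<le> bf I X x x} \<inter> {X. (\<Sum>i\<in>I. X (i, i)) = 1}"
        by (auto simp: S_def vecs_on_def symf_def)
      also have "closed \<dots>"
        unfolding bf_def
        by (intro closed_Int closed_INT ballI closed_Collect_all closed_Collect_eq closed_Collect_le
            continuous_intros)
      finally show ?thesis .
    qed
    ultimately show ?thesis using compact_Int_closed[OF compact_cube[of 1]] by metis
  qed
  obtain e where e: "orthonormal (I \<times> I) (edim (I \<times> I) L) e" "\<And>a. a < edim (I \<times> I) L \<Longrightarrow> e a \<in> L"
    "\<And>x. x \<in> L \<Longrightarrow> proj (I \<times> I) (edim (I \<times> I) L) e x = x"
    using orthonormal_basis[OF fin2 L] by blast
  define P where "P = proj (I \<times> I) (edim (I \<times> I) L) e"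
  \<comment> \<open>The squared length of \<open>res X\<close> is the squared distance from
    \<open>X\<close> to \<open>L\<close>.\<close>
  define res where "res = (\<lambda>X p. X p - P X p)"
  have resres: "ip (I \<times> I) (res X) (res Y) = ip (I \<times> I) (res X) Y" for X Y
    unfolding res_def P_def by (rule ip_residual_residual[OF e(1)])
  have PL: "P X \<in> L" for X unfolding P_def by (rule lin_sub_proj[OF L e(2)])
  have "S \<noteq> {}"
  proof -
    obtain i where "i \<in> I" using False by blast
    have "(\<lambda>a. if a = i then 1 else 0::real) \<in> vecs_on I" using \<open>i \<in> I\<close> by (auto simp: vecs_on_def)
    from outer[OF this] show ?thesis using ip_delta[OF fin \<open>i \<in> I\<close>] by auto
  qed
  moreover have "continuous_on S (\<lambda>X. ip (I \<times> I) (res X) (res X))"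
    unfolding res_def P_def proj_def by (intro continuous_intros)
  ultimately obtain X0 where X0: "X0 \<in> S"
    and min: "\<And>X. X \<in> S \<Longrightarrow> ip (I \<times> I) (res X0) (res X0) \<le> ip (I \<times> I) (res X) (res X)"
    using continuous_attains_inf[OF \<open>compact S\<close>] by blast
  \<comment> \<open>A vanishing distance would put a psd matrix of trace one into \<open>L\<close>,
    contradicting \<open>no_psd\<close>.\<close>
  have nz: "res X0 \<noteq> (\<lambda>_. 0)"
  proof
    assume "res X0 = (\<lambda>_. 0)"
    then have "X0 = P X0" by (auto simp: res_def fun_eq_iff)
    then have "X0 \<in> L" using PL by metis
    then have "X0 = (\<lambda>_. 0)" using no_psd X0 by (simp add: S_def)
    then show False using X0 by (simp add: S_def)
  qed
  have vec: "res X0 \<in> vecs_on (I \<times> I)"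
    using X0 lin_sub_vecs_on[OF L PL] by (auto simp: S_def res_def vecs_on_def)
  have pos: "0 < ip (I \<times> I) (res X0) X" if X: "X \<in> S" for X
  proof -
    define D where "D = (\<lambda>p. X p - X0 p)"
    \<comment> \<open>Variational inequality: \<open>S\<close> is convex, so \<open>X0\<close>
      minimizes the distance along the segment towards \<open>X\<close>, and the derivative at
      \<open>X0\<close> is nonnegative.\<close>
    have "0 \<le> ip (I \<times> I) (res X0) (res D)"
    proof (rule linear_coeff_nonneg)
      fix t :: real assume t: "0 < t" "t \<le> 1"
      have bft: "bf I (\<lambda>p. X0 p + t * D p) x x = (1 - t) * bf I X0 x x + t * bf I X x x" for x
      proof -
        have "bf I D x x = bf I X x x - bf I X0 x x"
          unfolding D_def using bf_lin_mat[of I X "-1" X0 x x] by simp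
        then show ?thesis unfolding bf_lin_mat by (simp only:) (simp add: algebra_simps)
      qed
      have "0 \<le> bf I (\<lambda>p. X0 p + t * D p) x x" for x
        unfolding bft using X0 X t by (simp add: S_def)
      moreover have "(\<Sum>i\<in>I. X0 (i, i) + t * D (i, i)) = 1"
        using X0 X by (simp add: S_def D_def sum.distrib sum_distrib_left[symmetric] sum_subtractf)
      moreover have "(\<lambda>p. X0 p + t * D p) \<in> vecs_on (I \<times> I)" "symf (\<lambda>p. X0 p + t * D p)"
        using X0 X by (simp_all add: S_def D_def vecs_on_def symf_def)
      ultimately have "(\<lambda>p. X0 p + t * D p) \<in> S" by (simp add: S_def)
      from min[OF this]
      have "ip (I \<times> I) (res X0) (res X0) \<le>
        ip (I \<times> I) (\<lambda>p. res X0 p + t * res D p) (\<lambda>p. res X0 p + t * res D p)"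
        unfolding res_def P_def proj_add by (simp add: algebra_simps)
      then show "0 \<le> 2 * t * ip (I \<times> I) (res X0) (res D) + t\<^sup>2 * ip (I \<times> I) (res D) (res D)"
        unfolding ip_expand by simp
    qed
    then have "0 \<le> ip (I \<times> I) D (res X0)"
      using resres[of X0 D] ip_commute[of "I \<times> I" D "res X0"] by simp
    then have "ip (I \<times> I) X0 (res X0) \<le> ip (I \<times> I) X (res X0)"
      unfolding D_def ip_diff_left by simp
    moreover have "0 < ip (I \<times> I) X0 (res X0)"
      using ip_pos[OF fin2 vec nz] resres[of X0 X0] ip_commute[of "I \<times> I" X0 "res X0"] by simp
    ultimately show ?thesis using ip_commute[of "I \<times> I" X "res X0"] by simp
  qed
  show ?thesis
  proof (rule that[OF vec])
    show "symf (res X0)" using X0 Lsym[OF PL] by (simp add: S_def res_def symf_def)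
    fix x :: "'a \<Rightarrow> real" assume x: "x \<in> vecs_on I" "x \<noteq> (\<lambda>_. 0)"
    define c where "c = 1 / sqrt (ip I x x)"
    have ipx: "0 < ip I x x" by (rule ip_pos[OF fin x])
    then have "c > 0" by (simp add: c_def)
    have "ip I (\<lambda>i. c * x i) (\<lambda>i. c * x i) = c * c * ip I x x"
      by (simp add: ip_def sum_distrib_left algebra_simps)
    also have "\<dots> = 1" using ipx by (simp add: c_def)
    finally have "ip I (\<lambda>i. c * x i) (\<lambda>i. c * x i) = 1" .
    moreover have "(\<lambda>i. c * x i) \<in> vecs_on I" using x by (simp add: vecs_on_def)
    \<comment> \<open>For a unit vector the outer product with itself lies in \<open>S\<close>, and
      pairing with it evaluates the form.\<close>
    ultimately have "0 < bf I (res X0) (\<lambda>i. c * x i) (\<lambda>i. c * x i)"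
      unfolding bf_eq_ip using pos outer by blast
    then show "0 < bf I (res X0) x x"
      unfolding bf_scale_left bf_scale_right using \<open>c > 0\<close> by (simp add: zero_less_mult_iff)
  next
    fix a assume "a \<in> L"
    then have "res a = (\<lambda>_. 0)" using e(3) by (simp add: res_def P_def)
    then show "ip (I \<times> I) (res X0) a = 0" using resres[of X0 a] by simp
  qed
qed

section \<open>Flags cut out by facial reduction\<close>

text \<open>\<open>zset I E as i\<close> is the space that spans the face left by the first \<open>i\<close> members of a sequence.\<close>

definition zset :: "'i set \<Rightarrow> ('i \<Rightarrow> real) set \<Rightarrow> (nat \<Rightarrow> 'i \<times> 'i \<Rightarrow> real) \<Rightarrow> nat \<Rightarrow> ('i \<Rightarrow> real) set" where
  "zset I E as i = {x \<in> E. \<forall>j<i. bf I (as j) x x = 0}"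

text \<open>This is the coordinate-free core of regularity: each form is psd on the space left by
  its predecessors. Diagonal blocks appear only after a basis adapted to the flag has been
  chosen.\<close>

definition frs :: "'i set \<Rightarrow> ('i \<Rightarrow> real) set \<Rightarrow> (nat \<Rightarrow> 'i \<times> 'i \<Rightarrow> real) \<Rightarrow> nat \<Rightarrow> bool" where
  "frs I E as k \<longleftrightarrow> (\<forall>i<k. symf (as i) \<and> (\<forall>x\<in>zset I E as i. 0 \<le> bf I (as i) x x))"

lemma zset_0 [simp]: "zset I E as 0 = E"
  by (simp add: zset_def)

lemma zset_Suc: "zset I E as (Suc i) = {x \<in> zset I E as i. bf I (as i) x x = 0}"
  by (auto simp: zset_def less_Suc_eq)

lemma zset_antimono: "i \<le> j \<Longrightarrow> zset I E as j \<subseteq> zset I E as i"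
  by (auto simp: zset_def)

lemma zset_subset: "zset I E as i \<subseteq> E"
  by (auto simp: zset_def)

text \<open>By \<open>psd_kernel\<close> the null vectors of a psd form are the vectors of its
  kernel, and these are closed under linear combinations.\<close>

lemma lin_sub_zero_set:
  assumes "lin_sub I E" "symf a" "\<And>x. x \<in> E \<Longrightarrow> 0 \<le> bf I a x x"
  shows "lin_sub I {x \<in> E. bf I a x x = 0}"
  unfolding lin_sub_def
proof (intro conjI ballI allI)
  show "{x \<in> E. bf I a x x = 0} \<subseteq> vecs_on I" using lin_sub_vecs_on[OF assms(1)] by blast
  show "(\<lambda>_. 0) \<in> {x \<in> E. bf I a x x = 0}" using lin_sub_zero[OF assms(1)] by simp
  fix x y c assume x: "x \<in> {x \<in> E. bf I a x x = 0}" and y: "y \<in> {x \<in> E. bf I a x x = 0}"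
  have "bf I a x y = 0" using psd_kernel[OF assms] x y by blast
  then have "bf I a (\<lambda>i. x i + c * y i) (\<lambda>i. x i + c * y i) = 0"
    using x y unfolding bf_expand[OF assms(2)] by simp
  then show "(\<lambda>i. x i + c * y i) \<in> {x \<in> E. bf I a x x = 0}"
    using lin_sub_add[OF assms(1)] x y by blast
qed

lemma lin_sub_zset:
  assumes "lin_sub I E" "frs I E as k" "i \<le> k"
  shows "lin_sub I (zset I E as i)"
  using assms(3)
proof (induction i)
  case (Suc i)
  then show ?case
    unfolding zset_Suc using assms(2) by (intro lin_sub_zero_set) (auto simp: frs_def)
qed (simp add: assms(1))

lemma zset_case_nat:
  "zset I E (case_nat a as) (Suc i) = zset I {x \<in> E. bf I a x x = 0} as i"
  by (auto simp: zset_def split: nat.split)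

section \<open>Diagonalizing two flags by one pair of dual bases\<close>

lemma bf_outer_sum: "bf I (\<lambda>(i, j). \<Sum>a\<in>S. h a i * h a j) x y = (\<Sum>a\<in>S. ip I x (h a) * ip I y (h a))"
proof -
  have "(\<lambda>(i, j). \<Sum>a\<in>S. h a i * h a j) = (\<lambda>p. \<Sum>a\<in>S. 1 * (\<lambda>(i, j). h a i * h a j) p)" by auto
  then show ?thesis
    unfolding bf_eq_ip by (simp only: ip_sum_left) (simp add: bf_eq_ip[symmetric] bf_outer ip_commute)
qed

lemma ip_scale_right: "ip I z (\<lambda>i. c * x i) = c * ip I z x"
  by (simp add: ip_def sum_distrib_left algebra_simps)

text \<open>The pair maximizes the squared pairing divided by the product of the two forms, as a top
  singular pair does. At a maximizer, any direction that leaves the pairing unchanged to first order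
  is orthogonal for the respective form.\<close>

lemma singular_pair:
  assumes fin: "finite I" and W: "lin_sub I W" and D: "lin_sub I D"
    and sa: "symf a" and sy: "symf y"
    and posa: "\<And>x. x \<in> W \<Longrightarrow> x \<noteq> (\<lambda>_. 0) \<Longrightarrow> 0 < bf I a x x"
    and psdy: "\<And>x. x \<in> D \<Longrightarrow> 0 \<le> bf I y x x"
    and null: "\<And>g w. g \<in> D \<Longrightarrow> bf I y g g = 0 \<Longrightarrow> w \<in> W \<Longrightarrow> ip I g w = 0"
    and g0: "g0 \<in> D" and w0: "w0 \<in> W" and nz: "ip I g0 w0 \<noteq> 0"
  obtains e f where "e \<in> W" "f \<in> D" "ip I f e = 1"
    "\<And>v. v \<in> W \<Longrightarrow> ip I f v = 0 \<Longrightarrow> bf I a e v = 0"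
    "\<And>g. g \<in> D \<Longrightarrow> ip I g e = 0 \<Longrightarrow> bf I y f g = 0"
proof -
  define N where "N = {g \<in> D. bf I y g g = 0}"
  have N: "lin_sub I N" unfolding N_def by (rule lin_sub_zero_set[OF D sy psdy])
  obtain h where h: "orthonormal I (edim I N) h" "\<And>a. a < edim I N \<Longrightarrow> h a \<in> N"
    "\<And>x. x \<in> N \<Longrightarrow> proj I (edim I N) h x = x"
    using orthonormal_basis[OF fin N] by blast
  define m where "m = edim I N"
  note h = h[folded m_def]
  \<comment> \<open>\<open>y\<close> need not be definite on \<open>D\<close>; adding the projection onto its kernel \<open>N\<close> repairs this, and the
    extra term vanishes at the maximizer because \<open>N\<close> annihilates \<open>W\<close>.\<close>
  define y' where "y' = (\<lambda>p. y p + 1 * (\<lambda>(i, j). \<Sum>\<alpha><m. h \<alpha> i * h \<alpha> j) p)"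
  have y': "bf I y' x z = bf I y x z + (\<Sum>\<alpha><m. ip I x (h \<alpha>) * ip I z (h \<alpha>))" for x z
    unfolding y'_def bf_lin_mat bf_outer_sum by simp
  have sy': "symf y'" using sy by (simp add: y'_def symf_def mult.commute)
  have posy: "0 < bf I y' x x" if x: "x \<in> D" "x \<noteq> (\<lambda>_. 0)" for x
  proof -
    have nn: "0 \<le> (\<Sum>\<alpha><m. ip I x (h \<alpha>) * ip I x (h \<alpha>))" by (simp add: sum_nonneg)
    show ?thesis
    proof (rule ccontr)
      assume "\<not> 0 < bf I y' x x"
      then have z: "bf I y x x = 0" "(\<Sum>\<alpha><m. ip I x (h \<alpha>) * ip I x (h \<alpha>)) = 0"
        using psdy[OF x(1)] nn by (auto simp: y')
      then have "x \<in> N" using x by (simp add: N_def)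
      have "ip I x (h \<alpha>) = 0" if "\<alpha> < m" for \<alpha>
        using z(2) that by (simp add: sum_nonneg_eq_0_iff)
      then have "proj I m h x = (\<lambda>_. 0)" by (simp add: proj_def)
      then show False using h(3)[OF \<open>x \<in> N\<close>] x(2) by simp
    qed
  qed
  \<comment> \<open>The quotient is homogeneous of degree zero in either vector, so its maximum over
    the product of two compact spheres is a global one.\<close>
  define \<phi> where "\<phi> = (\<lambda>z. (ip I (snd z) (fst z))\<^sup>2 / (bf I a (fst z) (fst z) * bf I y' (snd z) (snd z)))"
  define K where "K = {x \<in> W. ip I x x = 1} \<times> {x \<in> D. ip I x x = 1}"
  have "compact K"
    unfolding K_def by (intro compact_Times compact_sphere fin W D)
  have normalize: "(\<lambda>i. x i / sqrt (ip I x x)) \<in> {x \<in> E. ip I x x = 1}"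
    if "lin_sub I E" "x \<in> E" "x \<noteq> (\<lambda>_. 0)" for x E
  proof -
    let ?c = "1 / sqrt (ip I x x)"
    have pos: "0 < ip I x x" by (rule ip_pos[OF fin lin_sub_vecs_on[OF that(1,2)] that(3)])
    have "ip I (\<lambda>i. ?c * x i) (\<lambda>i. ?c * x i) = ?c * ?c * ip I x x"
      by (simp only: ip_scale_left ip_scale_right mult.assoc)
    also have "\<dots> = 1" using pos by simp
    finally have "ip I (\<lambda>i. ?c * x i) (\<lambda>i. ?c * x i) = 1" .
    then show ?thesis using lin_sub_scale[OF that(1,2), of ?c] by simp
  qed
  have nzW: "x \<noteq> (\<lambda>_. 0)" if "ip I x x = 1" for x using that by auto
  have posK: "0 < bf I a (fst z) (fst z)" "0 < bf I y' (snd z) (snd z)" if "z \<in> K" for z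
    using that posa posy nzW by (auto simp: K_def)
  have w0nz: "w0 \<noteq> (\<lambda>_. 0)" "g0 \<noteq> (\<lambda>_. 0)" using nz by auto
  have "K \<noteq> {}"
    using normalize[OF W w0 w0nz(1)] normalize[OF D g0 w0nz(2)] unfolding K_def by blast
  have c1: "continuous_on K (\<lambda>z. fst z i)" "continuous_on K (\<lambda>z. snd z i)" for i
    by (rule continuous_on_product_then_coordinatewise, intro continuous_intros)+
  have "continuous_on K \<phi>"
    unfolding \<phi>_def
  proof (intro continuous_on_divide)
    show "continuous_on K (\<lambda>z. (ip I (snd z) (fst z))\<^sup>2)" by (intro continuous_intros c1)
    show "continuous_on K (\<lambda>z. bf I a (fst z) (fst z) * bf I y' (snd z) (snd z))"
      unfolding bf_def by (intro continuous_intros c1)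
    show "\<forall>z\<in>K. bf I a (fst z) (fst z) * bf I y' (snd z) (snd z) \<noteq> 0"
      using posK by (metis less_numeral_extra(3) mult_pos_pos)
  qed
  then obtain z where z: "z \<in> K" and max: "\<And>z'. z' \<in> K \<Longrightarrow> \<phi> z' \<le> \<phi> z"
    using continuous_attains_sup[OF \<open>compact K\<close> \<open>K \<noteq> {}\<close>] by blast
  define e f \<mu> where "e = fst z" and "f = snd z" and "\<mu> = \<phi> z"
  have eW: "e \<in> W" and fD: "f \<in> D" using z by (auto simp: K_def e_def f_def)
  have pe: "0 < bf I a e e" and pf: "0 < bf I y' f f" using posK[OF z] by (auto simp: e_def f_def)
  have eq: "(ip I f e)\<^sup>2 = \<mu> * (bf I a e e * bf I y' f f)"
    using pe pf by (simp add: \<mu>_def \<phi>_def e_def f_def)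
  \<comment> \<open>Both sides are quadratic in either vector; rescaling therefore carries the bound
    from the spheres to all of \<open>W\<close> and \<open>D\<close>.\<close>
  have le: "(ip I g v)\<^sup>2 \<le> \<mu> * (bf I a v v * bf I y' g g)" if v: "v \<in> W" and g: "g \<in> D" for v g
  proof (cases "v = (\<lambda>_. 0) \<or> g = (\<lambda>_. 0)")
    case True
    then show ?thesis by auto
  next
    case False
    define c d where "c = 1 / sqrt (ip I v v)" and "d = 1 / sqrt (ip I g g)"
    have "c > 0" "d > 0"
      using False ip_pos[OF fin lin_sub_vecs_on[OF W v]] ip_pos[OF fin lin_sub_vecs_on[OF D g]]
      by (auto simp: c_def d_def)
    have "((\<lambda>i. c * v i), (\<lambda>i. d * g i)) \<in> K"
      unfolding K_def c_def d_def using normalize[OF W v] normalize[OF D g] False by simp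
    from max[OF this] have "\<phi> ((\<lambda>i. c * v i), (\<lambda>i. d * g i)) \<le> \<mu>" by (simp add: \<mu>_def)
    moreover have "\<phi> ((\<lambda>i. c * v i), (\<lambda>i. d * g i)) = (ip I g v)\<^sup>2 / (bf I a v v * bf I y' g g)"
    proof -
      have "ip I (\<lambda>i. d * g i) (\<lambda>i. c * v i) = d * c * ip I g v"
        by (simp add: ip_def sum_distrib_left algebra_simps)
      then show ?thesis using \<open>c > 0\<close> \<open>d > 0\<close>
        by (simp add: \<phi>_def bf_scale_left bf_scale_right power2_eq_square)
    qed
    moreover have "0 < bf I a v v * bf I y' g g" using False posa[OF v] posy[OF g] by simp
    ultimately show ?thesis by (simp add: divide_le_eq)
  qed
  have "0 < \<mu>"
  proof -
    have "0 < (ip I g0 w0)\<^sup>2" using nz by simp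
    also have "\<dots> \<le> \<mu> * (bf I a w0 w0 * bf I y' g0 g0)" by (rule le[OF w0 g0])
    finally have "0 < \<mu> * (bf I a w0 w0 * bf I y' g0 g0)" .
    moreover have "0 < bf I a w0 w0 * bf I y' g0 g0" using posa[OF w0] posy[OF g0] w0nz by simp
    ultimately show ?thesis by (simp add: zero_less_mult_iff)
  qed
  have nzfe: "ip I f e \<noteq> 0" using eq \<open>0 < \<mu>\<close> pe pf by auto
  \<comment> \<open>Replacing e by e + t v leaves the left side of \<open>le\<close> unchanged when
    f annihilates v, and equality holds at t = 0; the linear term in t must vanish.\<close>
  have orth_a: "bf I a e v = 0" if v: "v \<in> W" "ip I f v = 0" for v
  proof -
    have "\<mu> * bf I y' f f * bf I a e v = 0"
    proof (rule linear_coeff_zero)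
      fix t
      have "ip I f (\<lambda>i. e i + t * v i) = ip I f e + t * ip I f v"
        by (subst (1 2 3) ip_commute) (rule ip_add_left)
      then show "0 \<le> 2 * t * (\<mu> * bf I y' f f * bf I a e v) + t\<^sup>2 * (\<mu> * bf I y' f f * bf I a v v)"
        using le[OF lin_sub_add[OF W eW v(1), of t] fD] v(2) eq
        unfolding bf_expand[OF sa] by (simp add: algebra_simps)
    qed
    then show ?thesis using \<open>0 < \<mu>\<close> pf by simp
  qed
  have orth_y': "bf I y' f g = 0" if g: "g \<in> D" "ip I g e = 0" for g
  proof -
    have "\<mu> * bf I a e e * bf I y' f g = 0"
    proof (rule linear_coeff_zero)
      fix t
      show "0 \<le> 2 * t * (\<mu> * bf I a e e * bf I y' f g) + t\<^sup>2 * (\<mu> * bf I a e e * bf I y' g g)"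
        using le[OF eW lin_sub_add[OF D fD g(1), of t]] g(2) eq
        unfolding bf_expand[OF sy'] ip_add_left by (simp add: algebra_simps)
    qed
    then show ?thesis using \<open>0 < \<mu>\<close> pe by simp
  qed
  \<comment> \<open>A null vector \<open>h \<alpha>\<close> annihilates \<open>e\<close>, so
    \<open>orth_y'\<close> applies to it. As \<open>y\<close> also vanishes against it, only the
    added projection term is left, namely the coefficient of \<open>f\<close> at
    \<open>h \<alpha>\<close>. From here on \<open>y'\<close> and \<open>y\<close> agree on
    \<open>f\<close>.\<close>
  have fh: "ip I f (h \<alpha>) = 0" if \<alpha>: "\<alpha> < m" for \<alpha>
  proof -
    have hN: "h \<alpha> \<in> D" "bf I y (h \<alpha>) (h \<alpha>) = 0" using h(2)[OF \<alpha>] by (auto simp: N_def)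
    have "bf I y f (h \<alpha>) = 0"
      using psd_kernel[OF D sy psdy hN fD] bf_commute[OF sy] by metis
    moreover have "bf I y' f (h \<alpha>) = 0" by (rule orth_y'[OF hN(1) null[OF hN eW]])
    moreover have "(\<Sum>\<beta><m. ip I f (h \<beta>) * ip I (h \<alpha>) (h \<beta>)) = (\<Sum>\<beta><m. if \<beta> = \<alpha> then ip I f (h \<beta>) else 0)"
      using h(1) \<alpha> by (intro sum.cong) (auto simp: orthonormal_def)
    ultimately show ?thesis using \<alpha> by (simp add: y')
  qed
  define c where "c = 1 / ip I f e"
  show ?thesis
  proof (rule that[of e "\<lambda>i. c * f i"])
    show "ip I (\<lambda>i. c * f i) e = 1" unfolding ip_scale_left using nzfe by (simp add: c_def)
    show "bf I a e v = 0" if "v \<in> W" "ip I (\<lambda>i. c * f i) v = 0" for v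
      using orth_a[OF that(1)] that(2) nzfe unfolding ip_scale_left by (simp add: c_def)
    show "bf I y (\<lambda>i. c * f i) g = 0" if "g \<in> D" "ip I g e = 0" for g
      using orth_y'[OF that] fh by (simp add: bf_scale_left y')
  qed (use eW fD lin_sub_scale[OF D] in auto)
qed

text \<open>Vector \<open>t\<close> is meant for the block of stage \<open>\<iota> t\<close>. In the
  matrix of form \<open>i\<close> only rows and columns of stage at least \<open>i\<close> are
  constrained; there the sole nonzero entries are the diagonal ones of stage exactly
  \<open>i\<close>.\<close>

definition diag_system :: "'i set \<Rightarrow> (nat \<Rightarrow> 'i \<times> 'i \<Rightarrow> real) \<Rightarrow> (nat \<Rightarrow> nat) \<Rightarrow> (nat \<Rightarrow> 'i \<Rightarrow> real) \<Rightarrow> nat \<Rightarrow> bool" where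
  "diag_system I as \<iota> e q \<longleftrightarrow>
     (\<forall>t<q. 0 < bf I (as (\<iota> t)) (e t) (e t)) \<and>
     (\<forall>t<q. \<forall>u<q. \<forall>i. i \<le> \<iota> t \<longrightarrow> i \<le> \<iota> u \<longrightarrow> \<not> (t = u \<and> i = \<iota> t) \<longrightarrow> bf I (as i) (e t) (e u) = 0)"

text \<open>Below stage \<open>i0\<close> the new vector is a null vector of a psd form, hence in
  its kernel; at stage \<open>i0\<close> the hypothesis \<open>orth\<close> gives the zeros; above
  it nothing is demanded.\<close>

lemma diag_system_extend:
  assumes sys: "diag_system I as \<iota> e q" and H: "lin_sub I H" and frs: "frs I H as k"
    and H1: "H1 \<subseteq> H" and e: "\<And>t. t < q \<Longrightarrow> e t \<in> zset I H1 as (\<iota> t)"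
    and i0: "i0 < k" and x: "x \<in> zset I H as i0" "0 < bf I (as i0) x x"
    and orth: "\<And>v. v \<in> zset I H as i0 \<Longrightarrow> v \<in> H1 \<Longrightarrow> bf I (as i0) x v = 0"
  shows "diag_system I as (\<iota>(q := i0)) (e(q := x)) (Suc q)"
proof -
  have new: "bf I (as i) x v = 0" if i: "i < i0" and v: "v \<in> zset I H as i" for i v
  proof -
    have "x \<in> zset I H as (Suc i)" using x(1) zset_antimono[of "Suc i" i0 I H as] i by auto
    then have x': "x \<in> zset I H as i" "bf I (as i) x x = 0" by (auto simp: zset_Suc)
    have "i < k" using i i0 by simp
    then have "symf (as i)" "\<And>x. x \<in> zset I H as i \<Longrightarrow> 0 \<le> bf I (as i) x x"
      using frs by (auto simp: frs_def)
    then show ?thesis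
      using psd_kernel[OF lin_sub_zset[OF H frs, of i] _ _ x' v] \<open>i < k\<close> by simp
  qed
  have cross: "bf I (as i) x (e t) = 0 \<and> bf I (as i) (e t) x = 0"
    if t: "t < q" and i: "i \<le> \<iota> t" "i \<le> i0" for t i
  proof -
    have "e t \<in> zset I H1 as i" using e[OF t] zset_antimono[OF i(1)] by blast
    then have et: "e t \<in> zset I H as i" "e t \<in> H1" using H1 by (auto simp: zset_def)
    have "bf I (as i) x (e t) = 0"
      using new[OF _ et(1)] orth[OF _ et(2)] et(1) i(2) by (cases "i = i0") auto
    moreover have "symf (as i)" using frs i i0 by (auto simp: frs_def)
    ultimately show ?thesis using bf_commute by metis
  qed
  show ?thesis
    unfolding diag_system_def
  proof (intro conjI allI impI)
    fix t assume "t < Suc q"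
    then show "0 < bf I (as ((\<iota>(q := i0)) t)) ((e(q := x)) t) ((e(q := x)) t)"
      using sys x(2) by (auto simp: diag_system_def less_Suc_eq)
  next
    fix t u i
    assume tu: "t < Suc q" "u < Suc q" "i \<le> (\<iota>(q := i0)) t" "i \<le> (\<iota>(q := i0)) u"
      "\<not> (t = u \<and> i = (\<iota>(q := i0)) t)"
    then consider "t < q" "u < q" | "t = q" "u < q" | "t < q" "u = q" | "t = q" "u = q" by linarith
    then show "bf I (as i) ((e(q := x)) t) ((e(q := x)) u) = 0"
    proof cases
      case 1
      then show ?thesis using sys tu by (auto simp: diag_system_def)
    next
      case 4
      then have "i < i0" using tu by auto
      then show ?thesis
        using new[of i x] x(1) zset_antimono[of i i0 I H as] 4 by auto
    qed (use cross tu in auto)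
  qed
qed

lemma frs_subset:
  assumes "frs I H as k" "H1 \<subseteq> H"
  shows "frs I H1 as k"
  using assms unfolding frs_def zset_def by blast

lemma lin_sub_perp:
  assumes "lin_sub I H"
  shows "lin_sub I {v \<in> H. ip I f v = 0}"
proof -
  have "ip I f (\<lambda>i. x i + c * y i) = ip I f x + c * ip I f y" for x y c
    by (subst (1 2 3) ip_commute) (rule ip_add_left)
  then show ?thesis
    using assms unfolding lin_sub_def by auto
qed

text \<open>Induction on the dimension of \<open>H\<close>. Splitting off a pair (x, z) replaces
  \<open>H\<close> by the vectors annihilated by z and \<open>H'\<close> by those annihilated by x.
  Only \<open>H'\<close> separating the points of \<open>H\<close> is carried along, so
  \<open>H'\<close> may be larger, and the expansion is claimed on \<open>H\<close> alone.\<close>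

lemma simultaneous_diagonalization:
  assumes fin: "finite I"
  shows "lin_sub I H \<Longrightarrow> lin_sub I H' \<Longrightarrow> frs I H as k \<Longrightarrow> zset I H as k = {\<lambda>_. 0} \<Longrightarrow>
    frs I H' ys l \<Longrightarrow> zset I H' ys l = {\<lambda>_. 0} \<Longrightarrow>
    \<forall>v\<in>H. (\<forall>g\<in>H'. ip I g v = 0) \<longrightarrow> v = (\<lambda>_. 0) \<Longrightarrow>
    \<exists>q e f \<iota> \<kappa>.
      (\<forall>t<q. e t \<in> zset I H as (\<iota> t) \<and> \<iota> t < k \<and> f t \<in> zset I H' ys (\<kappa> t) \<and> \<kappa> t < l) \<and>
      (\<forall>t<q. \<forall>u<q. ip I (f t) (e u) = (if t = u then 1 else 0)) \<and>
      (\<forall>v\<in>H. v = (\<lambda>i. \<Sum>t<q. ip I (f t) v * e t i)) \<and>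
      diag_system I as \<iota> e q \<and> diag_system I ys \<kappa> f q"
proof (induction "edim I H" arbitrary: H H' rule: less_induct)
  case less
  note H = less.prems(1) and H' = less.prems(2) and frs = less.prems(3) and za = less.prems(4)
    and frs' = less.prems(5) and zy = less.prems(6)
  have dual: "v = (\<lambda>_. 0)" if "v \<in> H" "\<And>g. g \<in> H' \<Longrightarrow> ip I g v = 0" for v
    using less.prems(7) that by blast
  show ?case
  proof (cases "H = {\<lambda>_. 0}")
    case True
    then show ?thesis
      by (intro exI[of _ 0]) (auto simp: diag_system_def)
  next
    case False
    \<comment> \<open>The next kernel being zero, form \<open>as i0\<close> is positive definite on
      the kernel at \<open>i0\<close>.\<close>
    define i0 where "i0 = Max {i. i \<le> k \<and> zset I H as i \<noteq> {\<lambda>_. 0}}"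
    have finI: "finite {i. i \<le> k \<and> zset I H as i \<noteq> {\<lambda>_. 0}}" by simp
    have "0 \<in> {i. i \<le> k \<and> zset I H as i \<noteq> {\<lambda>_. 0}}" using False by simp
    then have "i0 \<in> {i. i \<le> k \<and> zset I H as i \<noteq> {\<lambda>_. 0}}"
      unfolding i0_def by (intro Max_in finI) blast
    then have i0: "i0 < k" "zset I H as i0 \<noteq> {\<lambda>_. 0}" using za le_neq_implies_less by blast+
    have i0s: "zset I H as (Suc i0) = {\<lambda>_. 0}"
      using Max_ge[OF finI, folded i0_def, of "Suc i0"] i0(1) by fastforce
    define W where "W = zset I H as i0"
    have W: "lin_sub I W" unfolding W_def using lin_sub_zset[OF H frs, of i0] i0(1) by simp
    have WH: "W \<subseteq> H" unfolding W_def by (rule zset_subset)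
    have symas: "symf (as i0)" and psdW: "\<And>x. x \<in> W \<Longrightarrow> 0 \<le> bf I (as i0) x x"
      using frs i0(1) by (auto simp: frs_def W_def)
    have posW: "0 < bf I (as i0) x x" if x: "x \<in> W" "x \<noteq> (\<lambda>_. 0)" for x
    proof -
      have "x \<notin> zset I H as (Suc i0)" using i0s x by simp
      then show ?thesis using psdW[OF x(1)] x(1) by (simp add: zset_Suc W_def)
    qed
    \<comment> \<open>Index 0 belongs to \<open>J\<close> because \<open>H'\<close> separates
      points, and \<open>l\<close> does not because the last kernel is zero; maximality of
      \<open>j0\<close> makes the kernel after it annihilate \<open>W\<close>.\<close>
    define J where "J = {j. j \<le> l \<and> (\<exists>g\<in>zset I H' ys j. \<exists>w\<in>W. ip I g w \<noteq> 0)}"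
    have finJ: "finite J" by (simp add: J_def)
    have "0 \<in> J"
    proof -
      obtain w where w: "w \<in> W" "w \<noteq> (\<lambda>_. 0)" using i0(2) lin_sub_zero[OF W] unfolding W_def by blast
      then have "\<exists>g\<in>H'. ip I g w \<noteq> 0" using dual[of w] WH by blast
      then show ?thesis using w by (auto simp: J_def)
    qed
    define j0 where "j0 = Max J"
    have "j0 \<in> J" unfolding j0_def using \<open>0 \<in> J\<close> by (intro Max_in finJ) blast
    then obtain g0 w0 where gw: "g0 \<in> zset I H' ys j0" "w0 \<in> W" "ip I g0 w0 \<noteq> 0" and "j0 \<le> l"
      by (auto simp: J_def)
    have j0: "j0 < l"
    proof (rule ccontr)
      assume "\<not> j0 < l"
      then have "j0 = l" using \<open>j0 \<le> l\<close> by simp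
      then show False using gw zy by simp
    qed
    have "Suc j0 \<notin> J"
    proof
      assume "Suc j0 \<in> J"
      then have "Suc j0 \<le> j0" unfolding j0_def by (rule Max_ge[OF finJ])
      then show False by simp
    qed
    then have null': "ip I g w = 0" if "g \<in> zset I H' ys (Suc j0)" "w \<in> W" for g w
      using that j0 by (auto simp: J_def)
    define D where "D = zset I H' ys j0"
    have D: "lin_sub I D" unfolding D_def using lin_sub_zset[OF H' frs', of j0] j0 by simp
    have DH: "D \<subseteq> H'" unfolding D_def by (rule zset_subset)
    have symys: "symf (ys j0)" and psdD: "\<And>x. x \<in> D \<Longrightarrow> 0 \<le> bf I (ys j0) x x"
      using frs' j0 by (auto simp: frs_def D_def)
    have null: "ip I g w = 0" if "g \<in> D" "bf I (ys j0) g g = 0" "w \<in> W" for g w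
      using null'[of g w] that by (simp add: zset_Suc D_def)
    obtain x z where xz: "x \<in> W" "z \<in> D" "ip I z x = 1"
      and ox: "\<And>v. v \<in> W \<Longrightarrow> ip I z v = 0 \<Longrightarrow> bf I (as i0) x v = 0"
      and oz: "\<And>g. g \<in> D \<Longrightarrow> ip I g x = 0 \<Longrightarrow> bf I (ys j0) z g = 0"
      using singular_pair[OF fin W D symas symys posW psdD null gw(1)[folded D_def] gw(2,3)] by blast
    define H1 H1' where "H1 = {v \<in> H. ip I z v = 0}" and "H1' = {g \<in> H'. ip I x g = 0}"
    have H1: "lin_sub I H1" "lin_sub I H1'" unfolding H1_def H1'_def by (rule lin_sub_perp[OF H], rule lin_sub_perp[OF H'])
    have sub: "H1 \<subseteq> H" "H1' \<subseteq> H'" by (auto simp: H1_def H1'_def)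
    have xH: "x \<in> H" and zH: "z \<in> H'" using xz WH DH by auto
    have zsets: "zset I H1 as k = {\<lambda>_. 0}" "zset I H1' ys l = {\<lambda>_. 0}"
      using za zy sub lin_sub_zero[OF H1(1)] lin_sub_zero[OF H1(2)] by (auto simp: zset_def)
    have "x \<notin> H1" using xz(3) by (simp add: H1_def)
    then have "H1 \<subset> H" using sub(1) xH by blast
    then have dim: "edim I H1 < edim I H" by (rule edim_less[OF fin H H1(1)])
    \<comment> \<open>Every \<open>g\<close> in \<open>H'\<close> is a member of \<open>H1'\<close>
      plus a multiple of \<open>z\<close>, and \<open>z\<close> annihilates \<open>H1\<close>, so
      separation is inherited.\<close>
    have dual1: "v = (\<lambda>_. 0)" if v: "v \<in> H1" "\<And>g. g \<in> H1' \<Longrightarrow> ip I g v = 0" for v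
    proof (rule dual)
      show "v \<in> H" using v(1) sub by blast
      fix g assume g: "g \<in> H'"
      have "ip I x (\<lambda>i. g i + (- ip I g x) * z i) = 0"
        using ip_add_left[of I g "- ip I g x" z x] xz(3) by (simp add: ip_commute)
      then have "(\<lambda>i. g i + (- ip I g x) * z i) \<in> H1'"
        using lin_sub_add[OF H' g zH] unfolding H1'_def by blast
      from v(2)[OF this] have "ip I g v - ip I g x * ip I z v = 0" by (simp only: ip_add_left)
      then show "ip I g v = 0" using v(1) by (simp add: H1_def)
    qed
    then have dual1': "\<forall>v\<in>H1. (\<forall>g\<in>H1'. ip I g v = 0) \<longrightarrow> v = (\<lambda>_. 0)" by blast
    from less.hyps[OF dim H1 frs_subset[OF frs sub(1)] zsets(1) frs_subset[OF frs' sub(2)] zsets(2) dual1']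
    obtain q e f \<iota> \<kappa> where
      e0: "\<forall>t<q. e t \<in> zset I H1 as (\<iota> t) \<and> \<iota> t < k \<and> f t \<in> zset I H1' ys (\<kappa> t) \<and> \<kappa> t < l"
      and bi0: "\<forall>t<q. \<forall>u<q. ip I (f t) (e u) = (if t = u then 1 else 0)"
      and span0: "\<forall>v\<in>H1. v = (\<lambda>i. \<Sum>t<q. ip I (f t) v * e t i)"
      and sys: "diag_system I as \<iota> e q" "diag_system I ys \<kappa> f q"
      by (elim exE conjE) (rule that, assumption+)
    note e = e0[rule_format] and bi = bi0[rule_format] and span = span0[rule_format]
    have eH1: "e t \<in> H1" and fH1: "f t \<in> H1'" if "t < q" for t using e[OF that] zset_subset by blast+
    have px: "0 < bf I (as i0) x x" using posW[OF xz(1)] xz(3) by fastforce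
    have pz: "0 < bf I (ys j0) z z"
      using psdD[OF xz(2)] null[OF xz(2) _ xz(1)] xz(3) by fastforce
    have sys1: "diag_system I as (\<iota>(q := i0)) (e(q := x)) (Suc q)"
      using xz(1) e ox by (intro diag_system_extend[OF sys(1) H frs sub(1) _ i0(1) _ px]) (auto simp: W_def H1_def)
    have sys2: "diag_system I ys (\<kappa>(q := j0)) (f(q := z)) (Suc q)"
      using xz(2) e oz
      by (intro diag_system_extend[OF sys(2) H' frs' sub(2) _ j0 _ pz]) (auto simp: D_def H1'_def ip_commute)
    have mem: "(e(q := x)) t \<in> zset I H as ((\<iota>(q := i0)) t) \<and> (\<iota>(q := i0)) t < k \<and>
        (f(q := z)) t \<in> zset I H' ys ((\<kappa>(q := j0)) t) \<and> (\<kappa>(q := j0)) t < l" if "t < Suc q" for t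
      using that e[of t] xz i0(1) j0 sub by (auto simp: less_Suc_eq W_def D_def zset_def)
    have bi1: "ip I ((f(q := z)) t) ((e(q := x)) u) = (if t = u then 1 else 0)"
      if "t < Suc q" "u < Suc q" for t u
      using that bi eH1 fH1 xz(3) by (auto simp: less_Suc_eq H1_def H1'_def ip_commute)
    have span1: "v = (\<lambda>i. \<Sum>t<Suc q. ip I ((f(q := z)) t) v * (e(q := x)) t i)" if v: "v \<in> H" for v
    proof -
      \<comment> \<open>Removing the component along \<open>x\<close> lands in \<open>H1\<close>;
        since each \<open>f t\<close> annihilates \<open>x\<close>, the other coefficients do not
        change.\<close>
      define w where "w = (\<lambda>i. v i + (- ip I z v) * x i)"
      have "ip I z w = 0"
        unfolding w_def using ip_add_left[of I v "- ip I z v" x z] xz(3) by (simp add: ip_commute)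
      then have "w \<in> H1" using lin_sub_add[OF H v xH] unfolding H1_def w_def by blast
      have fw: "ip I (f t) w = ip I (f t) v" if "t < q" for t
        unfolding w_def using ip_add_left[of I v "- ip I z v" x "f t"] fH1[OF that]
        by (simp add: ip_commute H1'_def)
      have "v i = (\<Sum>t<Suc q. ip I ((f(q := z)) t) v * (e(q := x)) t i)" for i
      proof -
        have "w i = (\<Sum>t<q. ip I (f t) v * e t i)"
          using fun_cong[OF span[OF \<open>w \<in> H1\<close>], of i] fw by simp
        then show ?thesis by (simp add: w_def)
      qed
      then show ?thesis by blast
    qed
    show ?thesis
    proof (rule exI[of _ "Suc q"], rule exI[of _ "e(q := x)"], rule exI[of _ "f(q := z)"],
        rule exI[of _ "\<iota>(q := i0)"], rule exI[of _ "\<kappa>(q := j0)"], intro conjI)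
      show "\<forall>v\<in>H. v = (\<lambda>i. \<Sum>t<Suc q. ip I ((f(q := z)) t) v * (e(q := x)) t i)"
        by (intro ballI span1)
    qed (use mem bi1 sys1 sys2 in blast)+
  qed
qed

section \<open>Existence of facial reduction sequences\<close>

definition diagf :: "'i set \<Rightarrow> ('i \<Rightarrow> real) \<Rightarrow> 'i \<times> 'i \<Rightarrow> real" where
  "diagf J d = (\<lambda>(i, j). if i = j \<and> i \<in> J then d i else 0)"

lemma ip_diagf:
  assumes "finite I" "J \<subseteq> I"
  shows "ip (I \<times> I) X (diagf J d) = (\<Sum>i\<in>J. X (i, i) * d i)"
proof -
  have "ip (I \<times> I) X (diagf J d) = (\<Sum>i\<in>I. \<Sum>j\<in>I. if j = i then (if i \<in> J then X (i, i) * d i else 0) else 0)"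
    unfolding ip_def sum.cartesian_product by (intro sum.cong) (auto simp: diagf_def)
  also have "\<dots> = (\<Sum>i\<in>I. if i \<in> J then X (i, i) * d i else 0)"
    using assms(1) by simp
  also have "\<dots> = (\<Sum>i\<in>J. X (i, i) * d i)"
    using assms by (simp add: sum.If_cases Int_absorb1)
  finally show ?thesis .
qed

lemma bf_diagf:
  assumes "finite I" "J \<subseteq> I"
  shows "bf I (diagf J d) x x = (\<Sum>i\<in>J. d i * (x i)\<^sup>2)"
  unfolding bf_eq_ip ip_commute[of _ "diagf J d"] ip_diagf[OF assms]
  by (simp add: power2_eq_square mult.commute)

lemma symf_diagf: "symf (diagf J d)"
  by (auto simp: symf_def diagf_def)

lemma lin_sub_vecs: "J \<subseteq> I \<Longrightarrow> lin_sub I (vecs_on J)"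
  by (auto simp: lin_sub_def vecs_on_def)

lemma ip_pairs: "ip (I \<times> I) X Y = (\<Sum>i\<in>I. \<Sum>j\<in>I. X (i, j) * Y (i, j))"
  unfolding ip_def sum.cartesian_product by (simp add: case_prod_unfold)

lemma bf_sum_sum:
  fixes d :: nat
  shows "bf I a (\<lambda>i. \<Sum>\<alpha><d. z \<alpha> * e \<alpha> i) (\<lambda>i. \<Sum>\<beta><d. w \<beta> * e \<beta> i)
    = (\<Sum>\<alpha><d. \<Sum>\<beta><d. bf I a (e \<alpha>) (e \<beta>) * z \<alpha> * w \<beta>)"
proof -
  have left: "bf I a (\<lambda>i. \<Sum>\<alpha><k. z \<alpha> * e \<alpha> i) y = (\<Sum>\<alpha><k. z \<alpha> * bf I a (e \<alpha>) y)" for y and k :: nat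
    by (induction k) (simp_all add: bf_add_left)
  have right: "bf I a y (\<lambda>i. \<Sum>\<alpha><k. w \<alpha> * e \<alpha> i) = (\<Sum>\<alpha><k. w \<alpha> * bf I a y (e \<alpha>))" for y and k :: nat
    by (induction k) (simp_all add: bf_add_right)
  show ?thesis unfolding left right by (simp add: sum_distrib_left algebra_simps)
qed

text \<open>This is B^T M B for the matrix B with rows \<open>e \<alpha>\<close>. It serves twice:
  it pushes a form from coordinates of a subspace into the full space, and it expresses congruence
  by a square matrix.\<close>

definition basis_form :: "nat \<Rightarrow> (nat \<Rightarrow> 'i \<Rightarrow> real) \<Rightarrow> (nat \<times> nat \<Rightarrow> real) \<Rightarrow> 'i \<times> 'i \<Rightarrow> real" where
  "basis_form d e M = (\<lambda>(i, j). \<Sum>\<alpha><d. \<Sum>\<beta><d. M (\<alpha>, \<beta>) * e \<alpha> i * e \<beta> j)"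

text \<open>Adjointness: pairing the pushed-forward \<open>M\<close> with \<open>a\<close> is
  pairing \<open>M\<close> with the restriction of \<open>a\<close> to the vectors
  \<open>e\<close>.\<close>

lemma ip_basis_form: "ip (I \<times> I) (basis_form d e M) a = (\<Sum>\<alpha><d. \<Sum>\<beta><d. M (\<alpha>, \<beta>) * bf I a (e \<alpha>) (e \<beta>))"
proof -
  have "basis_form d e M = (\<lambda>p. \<Sum>q\<in>{..<d} \<times> {..<d}. M q * (\<lambda>(i, j). e (fst q) i * e (snd q) j) p)"
    by (auto simp: basis_form_def sum.cartesian_product case_prod_unfold mult.assoc)
  then have "ip (I \<times> I) (basis_form d e M) a = (\<Sum>q\<in>{..<d} \<times> {..<d}. M q * bf I a (e (fst q)) (e (snd q)))"
    by (simp only: ip_sum_left bf_eq_ip ip_commute[of "I \<times> I" a])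
  then show ?thesis by (simp add: sum.cartesian_product case_prod_unfold)
qed

lemma bf_basis_form: "bf I (basis_form d e M) x y = bf {..<d} M (\<lambda>\<alpha>. ip I x (e \<alpha>)) (\<lambda>\<beta>. ip I y (e \<beta>))"
  unfolding bf_eq_ip[of I] ip_basis_form bf_outer by (simp add: bf_def mult.assoc)

lemma symf_basis_form: "symf M \<Longrightarrow> symf (basis_form d e M)"
proof -
  assume "symf M"
  then have M: "M (\<beta>, \<alpha>) = M (\<alpha>, \<beta>)" for \<alpha> \<beta> by (simp add: symf_def)
  show ?thesis
    unfolding symf_def basis_form_def
    by (simp, subst sum.swap, simp add: M[of _ _] mult.commute mult.left_commute)
qed

text \<open>One setting for both sides. For the primal, \<open>U\<close> is the span of the
  equations, \<open>R\<close> the block of \<open>Xs\<close> and \<open>J\<close> that of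
  \<open>Zs\<close>; for the dual, \<open>U\<close> is the symmetric orthogonal complement and the
  blocks change places. Assumption \<open>opt\<close> confines the optimal set to the face of
  \<open>R\<close>.\<close>

context
  fixes I J R :: "'i set" and U :: "('i \<times> 'i \<Rightarrow> real) set" and dx dz :: "'i \<Rightarrow> real"
  assumes fin: "finite I" and U: "lin_sub (I \<times> I) U" and Usym: "\<And>u. u \<in> U \<Longrightarrow> symf u"
    and RI: "R \<subseteq> I" and JI: "J \<subseteq> I" and RJ: "R \<inter> J = {}"
    and dx: "\<And>i. i \<in> R \<Longrightarrow> 0 < dx i"
    and opt: "\<And>X. X \<in> vecs_on (I \<times> I) \<Longrightarrow> symf X \<Longrightarrow> (\<And>x. 0 \<le> bf I X x x) \<Longrightarrow>
      (\<And>u. u \<in> U \<Longrightarrow> ip (I \<times> I) u X = ip (I \<times> I) u (diagf R dx)) \<Longrightarrow>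
      ip (I \<times> I) X (diagf J dz) = 0 \<Longrightarrow> X \<in> vecs_on (R \<times> R)"
begin

text \<open>Pairing with \<open>X\<close> vanishes wherever pairing with \<open>diagf R dx\<close>
  does, so on \<open>U\<close> it is a multiple \<rho> of it. Adding enough of
  \<open>diagf R dx\<close> and rescaling makes the multiple one, and \<open>opt\<close>
  applies.\<close>

lemma supported_of_perp:
  assumes X: "X \<in> vecs_on (I \<times> I)" "symf X" "\<And>x. 0 \<le> bf I X x x"
    and perp: "\<And>u. u \<in> U \<Longrightarrow> ip (I \<times> I) u (diagf R dx) = 0 \<Longrightarrow> ip (I \<times> I) u X = 0"
    and Z: "ip (I \<times> I) X (diagf J dz) = 0"
  shows "X \<in> vecs_on (R \<times> R)"
proof -
  let ?X0 = "diagf R dx"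
  have "\<exists>\<rho>. \<forall>u\<in>U. ip (I \<times> I) u X = \<rho> * ip (I \<times> I) u ?X0"
  proof (cases "\<forall>u\<in>U. ip (I \<times> I) u ?X0 = 0")
    case True
    then show ?thesis using perp by (intro exI[of _ 0]) auto
  next
    case False
    then obtain u0 where u0: "u0 \<in> U" "ip (I \<times> I) u0 ?X0 \<noteq> 0" by blast
    show ?thesis
    proof (intro exI ballI)
      fix u assume u: "u \<in> U"
      define c where "c = - ip (I \<times> I) u ?X0 / ip (I \<times> I) u0 ?X0"
      have "(\<lambda>p. u p + c * u0 p) \<in> U" by (rule lin_sub_add[OF U u u0(1)])
      moreover have "ip (I \<times> I) (\<lambda>p. u p + c * u0 p) ?X0 = 0"
        using u0(2) unfolding ip_add_left by (simp add: c_def)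
      ultimately have "ip (I \<times> I) (\<lambda>p. u p + c * u0 p) X = 0" by (rule perp)
      then show "ip (I \<times> I) u X = (ip (I \<times> I) u0 X / ip (I \<times> I) u0 ?X0) * ip (I \<times> I) u ?X0"
        using u0(2) unfolding ip_add_left by (simp add: c_def field_simps)
    qed
  qed
  then obtain \<rho> where \<rho>: "\<And>u. u \<in> U \<Longrightarrow> ip (I \<times> I) u X = \<rho> * ip (I \<times> I) u ?X0" by blast
  \<comment> \<open>The choice makes \<mu> nonnegative, as psd-ness needs, and \<rho> + \<mu> =
    |\<rho>| + 1 positive whatever the sign of \<rho>.\<close>
  define \<mu> c where "\<mu> = \<bar>\<rho>\<bar> + 1 - \<rho>" and "c = 1 / (\<bar>\<rho>\<bar> + 1)"
  have "\<mu> \<ge> 0" "c > 0" and c1: "c * (\<rho> + \<mu>) = 1" by (auto simp: \<mu>_def c_def)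
  define H where "H = (\<lambda>p. c * (X p + \<mu> * ?X0 p))"
  have X0v: "?X0 \<in> vecs_on (R \<times> R)" by (auto simp: vecs_on_def diagf_def)
  have "H \<in> vecs_on (R \<times> R)"
  proof (rule opt)
    show "H \<in> vecs_on (I \<times> I)" using X(1) RI by (auto simp: H_def vecs_on_def diagf_def)
    show "symf H" using X(2) symf_diagf[of R dx] by (simp add: H_def symf_def)
    show "0 \<le> bf I H x x" for x
    proof -
      have "bf I H x x = c * (bf I X x x + \<mu> * bf I ?X0 x x)"
        unfolding H_def using bf_lin_mat[of I "\<lambda>_. 0" c "\<lambda>p. X p + \<mu> * ?X0 p" x x]
        by (simp add: bf_lin_mat) (simp add: bf_def)
      moreover have "0 \<le> bf I ?X0 x x"
        unfolding bf_diagf[OF fin RI] using dx by (intro sum_nonneg) (simp add: less_imp_le)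
      ultimately show ?thesis using X(3) \<open>\<mu> \<ge> 0\<close> \<open>c > 0\<close> by simp
    qed
    have ipH: "ip (I \<times> I) H u = c * (ip (I \<times> I) X u + \<mu> * ip (I \<times> I) ?X0 u)" for u
      unfolding H_def ip_scale_left ip_add_left ..
    show "ip (I \<times> I) u H = ip (I \<times> I) u ?X0" if "u \<in> U" for u
    proof -
      have "ip (I \<times> I) u H = c * (\<rho> * ip (I \<times> I) u ?X0 + \<mu> * ip (I \<times> I) u ?X0)"
        using ipH[of u] \<rho>[OF that] by (simp add: ip_commute)
      also have "\<dots> = (c * (\<rho> + \<mu>)) * ip (I \<times> I) u ?X0" by (simp add: algebra_simps)
      finally show ?thesis by (simp add: c1)
    qed
    have "ip (I \<times> I) ?X0 (diagf J dz) = 0"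
      unfolding ip_diagf[OF fin JI] using RJ by (intro sum.neutral) (auto simp: diagf_def)
    then show "ip (I \<times> I) H (diagf J dz) = 0" using Z ipH by simp
  qed
  then show ?thesis
    using X0v \<open>c > 0\<close> unfolding vecs_on_def H_def by auto
qed

text \<open>If no such \<open>a\<close> existed, the restrictions to \<open>E\<close> would meet the
  psd cone only in zero. Gordan's alternative then gives a matrix positive definite on
  \<open>E\<close> and orthogonal to them, while \<open>supported_of_perp\<close> confines it to
  \<open>R\<close>; this is impossible when \<open>E\<close> is larger than the space of
  \<open>R\<close>.\<close>

lemma reducing_step:
  assumes E: "lin_sub I E" and RE: "vecs_on R \<subseteq> E" and EJ: "E \<subseteq> vecs_on (I - J)" and ne: "E \<noteq> vecs_on R"
  shows "\<exists>a\<in>U. ip (I \<times> I) a (diagf R dx) = 0 \<and>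
    (\<forall>x\<in>E. 0 \<le> bf I a x x) \<and> (\<exists>x\<in>E. bf I a x x \<noteq> 0)"
proof (rule ccontr)
  assume nex: "\<not> ?thesis"
  define L where "L = {u \<in> U. ip (I \<times> I) u (diagf R dx) = 0}"
  have zero: "bf I a x x = 0" if "a \<in> L" "\<And>x. x \<in> E \<Longrightarrow> 0 \<le> bf I a x x" "x \<in> E" for a x
    using that nex unfolding L_def by blast
  obtain e where e: "orthonormal I (edim I E) e" "\<And>a. a < edim I E \<Longrightarrow> e a \<in> E"
    "\<And>x. x \<in> E \<Longrightarrow> proj I (edim I E) e x = x"
    using orthonormal_basis[OF fin E] by blast
  define d where "d = edim I E"
  note e = e[folded d_def]
  \<comment> \<open>Gordan's alternative is stated for a full coordinate space, so forms on
    \<open>E\<close> are written in an orthonormal basis of \<open>E\<close>.\<close>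
  define restr where "restr = (\<lambda>a (\<alpha>, \<beta>). if \<alpha> < d \<and> \<beta> < d then bf I a (e \<alpha>) (e \<beta>) else 0)"
  have bfr: "bf I a x y = bf {..<d} (restr a) (\<lambda>\<alpha>. ip I x (e \<alpha>)) (\<lambda>\<alpha>. ip I y (e \<alpha>))"
    if "x \<in> E" "y \<in> E" for a x y
  proof -
    have "bf I a x y = bf I a (proj I d e x) (proj I d e y)" using e(3) that by simp
    also have "\<dots> = (\<Sum>\<alpha><d. \<Sum>\<beta><d. bf I a (e \<alpha>) (e \<beta>) * ip I x (e \<alpha>) * ip I y (e \<beta>))"
      unfolding proj_def by (rule bf_sum_sum)
    finally show ?thesis by (simp add: bf_def[of "{..<d}"] restr_def)
  qed
  have restr_add: "restr (\<lambda>p. a p + c * b p) = (\<lambda>p. restr a p + c * restr b p)" for a b c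
    by (auto simp: restr_def bf_lin_mat)
  have L: "lin_sub (I \<times> I) L"
    unfolding L_def using lin_sub_perp[OF U, of "diagf R dx"] by (simp add: ip_commute)
  obtain M where M: "M \<in> vecs_on ({..<d} \<times> {..<d})" "symf M"
    "\<And>x. x \<in> vecs_on {..<d} \<Longrightarrow> x \<noteq> (\<lambda>_. 0) \<Longrightarrow> 0 < bf {..<d} M x x"
    "\<And>a. a \<in> restr ` L \<Longrightarrow> ip ({..<d} \<times> {..<d}) M a = 0"
  proof (rule gordan[of "{..<d}" "restr ` L"])
    show "lin_sub ({..<d} \<times> {..<d}) (restr ` L)"
      unfolding lin_sub_def
    proof (intro conjI ballI allI)
      show "restr ` L \<subseteq> vecs_on ({..<d} \<times> {..<d})" by (auto simp: restr_def vecs_on_def)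
      have "restr (\<lambda>_. 0) = (\<lambda>_. 0)" by (auto simp: restr_def bf_def)
      then show "(\<lambda>_. 0) \<in> restr ` L" using lin_sub_zero[OF L] by (metis imageI)
      fix x y c assume "x \<in> restr ` L" "y \<in> restr ` L"
      then obtain a b where ab: "a \<in> L" "b \<in> L" "x = restr a" "y = restr b" by blast
      show "(\<lambda>i. x i + c * y i) \<in> restr ` L"
        using imageI[OF lin_sub_add[OF L ab(1,2), of c], of restr] unfolding restr_add ab(3,4) .
    qed
  next
    fix a' assume a': "a' \<in> restr ` L"
    then obtain a where a: "a \<in> L" "a' = restr a" by blast
    have sa: "symf a" using a(1) Usym by (simp add: L_def)
    then show "symf a'" using bf_commute[OF sa] by (auto simp: a(2) symf_def restr_def)
    assume psd: "\<And>x. 0 \<le> bf {..<d} a' x x"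
    have psdE: "0 \<le> bf I a x x" if "x \<in> E" for x using psd bfr[OF that that] a(2) by simp
    have z: "bf I a x x = 0" if "x \<in> E" for x by (rule zero[OF a(1) psdE that])
    have "bf I a (e \<alpha>) (e \<beta>) = 0" if "\<alpha> < d" "\<beta> < d" for \<alpha> \<beta>
      by (rule psd_kernel[OF E sa psdE e(2)[OF that(1)] z[OF e(2)[OF that(1)]] e(2)[OF that(2)]])
    then show "a' = (\<lambda>_. 0)" by (auto simp: a(2) restr_def)
  qed auto
  \<comment> \<open>Pushed back into the full space, \<open>X\<close> lives on \<open>E\<close>: it
    is orthogonal to \<open>L\<close> by adjointness and vanishes on \<open>J\<close>, where all
    vectors of \<open>E\<close> are zero.\<close>
  define X where "X = basis_form d e M"
  have evec: "e \<alpha> i = 0" if "\<alpha> < d" "i \<notin> I - J" for \<alpha> i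
    using e(2)[OF that(1)] EJ that(2) by (auto simp: vecs_on_def)
  have trunc: "bf I X x x = bf {..<d} M (\<lambda>\<alpha>. if \<alpha> < d then ip I x (e \<alpha>) else 0) (\<lambda>\<alpha>. if \<alpha> < d then ip I x (e \<alpha>) else 0)" for x
    unfolding X_def bf_basis_form unfolding bf_def by (intro sum.cong) auto
  have tvec: "(\<lambda>\<alpha>. if \<alpha> < d then ip I x (e \<alpha>) else 0) \<in> vecs_on {..<d}" for x by (simp add: vecs_on_def)
  have "X \<in> vecs_on (R \<times> R)"
  proof (rule supported_of_perp)
    show "X \<in> vecs_on (I \<times> I)"
      unfolding vecs_on_def X_def basis_form_def using evec by (auto intro!: sum.neutral)
    show "symf X" unfolding X_def by (rule symf_basis_form[OF M(2)])
    show "0 \<le> bf I X x x" for x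
      unfolding trunc using M(3)[OF tvec, of x] by (cases "(\<lambda>\<alpha>. if \<alpha> < d then ip I x (e \<alpha>) else 0) = (\<lambda>_. 0)") (simp_all add: less_imp_le)
    have "X (i, i) = 0" if "i \<in> J" for i
      using evec that by (auto simp: X_def basis_form_def intro!: sum.neutral)
    then show "ip (I \<times> I) X (diagf J dz) = 0" unfolding ip_diagf[OF fin JI] by simp
    fix u assume u: "u \<in> U" "ip (I \<times> I) u (diagf R dx) = 0"
    have "ip (I \<times> I) u X = ip (I \<times> I) X u" by (rule ip_commute)
    also have "\<dots> = (\<Sum>\<alpha><d. \<Sum>\<beta><d. M (\<alpha>, \<beta>) * bf I u (e \<alpha>) (e \<beta>))"
      unfolding X_def by (rule ip_basis_form)
    also have "\<dots> = ip ({..<d} \<times> {..<d}) M (restr u)"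
      by (simp add: ip_pairs restr_def)
    also have "\<dots> = 0" using u by (intro M(4) imageI) (simp add: L_def)
    finally show "ip (I \<times> I) u X = 0" .
  qed
  obtain x where x: "x \<in> E" "x \<notin> vecs_on R" using RE ne by blast
  \<comment> \<open>The part \<open>w\<close> of \<open>x\<close> outside \<open>R\<close> is a
    nonzero vector of \<open>E\<close>, yet the form \<open>X\<close>, supported on
    \<open>R\<close>, vanishes at it.\<close>
  define x' where "x' = (\<lambda>i. if i \<in> R then x i else 0)"
  define w where "w = (\<lambda>i. x i - x' i)"
  have "x' \<in> vecs_on R" by (simp add: x'_def vecs_on_def)
  then have wE: "w \<in> E" unfolding w_def using lin_sub_diff[OF E x(1)] RE by blast
  have "w \<noteq> (\<lambda>_. 0)"
  proof
    assume "w = (\<lambda>_. 0)"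
    then have "x = x'" by (auto simp: w_def fun_eq_iff)
    then show False using x(2) \<open>x' \<in> vecs_on R\<close> by simp
  qed
  have "bf I X w w = 0"
    unfolding bf_def using \<open>X \<in> vecs_on (R \<times> R)\<close>
    by (intro sum.neutral ballI) (auto simp: vecs_on_def w_def x'_def)
  then have "(\<lambda>\<alpha>. if \<alpha> < d then ip I w (e \<alpha>) else 0) = (\<lambda>_. 0)"
    using M(3)[OF tvec, of w] unfolding trunc by force
  then have "ip I w (e \<alpha>) = 0" if "\<alpha> < d" for \<alpha> using fun_cong[of _ _ \<alpha>] that by fastforce
  then have "proj I d e w = (\<lambda>_. 0)" by (simp add: proj_def)
  then show False using e(3)[OF wE] \<open>w \<noteq> (\<lambda>_. 0)\<close> by simp
qed

text \<open>Each step cuts \<open>E\<close> down properly, so the dimension drives the induction.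
  The final clause records that every form reduces strictly; this later yields linear
  independence.\<close>

lemma reducing_sequence:
  "lin_sub I E \<Longrightarrow> vecs_on R \<subseteq> E \<Longrightarrow> E \<subseteq> vecs_on (I - J) \<Longrightarrow>
    \<exists>k as. (\<forall>i<k. as i \<in> U \<and> ip (I \<times> I) (as i) (diagf R dx) = 0) \<and>
      frs I E as k \<and> zset I E as k = vecs_on R \<and>
      (\<forall>i<k. \<exists>x\<in>zset I E as i. bf I (as i) x x \<noteq> 0)"
proof (induction "edim I E" arbitrary: E rule: less_induct)
  case less
  note E = less.prems
  show ?case
  proof (cases "E = vecs_on R")
    case True
    then show ?thesis by (intro exI[of _ 0]) (simp add: frs_def)
  next
    case False
    obtain a where a: "a \<in> U" "ip (I \<times> I) a (diagf R dx) = 0"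
      and psd: "\<And>x. x \<in> E \<Longrightarrow> 0 \<le> bf I a x x" and nz: "\<exists>x\<in>E. bf I a x x \<noteq> 0"
      using reducing_step[OF E False] by blast
    have sa: "symf a" by (rule Usym[OF a(1)])
    define F where "F = {x \<in> E. bf I a x x = 0}"
    have F: "lin_sub I F" unfolding F_def by (rule lin_sub_zero_set[OF E(1) sa psd])
    have "F \<subset> E" using nz by (auto simp: F_def)
    \<comment> \<open>The pairing of \<open>a\<close> with \<open>diagf R dx\<close> is a vanishing
      sum of products \<open>a (i, i) * dx i\<close> with nonnegative first and positive second
      factor, so the block \<open>R\<close> is never cut.\<close>
    have delta: "(\<lambda>p. if p = i then 1 else 0) \<in> F" if i: "i \<in> R" for i
    proof -
      have v: "(\<lambda>p. if p = i then 1 else 0) \<in> vecs_on R" if "i \<in> R" for i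
        using that by (auto simp: vecs_on_def)
      have eq: "bf I a (\<lambda>p. if p = i then 1 else 0) (\<lambda>p. if p = i then 1 else 0) = a (i, i)" if "i \<in> R" for i
        using that RI by (intro bf_delta fin) auto
      have nn: "0 \<le> a (i, i)" if "i \<in> R" for i
        using psd[of "\<lambda>p. if p = i then 1 else 0"] v[OF that] E(2) eq[OF that] by auto
      have "(\<Sum>i\<in>R. a (i, i) * dx i) = 0" using a(2) unfolding ip_diagf[OF fin RI] .
      then have "a (i, i) * dx i = 0"
        using i nn dx finite_subset[OF RI fin] by (subst (asm) sum_nonneg_eq_0_iff) (auto simp: less_imp_le)
      then show ?thesis using v[OF i] E(2) eq[OF i] dx[OF i] by (auto simp: F_def)
    qed
    have RF: "vecs_on R \<subseteq> F"
    proof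
      fix x :: "'i \<Rightarrow> real" assume x: "x \<in> vecs_on R"
      have "(\<lambda>i. \<Sum>p\<in>R. x p * (if i = p then 1 else 0)) \<in> F"
        using finite_subset[OF RI fin] delta by (intro lin_sub_sum[OF F])
      moreover have "(\<lambda>i. \<Sum>p\<in>R. x p * (if i = p then 1 else 0)) = x"
        using x finite_subset[OF RI fin] by (auto simp: vecs_on_def fun_eq_iff if_distrib[where f = "\<lambda>c. _ * c"] cong: if_cong)
      ultimately show "x \<in> F" by simp
    qed
    have "edim I F < edim I E" by (rule edim_less[OF fin E(1) F \<open>F \<subset> E\<close>])
    moreover have "F \<subseteq> vecs_on (I - J)" using E(3) \<open>F \<subset> E\<close> by blast
    ultimately obtain k as where as: "\<And>i. i < k \<Longrightarrow> as i \<in> U \<and> ip (I \<times> I) (as i) (diagf R dx) = 0"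
      "frs I F as k" "zset I F as k = vecs_on R"
      "\<And>i. i < k \<Longrightarrow> \<exists>x\<in>zset I F as i. bf I (as i) x x \<noteq> 0"
      using less.hyps[OF _ F RF] by blast
    have "frs I E (case_nat a as) (Suc k)"
      unfolding frs_def
    proof (intro allI impI)
      fix i assume "i < Suc k"
      then show "symf (case_nat a as i) \<and> (\<forall>x\<in>zset I E (case_nat a as) i. 0 \<le> bf I (case_nat a as i) x x)"
        using sa psd as(2) by (cases i) (auto simp: frs_def zset_case_nat F_def)
    qed
    moreover have "zset I E (case_nat a as) (Suc k) = vecs_on R"
      unfolding zset_case_nat using as(3) by (simp add: F_def)
    moreover have "case_nat a as i \<in> U \<and> ip (I \<times> I) (case_nat a as i) (diagf R dx) = 0" if "i < Suc k" for i
      using that a as(1) by (cases i) auto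
    moreover have "\<exists>x\<in>zset I E (case_nat a as) i. bf I (case_nat a as i) x x \<noteq> 0" if "i < Suc k" for i
      using that nz as(4) by (cases i) (auto simp: zset_case_nat F_def)
    ultimately show ?thesis by (intro exI[of _ "Suc k"] exI[of _ "case_nat a as"]) blast
  qed
qed

end

text \<open>The residual of \<open>x\<close> over \<open>L\<close> lies in \<open>V\<close> and is
  orthogonal to \<open>L\<close>, hence by \<open>perp\<close> to \<open>x\<close>; but its pairing
  with \<open>x\<close> is its own squared length.\<close>

lemma double_perp:
  assumes fin: "finite P" and L: "lin_sub P L" and V: "lin_sub P V" and sub: "L \<subseteq> V" and x: "x \<in> V"
    and perp: "\<And>y. y \<in> V \<Longrightarrow> (\<And>z. z \<in> L \<Longrightarrow> ip P z y = 0) \<Longrightarrow> ip P y x = 0"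
  shows "x \<in> L"
proof -
  obtain e where e: "orthonormal P (edim P L) e" "\<And>a. a < edim P L \<Longrightarrow> e a \<in> L"
    "\<And>x. x \<in> L \<Longrightarrow> proj P (edim P L) e x = x"
    using orthonormal_basis[OF fin L] by blast
  define w where "w = (\<lambda>i. x i - proj P (edim P L) e x i)"
  have pL: "proj P (edim P L) e x \<in> L" by (rule lin_sub_proj[OF L e(2)])
  then have wV: "w \<in> V" unfolding w_def using lin_sub_diff[OF V x] sub by blast
  have "ip P z w = 0" if "z \<in> L" for z
    using ip_residual_residual[OF e(1), of x z] e(3)[OF that] by (simp add: w_def ip_commute[of P z])
  then have "ip P w x = 0" by (rule perp[OF wV])
  then have "ip P w w = 0" using ip_residual_residual[OF e(1), of x x] by (simp add: w_def)
  then have "w = (\<lambda>_. 0)" using ip_pos[OF fin lin_sub_vecs_on[OF V wV]] by fastforce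
  then have "x = proj P (edim P L) e x" by (auto simp: w_def fun_eq_iff)
  then show ?thesis using pL by metis
qed

section \<open>Matrices as functions\<close>

definition fm :: "nat \<Rightarrow> real mat \<Rightarrow> nat \<times> nat \<Rightarrow> real" where
  "fm n A = (\<lambda>(i, j). if i < n \<and> j < n then A $$ (i, j) else 0)"

lemma fm_vecs_on: "fm n A \<in> vecs_on ({..<n} \<times> {..<n})"
  by (auto simp: fm_def vecs_on_def)

lemma fm_mat: "X \<in> vecs_on ({..<n} \<times> {..<n}) \<Longrightarrow> fm n (mat n n X) = X"
  by (auto simp: fm_def vecs_on_def)

lemma fm_inject: "A \<in> carrier_mat n n \<Longrightarrow> B \<in> carrier_mat n n \<Longrightarrow> fm n A = fm n B \<Longrightarrow> A = B"
  by (intro eq_matI) (auto simp: fm_def fun_eq_iff split: if_splits)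

lemma fm_add: "A \<in> carrier_mat n n \<Longrightarrow> B \<in> carrier_mat n n \<Longrightarrow> fm n (A + B) = (\<lambda>p. fm n A p + fm n B p)"
  by (auto simp: fm_def)

lemma fm_minus: "A \<in> carrier_mat n n \<Longrightarrow> B \<in> carrier_mat n n \<Longrightarrow> fm n (A - B) = (\<lambda>p. fm n A p - fm n B p)"
  by (auto simp: fm_def)

lemma fm_smult: "A \<in> carrier_mat n n \<Longrightarrow> fm n (c \<cdot>\<^sub>m A) = (\<lambda>p. c * fm n A p)"
  by (auto simp: fm_def)

lemma fm_lincomb: "fm n (mat_lincomb n A y) = (\<lambda>p. \<Sum>i<length A. y $ i * fm n (A ! i) p)"
proof (rule ext)
  fix p :: "nat \<times> nat"
  obtain i j where "p = (i, j)" by fastforce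
  then show "fm n (mat_lincomb n A y) p = (\<Sum>i<length A. y $ i * fm n (A ! i) p)"
    by (auto simp: fm_def mat_lincomb_def)
qed

lemma symf_entry:
  assumes "symf (fm n X)" "i < n" "j < n"
  shows "X $$ (i, j) = X $$ (j, i)"
proof -
  have "fm n X (i, j) = fm n X (j, i)" using assms(1) by (simp add: symf_def)
  then show ?thesis using assms(2,3) by (simp add: fm_def)
qed

lemma lincomb_carrier [simp]: "mat_lincomb n A y \<in> carrier_mat n n"
  by (simp add: mat_lincomb_def)

lemma sym_mats_iff: "X \<in> sym_mats n \<longleftrightarrow> X \<in> carrier_mat n n \<and> symf (fm n X)"
proof
  assume X: "X \<in> sym_mats n"
  then have c: "X \<in> carrier_mat n n" and t: "X\<^sup>T = X" by (auto simp: sym_mats_def)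
  have "X $$ (i, j) = X $$ (j, i)" if "i < n" "j < n" for i j
    using arg_cong[OF t, of "\<lambda>M. M $$ (j, i)"] c that by simp
  then show "X \<in> carrier_mat n n \<and> symf (fm n X)" using c by (auto simp: symf_def fm_def)
next
  assume X: "X \<in> carrier_mat n n \<and> symf (fm n X)"
  have "X $$ (i, j) = X $$ (j, i)" if "i < n" "j < n" for i j
    using X that symf_entry by blast
  then show "X \<in> sym_mats n" using X by (auto simp: sym_mats_def intro!: eq_matI)
qed

lemma sym_mats_carrier: "X \<in> sym_mats n \<Longrightarrow> X \<in> carrier_mat n n"
  by (simp add: sym_mats_def)

text \<open>The trace pairs entry (i, j) of \<open>A\<close> with entry (j, i) of \<open>X\<close>;
  symmetry of \<open>X\<close> makes this the entrywise product.\<close>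

lemma mat_inner_ip:
  assumes "A \<in> carrier_mat n n" "X \<in> sym_mats n"
  shows "mat_inner A X = ip ({..<n} \<times> {..<n}) (fm n A) (fm n X)"
proof -
  have X: "X \<in> carrier_mat n n" "symf (fm n X)" using assms(2) by (auto simp: sym_mats_iff)
  have s: "X $$ (j, i) = X $$ (i, j)" if "i < n" "j < n" for i j
    using symf_entry[OF X(2)] that by blast
  have "mat_inner A X = (\<Sum>i<n. \<Sum>j<n. A $$ (i, j) * X $$ (j, i))"
    using assms(1) X(1) by (auto simp: mat_inner_def mat_trace_def scalar_prod_def atLeast0LessThan intro!: sum.cong)
  also have "\<dots> = (\<Sum>i<n. \<Sum>j<n. fm n A (i, j) * fm n X (i, j))"
    using s by (intro sum.cong refl) (auto simp: fm_def)
  finally show ?thesis by (simp add: ip_pairs)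
qed

lemma quadratic_form:
  assumes "X \<in> carrier_mat n n" "v \<in> carrier_vec n"
  shows "v \<bullet> (X *\<^sub>v v) = bf {..<n} (fm n X) (\<lambda>i. v $ i) (\<lambda>i. v $ i)"
  using assms
  by (auto simp: bf_def fm_def scalar_prod_def atLeast0LessThan sum_distrib_left algebra_simps intro!: sum.cong)

lemma psd_cone_iff: "X \<in> psd_cone n \<longleftrightarrow> X \<in> sym_mats n \<and> (\<forall>x. 0 \<le> bf {..<n} (fm n X) x x)"
proof -
  have "(\<forall>v\<in>carrier_vec n. 0 \<le> v \<bullet> (X *\<^sub>v v)) \<longleftrightarrow> (\<forall>x. 0 \<le> bf {..<n} (fm n X) x x)"
    if X: "X \<in> carrier_mat n n"
  proof
    assume L: "\<forall>v\<in>carrier_vec n. 0 \<le> v \<bullet> (X *\<^sub>v v)"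
    show "\<forall>x. 0 \<le> bf {..<n} (fm n X) x x"
    proof
      fix x
      have "0 \<le> bf {..<n} (fm n X) (\<lambda>i. vec n x $ i) (\<lambda>i. vec n x $ i)"
        using L vec_carrier[of n x] quadratic_form[OF X vec_carrier, of x] by metis
      also have "\<dots> = bf {..<n} (fm n X) x x" by (simp add: bf_def)
      finally show "0 \<le> bf {..<n} (fm n X) x x" .
    qed
  qed (simp add: quadratic_form[OF X])
  then show ?thesis by (auto simp: psd_cone_def sym_mats_def)
qed

lemma pd_mats_iff:
  "X \<in> pd_mats n \<longleftrightarrow> X \<in> sym_mats n \<and> (\<forall>x\<in>vecs_on {..<n}. x \<noteq> (\<lambda>_. 0) \<longrightarrow> 0 < bf {..<n} (fm n X) x x)"
proof -
  have "(\<forall>v\<in>carrier_vec n. v \<noteq> 0\<^sub>v n \<longrightarrow> 0 < v \<bullet> (X *\<^sub>v v)) \<longleftrightarrow>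
      (\<forall>x\<in>vecs_on {..<n}. x \<noteq> (\<lambda>_. 0) \<longrightarrow> 0 < bf {..<n} (fm n X) x x)"
    if X: "X \<in> carrier_mat n n"
  proof (intro iffI ballI impI)
    fix x :: "nat \<Rightarrow> real"
    assume L: "\<forall>v\<in>carrier_vec n. v \<noteq> 0\<^sub>v n \<longrightarrow> 0 < v \<bullet> (X *\<^sub>v v)" and x: "x \<in> vecs_on {..<n}" "x \<noteq> (\<lambda>_. 0)"
    obtain i where "x i \<noteq> 0" "i < n" using x by (auto simp: vecs_on_def fun_eq_iff)
    then have "vec n x \<noteq> 0\<^sub>v n" by (metis index_vec index_zero_vec(1))
    then have "0 < bf {..<n} (fm n X) (\<lambda>i. vec n x $ i) (\<lambda>i. vec n x $ i)"
      using L vec_carrier[of n x] quadratic_form[OF X vec_carrier, of x] by metis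
    also have "\<dots> = bf {..<n} (fm n X) x x" by (simp add: bf_def)
    finally show "0 < bf {..<n} (fm n X) x x" .
  next
    fix v :: "real vec"
    assume R: "\<forall>x\<in>vecs_on {..<n}. x \<noteq> (\<lambda>_. 0) \<longrightarrow> 0 < bf {..<n} (fm n X) x x"
      and v: "v \<in> carrier_vec n" "v \<noteq> 0\<^sub>v n"
    define x where "x = (\<lambda>i. if i < n then v $ i else 0)"
    have "x \<noteq> (\<lambda>_. 0)"
    proof
      assume "x = (\<lambda>_. 0)"
      then have "v $ i = 0" if "i < n" for i using that by (metis x_def)
      then show False using v by (auto intro!: eq_vecI)
    qed
    then have "0 < bf {..<n} (fm n X) x x" using R by (simp add: x_def vecs_on_def)
    also have "\<dots> = v \<bullet> (X *\<^sub>v v)" unfolding quadratic_form[OF X v(1)] by (simp add: bf_def x_def)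
    finally show "0 < v \<bullet> (X *\<^sub>v v)" .
  qed
  then show ?thesis by (auto simp: pd_mats_def sym_mats_def)
qed

section \<open>Diagonals of psd matrices and bounds on the rank\<close>

lemma psd_symf: "X \<in> psd_cone n \<Longrightarrow> symf (fm n X)"
  by (simp add: psd_cone_iff sym_mats_iff)

lemma psd_diag:
  assumes "X \<in> psd_cone n" "i < n"
  shows "0 \<le> X $$ (i, i)"
proof -
  have "0 \<le> bf {..<n} (fm n X) (\<lambda>p. if p = i then 1 else 0) (\<lambda>p. if p = i then 1 else 0)"
    using assms by (simp add: psd_cone_iff)
  then show ?thesis using assms(2) by (simp add: bf_delta fm_def)
qed

lemma psd_zero_diag:
  assumes "X \<in> psd_cone n" "i < n" "X $$ (i, i) = 0" "j < n"
  shows "X $$ (i, j) = 0" "X $$ (j, i) = 0"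
proof -
  let ?d = "\<lambda>i p. if p = i then 1 else (0::real)"
  have "bf {..<n} (fm n X) (?d i) (?d j) = 0"
  proof (rule psd_kernel[of _ "vecs_on {..<n}"])
    show "lin_sub {..<n} (vecs_on {..<n})" by (rule lin_sub_vecs) simp
    show "symf (fm n X)" by (rule psd_symf[OF assms(1)])
    show "bf {..<n} (fm n X) (?d i) (?d i) = 0" using assms by (simp add: bf_delta fm_def)
  qed (use assms in \<open>auto simp: psd_cone_iff vecs_on_def\<close>)
  then show z: "X $$ (i, j) = 0" using assms by (simp add: bf_delta fm_def)
  show "X $$ (j, i) = 0"
    using z symf_entry[OF psd_symf[OF assms(1)]] assms by metis
qed

text \<open>The rank is the size of a maximal independent set of columns; such a set avoids the zero
  vector, and every nonzero column has its index in \<open>R\<close>.\<close>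

lemma rank_le_support:
  fixes X :: "real mat"
  assumes X: "X \<in> carrier_mat n n" and R: "R \<subseteq> {..<n}"
    and supp: "\<And>i j. i < n \<Longrightarrow> j < n \<Longrightarrow> X $$ (i, j) \<noteq> 0 \<Longrightarrow> j \<in> R"
  shows "vec_space.rank n X \<le> card R"
proof -
  interpret vec_space "TYPE(real)" n .
  obtain S where S: "maximal S (\<lambda>T. T \<subseteq> set (cols X) \<and> lin_indpt T)"
    using maximal_exists_superset[of "set (cols X)" "\<lambda>T. T \<subseteq> set (cols X) \<and> lin_indpt T" "{}"]
    by (auto simp: lin_dep_def)
  then have S': "S \<subseteq> set (cols X)" "lin_indpt S" by (auto simp: maximal_def)
  have "0\<^sub>v n \<notin> S"
  proof -
    have "set (cols X) \<subseteq> carrier_vec n" using X cols_dim[of X] by auto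
    moreover have "(UNIV::real set) \<noteq> {0}" by (metis UNIV_I singletonD zero_neq_one)
    ultimately show ?thesis using zero_nin_lin_indpt[of S] S' by auto
  qed
  have "S \<subseteq> col X ` R"
  proof
    fix v assume v: "v \<in> S"
    then obtain j where j: "j < n" "v = col X j"
      using S'(1) X by (auto simp: cols_def)
    have "j \<in> R"
    proof (rule ccontr)
      assume "j \<notin> R"
      then have "col X j = 0\<^sub>v n" using supp j X by (intro eq_vecI) auto
      then show False using v j \<open>0\<^sub>v n \<notin> S\<close> by simp
    qed
    then show "v \<in> col X ` R" using j by blast
  qed
  then have "card S \<le> card R"
    using finite_subset[OF R] by (meson card_image_le card_mono finite_imageI finite_lessThan le_trans)
  then show ?thesis using rank_card_indpt[OF X S] by simp
qed

lemma card_index: "K \<subseteq> {..<n} \<Longrightarrow> card {i. i < n \<and> i \<in> K} = card K"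
  by (rule arg_cong[of _ _ card]) auto

lemma pick_bij:
  assumes "K \<subseteq> {..<n}"
  shows "bij_betw (pick K) {..<card K} K"
proof (rule bij_betw_imageI)
  have fin: "finite K" using assms finite_subset by blast
  show inj: "inj_on (pick K) {..<card K}"
    by (rule linorder_inj_onI') (metis lessThan_iff order_less_irrefl pick_mono)
  have "pick K ` {..<card K} \<subseteq> K" using pick_in_set by auto
  moreover have "card (pick K ` {..<card K}) = card K" using card_image[OF inj] by simp
  ultimately show "pick K ` {..<card K} = K" by (simp add: card_subset_eq fin)
qed

text \<open>A kernel vector of the principal submatrix, spread out over \<open>K\<close>, would be a
  nonzero null vector of the form. So this minor is nonzero, and it bounds the rank from
  below.\<close>

lemma rank_ge_pd_block:
  assumes X: "X \<in> carrier_mat n n" and K: "K \<subseteq> {..<n}"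
    and pd: "\<And>x. x \<in> vecs_on K \<Longrightarrow> x \<noteq> (\<lambda>_. 0) \<Longrightarrow> 0 < bf {..<n} (fm n X) x x"
  shows "card K \<le> vec_space.rank n X"
proof -
  let ?M = "submatrix X K K"
  let ?k = "card K"
  have M: "?M \<in> carrier_mat ?k ?k"
    using X by (intro carrier_matI) (simp_all add: dim_submatrix card_index[OF K])
  have Mij: "?M $$ (i, j) = X $$ (pick K i, pick K j)" if "i < ?k" "j < ?k" for i j
    using X that by (intro submatrix_index) (simp_all add: card_index[OF K])
  have bij: "bij_betw (pick K) {..<?k} K" by (rule pick_bij[OF K])
  have "det ?M \<noteq> 0"
  proof
    assume "det ?M = 0"
    then obtain v where v: "v \<in> carrier_vec ?k" "v \<noteq> 0\<^sub>v ?k" "?M *\<^sub>v v = 0\<^sub>v ?k"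
      using det_0_iff_vec_prod_zero_field[OF M] by blast
    define x where "x = (\<lambda>i. if i \<in> K then v $ (the_inv_into {..<?k} (pick K) i) else 0)"
    have xp: "x (pick K a) = v $ a" if "a < ?k" for a
      using bij that by (auto simp: x_def bij_betw_def the_inv_into_f_f)
    have "x \<noteq> (\<lambda>_. 0)"
    proof
      assume "x = (\<lambda>_. 0)"
      then have "v $ a = 0" if "a < ?k" for a using xp[OF that] by simp
      then show False using v by (auto intro!: eq_vecI)
    qed
    moreover have "x \<in> vecs_on K" by (simp add: x_def vecs_on_def)
    ultimately have "0 < bf {..<n} (fm n X) x x" using pd by blast
    also have "\<dots> = (\<Sum>i\<in>K. \<Sum>j\<in>K. X $$ (i, j) * x i * x j)"
    proof -
      have "bf {..<n} (fm n X) x x = (\<Sum>i\<in>K. \<Sum>j\<in>{..<n}. fm n X (i, j) * x i * x j)"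
        unfolding bf_def using K by (intro sum.mono_neutral_right) (auto simp: x_def)
      also have "\<dots> = (\<Sum>i\<in>K. \<Sum>j\<in>K. fm n X (i, j) * x i * x j)"
        using K by (intro sum.cong refl sum.mono_neutral_right) (auto simp: x_def)
      finally show ?thesis using K by (auto simp: fm_def intro!: sum.cong)
    qed
    also have "\<dots> = (\<Sum>a<?k. \<Sum>b<?k. X $$ (pick K a, pick K b) * x (pick K a) * x (pick K b))"
      by (simp add: sum.reindex_bij_betw[OF bij, symmetric])
    also have "\<dots> = (\<Sum>a<?k. v $ a * (\<Sum>b<?k. ?M $$ (a, b) * v $ b))"
      by (auto simp: Mij xp sum_distrib_left algebra_simps intro!: sum.cong)
    also have "\<dots> = 0"
    proof (intro sum.neutral ballI)
      fix a assume a: "a \<in> {..<?k}"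
      have "(\<Sum>b<?k. ?M $$ (a, b) * v $ b) = (?M *\<^sub>v v) $ a"
        using M v(1) a by (auto simp: scalar_prod_def atLeast0LessThan intro!: sum.cong)
      then show "v $ a * (\<Sum>b<?k. ?M $$ (a, b) * v $ b) = 0" using v(3) a by simp
    qed
    finally show False by simp
  qed
  then show ?thesis
    using vec_space.rank_gt_minor[OF X] card_index[OF K] by metis
qed

section \<open>Regular facial reduction sequences\<close>

text \<open>An entrywise version of \<open>regular_fr_seq\<close> with the blocks as a parameter. A
  diagonal matrix is positive definite when its diagonal is positive, so the zeros off the block and
  those off its diagonal merge into one clause.\<close>

definition fr_blocks :: "nat \<Rightarrow> (nat \<Rightarrow> nat set) \<Rightarrow> real mat list \<Rightarrow> bool" where
  "fr_blocks n P Ys \<longleftrightarrow> set Ys \<subseteq> sym_mats n \<and> (\<forall>i<length Ys. P i \<subseteq> {..<n}) \<and>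
     disjoint_family_on P {..<length Ys} \<and> (\<forall>i<length Ys. \<forall>p\<in>P i. 0 < (Ys ! i) $$ (p, p)) \<and>
     (\<forall>i<length Ys. \<forall>p\<in>{..<n} - (\<Union>j<i. P j). \<forall>q\<in>{..<n} - (\<Union>j<i. P j).
        \<not> (p = q \<and> p \<in> P i) \<longrightarrow> (Ys ! i) $$ (p, q) = 0)"

lemma fr_blocks_zero:
  assumes "fr_blocks n P Ys" "i < length Ys" "p \<in> {..<n} - (\<Union>j<i. P j)" "q \<in> {..<n} - (\<Union>j<i. P j)"
    "\<not> (p = q \<and> p \<in> P i)"
  shows "(Ys ! i) $$ (p, q) = 0"
  using assms unfolding fr_blocks_def by (elim conjE) (drule spec, drule (1) mp, drule (1) bspec, drule (1) bspec, drule (1) mp)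

lemma diagonal_pd:
  assumes D: "D \<in> carrier_mat k k" and off: "\<And>i j. i < k \<Longrightarrow> j < k \<Longrightarrow> i \<noteq> j \<Longrightarrow> D $$ (i, j) = 0"
    and pos: "\<And>i. i < k \<Longrightarrow> 0 < D $$ (i, i)"
  shows "diagonal_mat D" "D \<in> pd_mats k"
proof -
  show "diagonal_mat D" using D off by (simp add: diagonal_mat_def)
  have fm: "fm k D = diagf {..<k} (\<lambda>i. D $$ (i, i))"
    using off by (auto simp: fm_def diagf_def)
  show "D \<in> pd_mats k"
    unfolding pd_mats_iff sym_mats_iff fm
  proof (intro conjI ballI impI)
    fix x :: "nat \<Rightarrow> real" assume x: "x \<in> vecs_on {..<k}" "x \<noteq> (\<lambda>_. 0)"
    then obtain i where i: "x i \<noteq> 0" "i < k" by (auto simp: vecs_on_def fun_eq_iff)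
    have "0 < D $$ (i, i) * (x i)\<^sup>2" using pos i by simp
    also have "\<dots> \<le> (\<Sum>i<k. D $$ (i, i) * (x i)\<^sup>2)"
      using pos i by (intro member_le_sum) (auto simp: less_imp_le)
    finally show "0 < bf {..<k} (diagf {..<k} (\<lambda>i. D $$ (i, i))) x x" by (simp add: bf_diagf)
  qed (use D symf_diagf in auto)
qed

lemma pd_diag_pos:
  assumes "D \<in> pd_mats k" "i < k"
  shows "0 < D $$ (i, i)"
proof -
  let ?d = "\<lambda>p. if p = i then 1 else (0::real)"
  have "?d \<noteq> (\<lambda>_. 0)" by (metis zero_neq_one)
  then have "0 < bf {..<k} (fm k D) ?d ?d"
    using assms by (auto simp: pd_mats_iff vecs_on_def)
  then show ?thesis using assms(2) by (simp add: bf_delta fm_def)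
qed

lemma fr_blocks_regular:
  assumes "fr_blocks n P Ys"
  shows "regular_fr_seq n Ys"
  unfolding regular_fr_seq_def
proof (intro conjI exI[of _ P] allI impI ballI)
  show "set Ys \<subseteq> sym_mats n" "disjoint_family_on P {..<length Ys}"
    using assms by (auto simp: fr_blocks_def)
  fix i assume i: "i < length Ys"
  show K: "P i \<subseteq> {..<n}" using assms i by (auto simp: fr_blocks_def)
  have carrier: "Ys ! i \<in> carrier_mat n n"
    using assms i by (auto simp: fr_blocks_def intro!: sym_mats_carrier)
  have out: "P i \<subseteq> {..<n} - (\<Union>j<i. P j)"
  proof -
    have "P j \<inter> P i = {}" if "j < i" for j
      using assms i that unfolding fr_blocks_def disjoint_family_on_def by auto
    then show ?thesis using K by blast
  qed
  let ?S = "submatrix (Ys ! i) (P i) (P i)"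
  have S: "?S \<in> carrier_mat (card (P i)) (card (P i))"
    using carrier by (intro carrier_matI) (simp_all add: dim_submatrix card_index[OF K])
  have Sij: "?S $$ (a, b) = (Ys ! i) $$ (pick (P i) a, pick (P i) b)"
    if "a < card (P i)" "b < card (P i)" for a b
    using carrier that by (intro submatrix_index) (simp_all add: card_index[OF K])
  have mem: "pick (P i) a \<in> P i" if "a < card (P i)" for a
    using pick_bij[OF K] that by (auto simp: bij_betw_def)
  have "?S $$ (a, b) = 0" if "a < card (P i)" "b < card (P i)" "a \<noteq> b" for a b
  proof -
    have "pick (P i) a \<noteq> pick (P i) b"
      using pick_bij[OF K] that by (auto simp: bij_betw_def inj_on_def)
    moreover have "pick (P i) a \<in> {..<n} - (\<Union>j<i. P j)" "pick (P i) b \<in> {..<n} - (\<Union>j<i. P j)"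
      using mem that out by blast+
    ultimately show ?thesis using fr_blocks_zero[OF assms i] Sij[OF that(1,2)] by simp
  qed
  moreover have "0 < ?S $$ (a, a)" if "a < card (P i)" for a
    using assms i mem[OF that] Sij[OF that that] by (simp add: fr_blocks_def)
  ultimately show "diagonal_mat ?S" "?S \<in> pd_mats (card (P i))" using diagonal_pd[OF S] by blast+
  fix p q assume pq: "p \<in> {..<n} - (\<Union>j<i. P j)" "q \<in> {..<n} - (\<Union>j<i. P j)"
    and "\<not> (p \<in> P i \<and> q \<in> P i)"
  then have "\<not> (p = q \<and> p \<in> P i)" by blast
  then show "(Ys ! i) $$ (p, q) = 0" by (rule fr_blocks_zero[OF assms i pq])
qed

text \<open>Once the diagonal of a psd \<open>X\<close> vanishes on the earlier blocks, so do the
  corresponding rows and columns, and the arbitrary entries of the next matrix meet only zeros. What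
  remains of the pairing is a sum of nonnegative terms over \<open>P i\<close>, which forces the
  diagonal of \<open>X\<close> to vanish there as well.\<close>

lemma fr_blocks_reduces:
  assumes blocks: "fr_blocks n P Ys" and R: "R = {..<n} - (\<Union>i<length Ys. P i)"
  shows "reduces_to n Ys {X \<in> psd_cone n. fm n X \<in> vecs_on (R \<times> R)}"
  unfolding reduces_to_def
proof (intro equalityI subsetI)
  fix X assume X: "X \<in> psd_cone n \<inter> (\<Inter>Y\<in>set Ys. mat_perp n Y)"
  then have psd: "X \<in> psd_cone n" by blast
  have sym: "X \<in> sym_mats n" using psd by (simp add: psd_cone_iff)
  have "i \<le> length Ys \<Longrightarrow> \<forall>p\<in>(\<Union>j<i. P j). X $$ (p, p) = 0" for i
  proof (induction i)
    case (Suc i)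
    then have i: "i < length Ys" and IH: "\<And>p. p \<in> (\<Union>j<i. P j) \<Longrightarrow> X $$ (p, p) = 0" by auto
    let ?Y = "Ys ! i"
    have Pn: "P i \<subseteq> {..<n}" using blocks i by (simp add: fr_blocks_def)
    have Y: "?Y \<in> carrier_mat n n" using blocks i by (auto simp: fr_blocks_def intro!: sym_mats_carrier)
    have "X \<in> mat_perp n ?Y" using X i nth_mem[of i Ys] by blast
    then have "0 = ip ({..<n} \<times> {..<n}) (fm n ?Y) (fm n X)"
      using mat_inner_ip[OF Y sym] by (simp add: mat_perp_def)
    also have "\<dots> = ip ({..<n} \<times> {..<n}) (\<lambda>_. 1) (diagf (P i) (\<lambda>p. ?Y $$ (p, p) * X $$ (p, p)))"
      unfolding ip_pairs
    proof (intro sum.cong refl)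
      fix p q assume pq: "p \<in> {..<n}" "q \<in> {..<n}"
      show "fm n ?Y (p, q) * fm n X (p, q) = 1 * diagf (P i) (\<lambda>p. ?Y $$ (p, p) * X $$ (p, p)) (p, q)"
      proof (cases "p \<in> (\<Union>j<i. P j) \<or> q \<in> (\<Union>j<i. P j)")
        case True
        then have "X $$ (p, q) = 0" using IH psd_zero_diag[OF psd] pq by (metis lessThan_iff)
        then show ?thesis using pq by (auto simp: fm_def diagf_def)
      next
        case False
        then have "\<not> (p = q \<and> p \<in> P i) \<Longrightarrow> ?Y $$ (p, q) = 0"
          using pq by (intro fr_blocks_zero[OF blocks i]) auto
        then show ?thesis using pq by (auto simp: fm_def diagf_def)
      qed
    qed
    also have "\<dots> = (\<Sum>p\<in>P i. ?Y $$ (p, p) * X $$ (p, p))"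
      by (subst ip_diagf) (use Pn in auto)
    finally have sum: "(\<Sum>p\<in>P i. ?Y $$ (p, p) * X $$ (p, p)) = 0" by simp
    have Ypos: "0 < ?Y $$ (p, p)" if "p \<in> P i" for p using blocks i that by (simp add: fr_blocks_def)
    have "X $$ (p, p) = 0" if p: "p \<in> P i" for p
    proof -
      have nn: "0 \<le> ?Y $$ (q, q) * X $$ (q, q)" if "q \<in> P i" for q
      proof -
        have "q < n" using that Pn by blast
        then show ?thesis using Ypos[OF that] psd_diag[OF psd] by simp
      qed
      have "finite (P i)" using Pn finite_subset by blast
      then have "?Y $$ (p, p) * X $$ (p, p) = 0"
        using iffD1[OF sum_nonneg_eq_0_iff[OF _ nn] sum] p by blast
      then show ?thesis using Ypos[OF p] by simp
    qed
    show ?case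
    proof
      fix p assume "p \<in> (\<Union>j<Suc i. P j)"
      then have "p \<in> P i \<or> p \<in> (\<Union>j<i. P j)" by (auto simp: less_Suc_eq)
      then show "X $$ (p, p) = 0" using IH \<open>\<And>p. p \<in> P i \<Longrightarrow> X $$ (p, p) = 0\<close> by blast
    qed
  qed auto
  then have zero: "X $$ (p, p) = 0" if "p < n" "p \<notin> R" for p using that R by blast
  have "fm n X \<in> vecs_on (R \<times> R)"
    unfolding vecs_on_def fm_def using psd_zero_diag[OF psd _ zero] zero by auto
  then show "X \<in> {X \<in> psd_cone n. fm n X \<in> vecs_on (R \<times> R)}" using psd by blast
next
  fix X assume X: "X \<in> {X \<in> psd_cone n. fm n X \<in> vecs_on (R \<times> R)}"
  then have psd: "X \<in> psd_cone n" and supp: "fm n X \<in> vecs_on (R \<times> R)" by auto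
  have sym: "X \<in> sym_mats n" using psd by (simp add: psd_cone_iff)
  have "mat_inner Y X = 0" if YYs: "Y \<in> set Ys" for Y
  proof -
    obtain i where i: "i < length Ys" "Y = Ys ! i" using YYs by (metis in_set_conv_nth)
    have "set Ys \<subseteq> sym_mats n" using blocks by (simp add: fr_blocks_def)
    then have Y: "Y \<in> carrier_mat n n" using YYs by (intro sym_mats_carrier) blast
    have RP: "p \<in> {..<n} - (\<Union>j<i. P j) \<and> p \<notin> P i" if "p \<in> R" for p
      using that i(1) unfolding R by auto
    have "fm n Y (p, q) * fm n X (p, q) = 0" if pq: "p \<in> {..<n}" "q \<in> {..<n}" for p q
    proof (cases "p \<in> R \<and> q \<in> R")
      case True
      then have "p \<in> {..<n} - (\<Union>j<i. P j)" "q \<in> {..<n} - (\<Union>j<i. P j)" "p \<notin> P i"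
        using RP by blast+
      then have "Y $$ (p, q) = 0" unfolding i(2) by (intro fr_blocks_zero[OF blocks i(1)]) auto
      then show ?thesis by (simp add: fm_def)
    next
      case False
      then show ?thesis using supp unfolding vecs_on_def by auto
    qed
    then show ?thesis unfolding mat_inner_ip[OF Y sym] ip_pairs by (intro sum.neutral ballI)
  qed
  then show "X \<in> psd_cone n \<inter> (\<Inter>Y\<in>set Ys. mat_perp n Y)"
    using psd sym by (auto simp: mat_perp_def)
qed

section \<open>The two faces; congruence of matrices\<close>

lemma lower_right_face_alt:
  assumes "r \<le> n"
  shows "lower_right_face n r = {X \<in> psd_cone n. fm n X \<in> vecs_on ({n - r..<n} \<times> {n - r..<n})}"
  using assms unfolding lower_right_face_def vecs_on_def fm_def by auto

lemma upper_left_face_alt: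
  assumes "s \<le> n"
  shows "upper_left_face n s = {X \<in> psd_cone n. fm n X \<in> vecs_on ({..<s} \<times> {..<s})}"
  using assms unfolding upper_left_face_def vecs_on_def fm_def by auto

text \<open>Rows are what enters \<open>basis_form\<close>: S^T X S is the sum of the entries of X
  times outer products of rows of S.\<close>

definition mrow :: "nat \<Rightarrow> real mat \<Rightarrow> nat \<Rightarrow> nat \<Rightarrow> real" where
  "mrow n S = (\<lambda>p i. if i < n then S $$ (p, i) else 0)"

abbreviation congruence :: "real mat \<Rightarrow> real mat \<Rightarrow> real mat" where
  "congruence S X \<equiv> S\<^sup>T * X * S"

lemma fm_congruence:
  assumes "X \<in> carrier_mat n n" "S \<in> carrier_mat n n"
  shows "fm n (congruence S X) = basis_form n (mrow n S) (fm n X)"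
proof (rule ext)
  fix p :: "nat \<times> nat"
  obtain i j where p: "p = (i, j)" by fastforce
  show "fm n (congruence S X) p = basis_form n (mrow n S) (fm n X) p"
  proof (cases "i < n \<and> j < n")
    case True
    have "fm n (congruence S X) p = (\<Sum>\<alpha><n. S $$ (\<alpha>, i) * (\<Sum>\<beta><n. X $$ (\<alpha>, \<beta>) * S $$ (\<beta>, j)))"
      using True assms by (auto simp: p fm_def scalar_prod_def atLeast0LessThan intro!: sum.cong)
    also have "\<dots> = (\<Sum>\<alpha><n. \<Sum>\<beta><n. X $$ (\<alpha>, \<beta>) * S $$ (\<alpha>, i) * S $$ (\<beta>, j))"
      by (simp add: sum_distrib_left algebra_simps)
    finally show ?thesis using True by (simp add: p basis_form_def mrow_def fm_def)
  next
    case False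
    then show ?thesis by (auto simp: p fm_def basis_form_def mrow_def intro!: sum.neutral)
  qed
qed

lemma congruence_carrier [simp]:
  "S \<in> carrier_mat n n \<Longrightarrow> X \<in> carrier_mat n n \<Longrightarrow> congruence S X \<in> carrier_mat n n"
  by (intro mult_carrier_mat) auto

lemma sym_congruence:
  assumes "X \<in> sym_mats n" "S \<in> carrier_mat n n"
  shows "congruence S X \<in> sym_mats n"
  using assms by (simp add: sym_mats_iff fm_congruence symf_basis_form)

lemma psd_congruence:
  assumes "X \<in> psd_cone n" "S \<in> carrier_mat n n"
  shows "congruence S X \<in> psd_cone n"
  using assms by (auto simp: psd_cone_iff sym_congruence fm_congruence sym_mats_carrier bf_basis_form)

lemma mat_inner_congruence:
  assumes M: "M \<in> sym_mats n" and Y: "Y \<in> sym_mats n" and S: "S \<in> carrier_mat n n"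
  shows "mat_inner (congruence S M) Y = mat_inner M (S * Y * S\<^sup>T)"
proof -
  have c: "M \<in> carrier_mat n n" "Y \<in> carrier_mat n n" using M Y by (auto intro: sym_mats_carrier)
  have St: "S\<^sup>T \<in> carrier_mat n n" using S by simp
  have SY: "S * Y * S\<^sup>T \<in> sym_mats n" using sym_congruence[OF Y St] by simp
  have entry: "fm n (S * Y * S\<^sup>T) (\<alpha>, \<beta>) = bf {..<n} (fm n Y) (mrow n S \<alpha>) (mrow n S \<beta>)"
    if "\<alpha> < n" "\<beta> < n" for \<alpha> \<beta>
    using fm_congruence[OF c(2) St] that S
    by (simp add: basis_form_def mrow_def bf_def)
  have "mat_inner (congruence S M) Y = (\<Sum>\<alpha><n. \<Sum>\<beta><n. fm n M (\<alpha>, \<beta>) * bf {..<n} (fm n Y) (mrow n S \<alpha>) (mrow n S \<beta>))"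
    using mat_inner_ip[OF congruence_carrier[OF S c(1)] Y] fm_congruence[OF c(1) S] by (simp add: ip_basis_form)
  also have "\<dots> = (\<Sum>\<alpha><n. \<Sum>\<beta><n. fm n M (\<alpha>, \<beta>) * fm n (S * Y * S\<^sup>T) (\<alpha>, \<beta>))"
    using entry by (intro sum.cong refl) simp
  also have "\<dots> = mat_inner M (S * Y * S\<^sup>T)"
    unfolding mat_inner_ip[OF c(1) SY] ip_pairs ..
  finally show ?thesis .
qed

lemma congruence_cancel:
  fixes X S S' :: "real mat"
  assumes "X \<in> carrier_mat n n" "S \<in> carrier_mat n n" "S' \<in> carrier_mat n n" "S * S'\<^sup>T = 1\<^sub>m n"
  shows "S * (congruence S' X) * S\<^sup>T = X"
proof -
  have "S * (congruence S' X) * S\<^sup>T = (S * S'\<^sup>T) * X * (S' * S\<^sup>T)"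
    using assms(1-3) by (simp add: assoc_mult_mat[of _ n n _ n _ n])
  also have "S' * S\<^sup>T = 1\<^sub>m n"
    using transpose_mult[of S n n "S'\<^sup>T" n] assms(2-4) by simp
  finally show ?thesis using assms by simp
qed

lemma mat_inner_congruence_dual:
  assumes "M \<in> sym_mats n" "Y \<in> sym_mats n" "S \<in> carrier_mat n n" "S' \<in> carrier_mat n n" "S * S'\<^sup>T = 1\<^sub>m n"
  shows "mat_inner (congruence S M) (congruence S' Y) = mat_inner M Y"
  using mat_inner_congruence[OF assms(1) sym_congruence[OF assms(2,4)] assms(3)]
    congruence_cancel[OF sym_mats_carrier[OF assms(2)] assms(3-5)] by simp

text \<open>After rotation, entry (c, c') of a form is its value at columns c and c' of
  \<open>T\<close>. Middle columns are the diagonalizing vectors, columns in \<open>R\<close> are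
  unit vectors lying in every kernel, and those in \<open>J\<close> are released by the leading
  matrix \<open>D\<close>.\<close>

lemma congruence_fr_blocks:
  fixes a :: "nat \<Rightarrow> real mat" and e :: "nat \<Rightarrow> nat \<Rightarrow> real"
  assumes part: "J \<union> R \<union> {s..<s + q} = {..<n}" and disj: "J \<inter> R = {}" "J \<inter> {s..<s + q} = {}" "R \<inter> {s..<s + q} = {}"
    and D: "D \<in> carrier_mat n n" "fm n D = diagf J d" "\<And>p. p \<in> J \<Longrightarrow> 0 < d p"
    and a: "\<And>i. i < k \<Longrightarrow> a i \<in> sym_mats n"
    and frs: "frs {..<n} (vecs_on ({..<n} - J)) (\<lambda>i. fm n (a i)) k"
    and zk: "zset {..<n} (vecs_on ({..<n} - J)) (\<lambda>i. fm n (a i)) k = vecs_on R"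
    and e: "\<And>t. t < q \<Longrightarrow> e t \<in> zset {..<n} (vecs_on {s..<s + q}) (\<lambda>i. fm n (a i)) (\<iota> t)"
      "\<And>t. t < q \<Longrightarrow> \<iota> t < k"
    and sys: "diag_system {..<n} (\<lambda>i. fm n (a i)) \<iota> e q"
    and T: "T \<in> carrier_mat n n"
      "\<And>i c. i < n \<Longrightarrow> c < n \<Longrightarrow> T $$ (i, c) = (if c \<in> {s..<s + q} then e (c - s) i else if i = c then 1 else 0)"
  shows "regular_fr_seq n (D # map (\<lambda>i. congruence T (a i)) [0..<k])"
    and "reduces_to n (D # map (\<lambda>i. congruence T (a i)) [0..<k]) {X \<in> psd_cone n. fm n X \<in> vecs_on (R \<times> R)}"
proof -
  define F where "F = (\<lambda>i. fm n (a i))"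
  define E0 where "E0 = vecs_on ({..<n} - J)"
  note frs = frs[folded F_def E0_def] and zk = zk[folded F_def E0_def] and e = e[folded F_def] and sys = sys[folded F_def]
  have E0: "lin_sub {..<n} E0" unfolding E0_def by (rule lin_sub_vecs) blast
  define tc where "tc = (\<lambda>c i. if c \<in> {s..<s + q} then e (c - s) i else if i = c then 1 else 0)"
  let ?Y = "\<lambda>i. congruence T (a i)"
  let ?Ys = "D # map ?Y [0..<k]"
  have sub: "zset {..<n} (vecs_on {s..<s + q}) F i \<subseteq> zset {..<n} E0 F i" for i
  proof -
    have "{s..<s + q} \<subseteq> {..<n} - J" using part disj by blast
    then show ?thesis unfolding zset_def E0_def vecs_on_def by blast
  qed
  have entry: "?Y i $$ (c, c') = bf {..<n} (F i) (tc c) (tc c')" if "i < k" "c < n" "c' < n" for i c c'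
  proof -
    have "?Y i $$ (c, c') = fm n (?Y i) (c, c')" using that by (simp add: fm_def)
    also have "\<dots> = basis_form n (mrow n T) (F i) (c, c')"
      unfolding F_def using fm_congruence[OF sym_mats_carrier[OF a[OF that(1)]] T(1)] by simp
    also have "\<dots> = bf {..<n} (F i) (tc c) (tc c')"
      using that by (simp add: basis_form_def bf_def mrow_def tc_def T(2))
    finally show ?thesis .
  qed
  \<comment> \<open>The head \<open>D\<close> occupies block 0, so the middle positions of stage i
    form block \<open>Suc i\<close>.\<close>
  define P where "P = case_nat J (\<lambda>i. {s + t | t. t < q \<and> \<iota> t = i})"
  have P0: "P 0 = J" and PS: "P (Suc i) = {s + t | t. t < q \<and> \<iota> t = i}" for i by (simp_all add: P_def)
  have Jn: "J \<subseteq> {..<n}" and Rn: "R \<subseteq> {..<n}" using part by blast+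
  have mid: "s + t \<in> {..<n}" if "t < q" for t
  proof -
    have "s + t \<in> {s..<s + q}" using that by simp
    then show ?thesis using part by blast
  qed
  have Pcompl: "p \<in> R \<or> (\<exists>t<q. p = s + t \<and> i \<le> \<iota> t)" if "p \<in> {..<n} - (\<Union>j<Suc i. P j)" for p i
  proof (cases "p \<in> R")
    case False
    have "p \<notin> J" using that P0 by auto
    then have "p \<in> {s..<s + q}" using False that part by blast
    then obtain t where t: "t < q" "p = s + t"
      by (metis add_diff_inverse_nat atLeastLessThan_iff not_less nat_add_left_cancel_less)
    have "i \<le> \<iota> t"
    proof (rule ccontr)
      assume "\<not> i \<le> \<iota> t"
      then have "Suc (\<iota> t) < Suc i" by simp
      moreover have "p \<in> P (Suc (\<iota> t))" using t by (auto simp: PS)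
      ultimately show False using that by blast
    qed
    then show ?thesis using t by blast
  qed simp
  have tcR: "tc p \<in> zset {..<n} E0 F k" if "p \<in> R" for p
  proof -
    have "p \<notin> {s..<s + q}" using that disj by blast
    then have "tc p \<in> vecs_on R" using that by (auto simp: tc_def vecs_on_def)
    then show ?thesis by (simp add: zk)
  qed
  have tcM: "tc (s + t) = e t" if "t < q" for t using that by (auto simp: tc_def)
  have tcin: "tc p \<in> zset {..<n} E0 F i" if "p \<in> {..<n} - (\<Union>j<Suc i. P j)" "i \<le> k" for p i
    using Pcompl[OF that(1)]
  proof
    assume "p \<in> R"
    then show ?thesis using tcR zset_antimono[OF that(2), of "{..<n}" E0 F] by blast
  next
    assume "\<exists>t<q. p = s + t \<and> i \<le> \<iota> t"
    then obtain t where t: "t < q" "p = s + t" "i \<le> \<iota> t" by blast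
    then show ?thesis using e(1)[OF t(1)] sub zset_antimono[OF t(3), of "{..<n}" E0 F] by (auto simp: tcM)
  qed
  have syspos: "0 < bf {..<n} (F (\<iota> t)) (e t) (e t)" if "t < q" for t
    using sys that unfolding diag_system_def by blast
  have syszero: "bf {..<n} (F i) (e t) (e u) = 0"
    if "t < q" "u < q" "i \<le> \<iota> t" "i \<le> \<iota> u" "\<not> (t = u \<and> i = \<iota> t)" for t u i
    using sys that unfolding diag_system_def by blast
  have blocks: "fr_blocks n P ?Ys"
    unfolding fr_blocks_def
  proof (intro conjI allI impI ballI)
    have "D \<in> sym_mats n" using D symf_diagf by (simp add: sym_mats_iff)
    then show "set ?Ys \<subseteq> sym_mats n" using sym_congruence[OF a T(1)] by auto
    have "P i \<inter> P j = {}" if "i \<noteq> j" for i j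
    proof (cases i; cases j)
      fix i' assume "i = 0" "j = Suc i'"
      then show ?thesis using disj(2) by (auto simp: P0 PS)
    next
      fix i' assume "i = Suc i'" "j = 0"
      then show ?thesis using disj(2) by (auto simp: P0 PS)
    next
      fix i' j' assume "i = Suc i'" "j = Suc j'"
      then show ?thesis using that by (auto simp: PS)
    qed (use that in simp)
    then show "disjoint_family_on P {..<length ?Ys}" by (simp add: disjoint_family_on_def)
    fix i assume i: "i < length ?Ys"
    show "P i \<subseteq> {..<n}" using Jn mid by (cases i) (auto simp: P0 PS)
    have diag: "0 < (?Ys ! i) $$ (p, p)" if pP: "p \<in> P i" for p
    proof (cases i)
      case 0
      have "p < n" using pP 0 Jn P0 by auto
      then have "D $$ (p, p) = fm n D (p, p)" by (simp add: fm_def)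
      then show ?thesis using D pP 0 by (simp add: P0 diagf_def)
    next
      case (Suc i')
      then obtain t where t: "t < q" "p = s + t" "\<iota> t = i'" using pP by (auto simp: PS)
      have "p < n" using t mid by auto
      have "i' < k" using Suc i by simp
      then have "(?Ys ! i) $$ (p, p) = bf {..<n} (F i') (tc p) (tc p)"
        using entry[OF \<open>i' < k\<close> \<open>p < n\<close> \<open>p < n\<close>] by (simp add: Suc)
      also have "\<dots> = bf {..<n} (F (\<iota> t)) (e t) (e t)" using t tcM by simp
      finally show ?thesis using syspos[OF t(1)] by simp
    qed
    fix p
    show "0 < (?Ys ! i) $$ (p, p)" if "p \<in> P i" by (rule diag[OF that])
    fix q' assume p: "p \<in> {..<n} - (\<Union>j<i. P j)" and q': "q' \<in> {..<n} - (\<Union>j<i. P j)"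
      and ne: "\<not> (p = q' \<and> p \<in> P i)"
    show "(?Ys ! i) $$ (p, q') = 0"
    proof (cases i)
      case 0
      have "D $$ (p, q') = fm n D (p, q')" using p q' by (simp add: fm_def)
      then show ?thesis using D(2) 0 ne by (auto simp: P0 diagf_def)
    next
      case (Suc i')
      then have "i' < k" using i by simp
      have symF: "symf (F i')" and psdF: "\<And>x. x \<in> zset {..<n} E0 F i' \<Longrightarrow> 0 \<le> bf {..<n} (F i') x x"
        using frs \<open>i' < k\<close> by (auto simp: frs_def)
      \<comment> \<open>A column indexed by \<open>R\<close> survives stage i' as well, so it is a
        null vector of a form psd on the current kernel, and its whole row there vanishes.\<close>
      have kernel: "bf {..<n} (F i') (tc u) (tc v) = 0"
        if "u \<in> R" "v \<in> {..<n} - (\<Union>j<i. P j)" for u v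
      proof (rule psd_kernel[OF lin_sub_zset[OF E0 frs] symF psdF])
        have "tc u \<in> zset {..<n} E0 F (Suc i')"
          using tcR[OF that(1)] zset_antimono[of "Suc i'" k "{..<n}" E0 F] \<open>i' < k\<close> by auto
        then show "tc u \<in> zset {..<n} E0 F i'" "bf {..<n} (F i') (tc u) (tc u) = 0" by (auto simp: zset_Suc)
        show "tc v \<in> zset {..<n} E0 F i'" using tcin[of v i'] that(2) Suc \<open>i' < k\<close> by simp
      qed (use \<open>i' < k\<close> in simp)
      have "bf {..<n} (F i') (tc p) (tc q') = 0"
      proof (cases "p \<in> R \<or> q' \<in> R")
        case True
        then show ?thesis using kernel p q' bf_commute[OF symF] by metis
      next
        case False
        obtain t u where tu: "t < q" "p = s + t" "i' \<le> \<iota> t" "u < q" "q' = s + u" "i' \<le> \<iota> u"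
          using Pcompl[of p i'] Pcompl[of q' i'] p q' Suc False by blast
        have "\<not> (t = u \<and> i' = \<iota> t)" using ne tu Suc by (auto simp: PS)
        then show ?thesis using syszero[OF tu(1,4,3,6)] tcM tu by simp
      qed
      then show ?thesis using entry[OF \<open>i' < k\<close>, of p q'] p q' Suc \<open>i' < k\<close> by simp
    qed
  qed
  show "regular_fr_seq n ?Ys" by (rule fr_blocks_regular[OF blocks])
  have R: "R = {..<n} - (\<Union>i<Suc k. P i)"
  proof (intro equalityI subsetI)
    fix p assume "p \<in> R"
    then have p: "p \<notin> J" "p \<notin> {s..<s + q}" "p \<in> {..<n}" using disj Rn by blast+
    have "p \<notin> P i" for i
    proof (cases i)
      case (Suc i')
      have "P i \<subseteq> {s..<s + q}" unfolding Suc PS by auto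
      then show ?thesis using p(2) by blast
    qed (use p(1) P0 in simp)
    then show "p \<in> {..<n} - (\<Union>i<Suc k. P i)" using p(3) by blast
  next
    fix p assume "p \<in> {..<n} - (\<Union>i<Suc k. P i)"
    from Pcompl[OF this] show "p \<in> R"
    proof
      assume "\<exists>t<q. p = s + t \<and> k \<le> \<iota> t"
      then show ?thesis using e(2) by (meson not_le)
    qed
  qed
  have "length ?Ys = Suc k" by simp
  with R have "R = {..<n} - (\<Union>i<length ?Ys. P i)" by (simp only:)
  then show "reduces_to n ?Ys {X \<in> psd_cone n. fm n X \<in> vecs_on (R \<times> R)}"
    by (rule fr_blocks_reduces[OF blocks])
qed

section \<open>Reformulations\<close>

lemma set_subset_nthI: "length A = m \<Longrightarrow> (\<And>i. i < m \<Longrightarrow> A ! i \<in> S) \<Longrightarrow> set A \<subseteq> S"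
  by (metis in_set_conv_nth subsetI)

lemma mat_inner_lincomb:
  assumes A: "set A \<subseteq> sym_mats n" and X: "X \<in> sym_mats n"
  shows "mat_inner (mat_lincomb n A y) X = (\<Sum>i<length A. y $ i * mat_inner (A ! i) X)"
proof -
  have "mat_inner (mat_lincomb n A y) X =
      (\<Sum>i<length A. y $ i * ip ({..<n} \<times> {..<n}) (fm n (A ! i)) (fm n X))"
    unfolding mat_inner_ip[OF lincomb_carrier X] fm_lincomb by (rule ip_sum_left)
  also have "\<dots> = (\<Sum>i<length A. y $ i * mat_inner (A ! i) X)"
  proof (intro sum.cong refl)
    fix i assume "i \<in> {..<length A}"
    then have "A ! i \<in> carrier_mat n n" using A nth_mem[of i A] by (intro sym_mats_carrier) auto
    then show "y $ i * ip ({..<n} \<times> {..<n}) (fm n (A ! i)) (fm n X) = y $ i * mat_inner (A ! i) X"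
      using mat_inner_ip X by metis
  qed
  finally show ?thesis .
qed

lemma lincomb_sym:
  assumes "set A \<subseteq> sym_mats n"
  shows "mat_lincomb n A y \<in> sym_mats n"
proof -
  have "symf (fm n (A ! i))" if "i < length A" for i
    using assms nth_mem[OF that] by (auto simp: sym_mats_iff)
  then have "symf (fm n (mat_lincomb n A y))"
    unfolding fm_lincomb symf_def by (auto intro!: sum.cong)
  then show ?thesis by (simp add: sym_mats_iff)
qed

lemma scalar_prod_sum:
  fixes b y :: "real vec"
  shows "y \<in> carrier_vec m \<Longrightarrow> b \<bullet> y = (\<Sum>t<m. y $ t * b $ t)"
  by (auto simp: scalar_prod_def atLeast0LessThan mult.commute intro!: sum.cong)

text \<open>These coefficients undo a combination: the new row i takes weight
  \<open>y i / z i\<close>, which restores \<open>y i * G i\<close>, and the surplus it brings at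
  the other rows is subtracted there.\<close>

lemma combine_sum:
  fixes y z G :: "nat \<Rightarrow> real"
  assumes i: "i < m" and z: "z i \<noteq> 0"
  shows "(\<Sum>t<m. (if t = i then y i / z i else y t - y i / z i * z t) * (if t = i then \<Sum>u<m. z u * G u else G t))
    = (\<Sum>t<m. y t * G t)"
proof -
  let ?c = "y i / z i"
  define w where "w = (\<Sum>u<m. z u * G u)"
  have split: "(\<Sum>t<m. F t) = F i + (\<Sum>t\<in>{..<m} - {i}. F t)" for F :: "nat \<Rightarrow> real"
    using i by (intro sum.remove) auto
  have w: "w = z i * G i + (\<Sum>t\<in>{..<m} - {i}. z t * G t)" unfolding w_def by (rule split)
  have "(\<Sum>t<m. (if t = i then ?c else y t - ?c * z t) * (if t = i then w else G t))
      = ?c * w + (\<Sum>t\<in>{..<m} - {i}. (y t - ?c * z t) * G t)"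
    by (subst split) (auto intro!: sum.cong)
  also have "(\<Sum>t\<in>{..<m} - {i}. (y t - ?c * z t) * G t)
      = (\<Sum>t\<in>{..<m} - {i}. y t * G t) - ?c * (\<Sum>t\<in>{..<m} - {i}. z t * G t)"
    by (simp add: sum_subtractf sum_distrib_left left_diff_distrib mult.assoc)
  also have "?c * w + \<dots> = y i * G i + (\<Sum>t\<in>{..<m} - {i}. y t * G t)"
    using z by (simp add: w distrib_left)
  also have "\<dots> = (\<Sum>t<m. y t * G t)" by (rule split[symmetric])
  finally show ?thesis unfolding w_def .
qed

text \<open>Inclusion of the row spaces of the augmented systems. Carrying the right-hand side along
  keeps combinations with \<open>b \<bullet> y = 0\<close> available with that property after row
  operations.\<close>

definition row_span_le :: "nat \<Rightarrow> real mat list \<Rightarrow> real vec \<Rightarrow> real mat list \<Rightarrow> real vec \<Rightarrow> bool" where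
  "row_span_le n A b A' b' \<longleftrightarrow> (\<forall>y\<in>carrier_vec (length A). \<exists>y'\<in>carrier_vec (length A').
     mat_lincomb n A' y' = mat_lincomb n A y \<and> b' \<bullet> y' = b \<bullet> y)"

lemma row_span_le_trans:
  "row_span_le n A b A' b' \<Longrightarrow> row_span_le n A' b' A'' b'' \<Longrightarrow> row_span_le n A b A'' b''"
  unfolding row_span_le_def by metis

lemma row_span_le_combine:
  assumes i: "i < length A" and z: "z \<in> carrier_vec (length A)" "z $ i \<noteq> 0" and b: "b \<in> carrier_vec (length A)"
  shows "row_span_le n A b (A[i := mat_lincomb n A z]) (update_vec b i (b \<bullet> z))"
  unfolding row_span_le_def
proof
  fix y :: "real vec" assume y: "y \<in> carrier_vec (length A)"
  let ?m = "length A"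
  let ?y = "\<lambda>t. if t = i then y $ i / z $ i else y $ t - y $ i / z $ i * z $ t"
  have "mat_lincomb n (A[i := mat_lincomb n A z]) (vec ?m ?y) = mat_lincomb n A y"
  proof (rule eq_matI)
    fix p q assume "p < dim_row (mat_lincomb n A y)" "q < dim_col (mat_lincomb n A y)"
    then have pq: "p < n" "q < n" by (auto simp: mat_lincomb_def)
    have "mat_lincomb n (A[i := mat_lincomb n A z]) (vec ?m ?y) $$ (p, q)
        = (\<Sum>t<?m. ?y t * (if t = i then \<Sum>u<?m. z $ u * (A ! u) $$ (p, q) else (A ! t) $$ (p, q)))"
      using pq unfolding mat_lincomb_def by (auto simp: nth_list_update intro!: sum.cong)
    also have "\<dots> = (\<Sum>t<?m. y $ t * (A ! t) $$ (p, q))"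
      by (rule combine_sum[where z = "\<lambda>t. z $ t" and y = "\<lambda>t. y $ t", OF i z(2)])
    finally show "mat_lincomb n (A[i := mat_lincomb n A z]) (vec ?m ?y) $$ (p, q) = mat_lincomb n A y $$ (p, q)"
      using pq by (simp add: mat_lincomb_def)
  qed (simp_all add: mat_lincomb_def)
  moreover have "update_vec b i (b \<bullet> z) \<bullet> vec ?m ?y = b \<bullet> y"
  proof -
    have "update_vec b i (b \<bullet> z) \<bullet> vec ?m ?y
        = (\<Sum>t<?m. ?y t * (if t = i then \<Sum>u<?m. z $ u * b $ u else b $ t))"
      using b scalar_prod_sum[OF z(1), of b] by (auto simp: scalar_prod_sum[of _ ?m] update_vec_def intro!: sum.cong)
    also have "\<dots> = (\<Sum>t<?m. y $ t * b $ t)"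
      by (rule combine_sum[where z = "\<lambda>t. z $ t" and y = "\<lambda>t. y $ t", OF i z(2)])
    finally show ?thesis by (simp add: scalar_prod_sum[OF y])
  qed
  ultimately show "\<exists>y'\<in>carrier_vec (length (A[i := mat_lincomb n A z])).
     mat_lincomb n (A[i := mat_lincomb n A z]) y' = mat_lincomb n A y \<and> update_vec b i (b \<bullet> z) \<bullet> y' = b \<bullet> y"
    by (intro bexI[of _ "vec ?m ?y"]) auto
qed

lemma exchange_nth:
  assumes "i < length A" "j < length A" "t < length A"
  shows "A[i := A ! j, j := A ! i] ! t = A ! (Transposition.transpose i j t)"
  using assms by (auto simp: nth_list_update Transposition.transpose_def)

lemma exchange_index:
  assumes "i < dim_vec b" "j < dim_vec b" "t < dim_vec b"
  shows "update_vec (update_vec b i (b $ j)) j (b $ i) $ t = b $ (Transposition.transpose i j t)"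
  using assms by (auto simp: update_vec_def Transposition.transpose_def)

lemma row_span_le_exchange:
  assumes i: "i < length A" and j: "j < length A" and b: "b \<in> carrier_vec (length A)"
  shows "row_span_le n A b (A[i := A ! j, j := A ! i]) (update_vec (update_vec b i (b $ j)) j (b $ i))"
  unfolding row_span_le_def
proof
  fix y :: "real vec" assume y: "y \<in> carrier_vec (length A)"
  let ?m = "length A"
  let ?\<tau> = "Transposition.transpose i j"
  let ?b = "update_vec (update_vec b i (b $ j)) j (b $ i)"
  let ?y = "vec ?m (\<lambda>t. y $ (?\<tau> t))"
  have \<tau>: "?\<tau> permutes {..<?m}" using i j by (intro permutes_swap_id) auto
  have perm: "(\<Sum>t<?m. g (?\<tau> t)) = (\<Sum>t<?m. g t)" for g :: "nat \<Rightarrow> real"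
    using sum.permute[OF \<tau>, of g] by (simp add: o_def)
  have "mat_lincomb n (A[i := A ! j, j := A ! i]) ?y = mat_lincomb n A y"
  proof (rule eq_matI)
    fix p q assume "p < dim_row (mat_lincomb n A y)" "q < dim_col (mat_lincomb n A y)"
    then have pq: "p < n" "q < n" by (auto simp: mat_lincomb_def)
    have "mat_lincomb n (A[i := A ! j, j := A ! i]) ?y $$ (p, q) = (\<Sum>t<?m. y $ (?\<tau> t) * (A ! (?\<tau> t)) $$ (p, q))"
      using pq exchange_nth[OF i j] by (simp add: mat_lincomb_def)
    also have "\<dots> = mat_lincomb n A y $$ (p, q)"
      using pq perm[of "\<lambda>t. y $ t * (A ! t) $$ (p, q)"] by (simp add: mat_lincomb_def)
    finally show "mat_lincomb n (A[i := A ! j, j := A ! i]) ?y $$ (p, q) = mat_lincomb n A y $$ (p, q)" .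
  qed (simp_all add: mat_lincomb_def)
  moreover have "?b \<bullet> ?y = b \<bullet> y"
  proof -
    have "?b \<bullet> ?y = (\<Sum>t<?m. ?y $ t * ?b $ t)" by (rule scalar_prod_sum) simp
    also have "\<dots> = (\<Sum>t<?m. y $ (?\<tau> t) * b $ (?\<tau> t))"
      using exchange_index[of i b j] i j b by (intro sum.cong refl) auto
    also have "\<dots> = b \<bullet> y" using perm[of "\<lambda>t. y $ t * b $ t"] by (simp add: scalar_prod_sum[OF y])
    finally show ?thesis .
  qed
  ultimately show "\<exists>y'\<in>carrier_vec (length (A[i := A ! j, j := A ! i])).
     mat_lincomb n (A[i := A ! j, j := A ! i]) y' = mat_lincomb n A y \<and> ?b \<bullet> y' = b \<bullet> y"
    by (intro bexI[of _ ?y]) auto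
qed

text \<open>Steinitz exchange: the prescribed combinations \<open>a i\<close> are brought one by one
  to the front. The last clause is what keeps matrices orthogonal to all old equations orthogonal to
  the new ones.\<close>

lemma row_operations:
  assumes A: "length A = m" "set A \<subseteq> sym_mats n" and b: "b \<in> carrier_vec m"
  shows "(\<And>i. i < k \<Longrightarrow> \<exists>y\<in>carrier_vec m. a i = mat_lincomb n A y \<and> b \<bullet> y = 0) \<Longrightarrow>
    (\<And>i c. i < k \<Longrightarrow> \<exists>p<n. \<exists>q<n. a i $$ (p, q) \<noteq> (\<Sum>j<i. c j * a j $$ (p, q))) \<Longrightarrow>
    \<exists>A' b'. (reform_step n R)\<^sup>*\<^sup>* (A, b, C) (A', b', C) \<and> length A' = m \<and> set A' \<subseteq> sym_mats n \<and>
      b' \<in> carrier_vec m \<and> k \<le> m \<and> (\<forall>i<k. A' ! i = a i \<and> b' $ i = 0) \<and> row_span_le n A b A' b' \<and>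
      (\<forall>Y\<in>sym_mats n. (\<forall>i<m. mat_inner (A ! i) Y = 0) \<longrightarrow> (\<forall>i<m. mat_inner (A' ! i) Y = 0))"
proof (induction k)
  case 0
  have "row_span_le n A b A b" unfolding row_span_le_def by blast
  then show ?case using A b by (intro exI[of _ A] exI[of _ b]) auto
next
  case (Suc k)
  obtain A1 b1 where steps: "(reform_step n R)\<^sup>*\<^sup>* (A, b, C) (A1, b1, C)"
    and A1: "length A1 = m" "set A1 \<subseteq> sym_mats n" and b1: "b1 \<in> carrier_vec m" and "k \<le> m"
    and first: "\<And>i. i < k \<Longrightarrow> A1 ! i = a i" "\<And>i. i < k \<Longrightarrow> b1 $ i = 0"
    and span: "row_span_le n A b A1 b1"
    and perp: "\<And>Y. Y \<in> sym_mats n \<Longrightarrow> \<forall>i<m. mat_inner (A ! i) Y = 0 \<Longrightarrow> \<forall>i<m. mat_inner (A1 ! i) Y = 0"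
    using Suc.IH[OF Suc.prems] less_SucI by (metis (no_types, lifting))
  obtain y where y: "y \<in> carrier_vec m" "a k = mat_lincomb n A y" "b \<bullet> y = 0"
    using Suc.prems(1)[of k] by auto
  obtain z where z: "z \<in> carrier_vec m" "a k = mat_lincomb n A1 z" "b1 \<bullet> z = 0"
    using span y A1(1) A(1) unfolding row_span_le_def by metis
  \<comment> \<open>If all coefficients from position k on were zero, \<open>a k\<close> would be a
    combination of the rows already placed.\<close>
  have "\<exists>t. k \<le> t \<and> t < m \<and> z $ t \<noteq> 0"
  proof (rule ccontr)
    assume none: "\<nexists>t. k \<le> t \<and> t < m \<and> z $ t \<noteq> 0"
    obtain p q where pq: "p < n" "q < n" "a k $$ (p, q) \<noteq> (\<Sum>j<k. z $ j * a j $$ (p, q))"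
      using Suc.prems(2)[of k "\<lambda>j. z $ j"] by auto
    have "a k $$ (p, q) = (\<Sum>j<m. z $ j * (A1 ! j) $$ (p, q))"
      using pq A1(1) by (simp add: z(2) mat_lincomb_def)
    also have "\<dots> = (\<Sum>j<k. z $ j * (A1 ! j) $$ (p, q))"
      using none \<open>k \<le> m\<close> by (intro sum.mono_neutral_right) auto
    also have "\<dots> = (\<Sum>j<k. z $ j * a j $$ (p, q))" using first by simp
    finally show False using pq(3) by simp
  qed
  then obtain t where t: "k \<le> t" "t < m" "z $ t \<noteq> 0" by blast
  \<comment> \<open>Row t, whose coefficient is nonzero, becomes \<open>a k\<close> by a combination
    and is then exchanged with row k; the rows before k are untouched.\<close>
  define A2 b2 where "A2 = A1[t := mat_lincomb n A1 z]" and "b2 = update_vec b1 t (b1 \<bullet> z)"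
  define A3 b3 where "A3 = A2[k := A2 ! t, t := A2 ! k]" and "b3 = update_vec (update_vec b2 k (b2 $ t)) t (b2 $ k)"
  have len: "length A2 = m" "length A3 = m" using A1 by (simp_all add: A2_def A3_def)
  have dim: "b2 \<in> carrier_vec m" "b3 \<in> carrier_vec m"
    using b1 by (auto simp: b2_def b3_def update_vec_def)
  have "reform_step n R (A1, b1, C) (A2, b2, C)"
    unfolding A2_def b2_def using t z A1 by (intro reform_step.combine) auto
  moreover have "reform_step n R (A2, b2, C) (A3, b3, C)"
    unfolding A3_def b3_def using t len by (intro reform_step.exchange) auto
  ultimately have steps': "(reform_step n R)\<^sup>*\<^sup>* (A, b, C) (A3, b3, C)"
    using steps by (meson rtranclp.rtrancl_into_rtrancl)
  have "row_span_le n A1 b1 A2 b2"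
    unfolding A2_def b2_def using t z A1 b1 by (intro row_span_le_combine) auto
  moreover have "row_span_le n A2 b2 A3 b3"
    unfolding A3_def b3_def using t len dim by (intro row_span_le_exchange) auto
  ultimately have span': "row_span_le n A b A3 b3" using span row_span_le_trans by blast
  have nth2: "A2 ! i = (if i = t then a k else A1 ! i)" if "i < m" for i
    using that A1(1) t(2) z(2) by (auto simp: A2_def)
  have nth3: "A3 ! i = A2 ! (Transposition.transpose k t i)" if "i < m" for i
    unfolding A3_def using exchange_nth[of k A2 t i] len t that by simp
  have tr: "Transposition.transpose k t i < m" if "i < m" for i
    using that t by (auto simp: Transposition.transpose_def)
  have b3i: "b3 $ i = b2 $ (Transposition.transpose k t i)" if "i < m" for i
    unfolding b3_def using exchange_index[of k b2 t i] dim t that by simp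
  have b2i: "b2 $ i = (if i = t then 0 else b1 $ i)" if "i < m" for i
    using that b1 z(3) by (auto simp: b2_def update_vec_def)
  have first': "A3 ! i = a i \<and> b3 $ i = 0" if "i < Suc k" for i
  proof (cases "i = k")
    case True
    then show ?thesis using t nth3[of k] nth2[of t] b3i[of k] b2i[of t] by simp
  next
    case False
    then have "i < k" "i < m" "i \<noteq> t" using that t by auto
    then have "Transposition.transpose k t i = i" by (simp add: Transposition.transpose_def)
    then show ?thesis using nth3[OF \<open>i < m\<close>] nth2[OF \<open>i < m\<close>] b3i[OF \<open>i < m\<close>] b2i[OF \<open>i < m\<close>]
      first[OF \<open>i < k\<close>] \<open>i \<noteq> t\<close> by simp
  qed
  have ak: "a k \<in> sym_mats n" using lincomb_sym[OF A(2)] y(2) by simp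
  have mem: "A3 ! i \<in> insert (a k) (set A1)" if "i < m" for i
    using nth3[OF that] nth2[OF tr[OF that]] tr[OF that] A1(1) by auto
  have "A3 ! i \<in> sym_mats n" if "i < m" for i using mem[OF that] ak A1(2) by (metis insert_iff subsetD)
  with len(2) have sym3: "set A3 \<subseteq> sym_mats n" by (rule set_subset_nthI)
  have perp': "mat_inner (A3 ! i) Y = 0"
    if Y: "Y \<in> sym_mats n" "\<forall>i<m. mat_inner (A ! i) Y = 0" and i: "i < m" for Y i
  proof -
    have "mat_inner (a k) Y = 0"
      unfolding y(2) mat_inner_lincomb[OF A(2) Y(1)] using Y(2) A(1) by simp
    moreover have "mat_inner M Y = 0" if M: "M \<in> set A1" for M
    proof -
      obtain j where "j < m" "M = A1 ! j" using M A1(1) by (metis in_set_conv_nth)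
      then show ?thesis using perp[OF Y] by blast
    qed
    ultimately show ?thesis using mem[OF i] by (metis insert_iff)
  qed
  show ?case
  proof (rule exI[of _ A3], rule exI[of _ b3], intro conjI)
    show "\<forall>i<Suc k. A3 ! i = a i \<and> b3 $ i = 0" using first' by blast
    show "\<forall>Y\<in>sym_mats n. (\<forall>i<m. mat_inner (A ! i) Y = 0) \<longrightarrow> (\<forall>i<m. mat_inner (A3 ! i) Y = 0)"
      using perp' by blast
    show "Suc k \<le> m" using t by simp
  qed fact+
qed

section \<open>Admissible rotations and transport of solutions along a reformulation\<close>

definition unit_cols :: "nat \<Rightarrow> nat set \<Rightarrow> real mat \<Rightarrow> bool" where
  "unit_cols n K S \<longleftrightarrow> (\<forall>c\<in>K. \<forall>i<n. S $$ (i, c) = (if i = c then 1 else 0))"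

lemma unit_cols_mult:
  assumes "S \<in> carrier_mat n n" "T \<in> carrier_mat n n" "K \<subseteq> {..<n}" "unit_cols n K S" "unit_cols n K T"
  shows "unit_cols n K (S * T)"
  unfolding unit_cols_def
proof (intro ballI allI impI)
  fix c i assume c: "c \<in> K" and i: "i < n"
  have "c < n" using c assms(3) by blast
  have "(S * T) $$ (i, c) = (\<Sum>j<n. S $$ (i, j) * T $$ (j, c))"
    using assms(1,2) i \<open>c < n\<close> by (auto simp: scalar_prod_def atLeast0LessThan intro!: sum.cong)
  also have "\<dots> = (\<Sum>j<n. if j = c then S $$ (i, j) else 0)"
    using assms(5) c by (intro sum.cong) (auto simp: unit_cols_def)
  also have "\<dots> = (if i = c then 1 else 0)"
    using assms(4) c i \<open>c < n\<close> by (simp add: unit_cols_def)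
  finally show "(S * T) $$ (i, c) = (if i = c then 1 else 0)" .
qed

lemma block_mat_entry:
  fixes U :: "real mat"
  assumes "U \<in> carrier_mat p p" "n = s + p + r"
  shows "diag_block_mat [1\<^sub>m s, U, 1\<^sub>m r] \<in> carrier_mat n n"
    and "i < n \<Longrightarrow> j < n \<Longrightarrow> diag_block_mat [1\<^sub>m s, U, 1\<^sub>m r] $$ (i, j) =
      (if i \<in> {s..<s + p} \<and> j \<in> {s..<s + p} then U $$ (i - s, j - s) else if i = j then 1 else 0)"
  using assms by (auto simp: Let_def)

text \<open>Transport needs both the rotation and its transposed inverse to fix the unit vectors of
  the two outer blocks; \<open>T'\<close> is that transposed inverse.\<close>

lemma admissible_unit_cols:
  assumes T: "T \<in> admissible_mats n s r" "r + s < n" "invertible_mat T"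
  defines "K \<equiv> {..<n} - {s..<n - r}"
  obtains T' where "T \<in> carrier_mat n n" "T' \<in> carrier_mat n n" "T * T'\<^sup>T = 1\<^sub>m n"
    "unit_cols n K T" "unit_cols n K T'"
proof -
  obtain U where U: "T = diag_block_mat [1\<^sub>m s, U, 1\<^sub>m r]" "U \<in> carrier_mat (n - r - s) (n - r - s)"
    using T(1) by (auto simp: admissible_mats_def)
  have n: "n = s + (n - r - s) + r" using T(2) by simp
  note entry = block_mat_entry[OF U(2) n, folded U(1)]
  have mid: "s + (n - r - s) = n - r" using T(2) by simp
  note carrier = entry(1)
  obtain B where B: "T * B = 1\<^sub>m n" "B * T = 1\<^sub>m (dim_row B)"
    using T(3) carrier unfolding invertible_mat_def inverts_mat_def by auto
  have "dim_col B = n" using arg_cong[OF B(1), of dim_col] by simp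
  moreover have "dim_row B = n" using arg_cong[OF B(2), of dim_col] carrier by simp
  ultimately have Bc: "B \<in> carrier_mat n n" by blast
  have "unit_cols n K T"
    using entry(2) by (auto simp: unit_cols_def K_def mid)
  moreover have "unit_cols n K (B\<^sup>T)"
    unfolding unit_cols_def
  proof (intro ballI allI impI)
    fix c i assume c: "c \<in> K" and i: "i < n"
    have "c < n" using c by (simp add: K_def)
    \<comment> \<open>Row c of \<open>T\<close> is a unit row, so row c of the product
      \<open>T * B\<close> is simply row c of \<open>B\<close>.\<close>
    have row: "T $$ (c, j) = (if j = c then 1 else 0)" if "j < n" for j
      using entry(2)[OF \<open>c < n\<close> that] c by (auto simp: K_def mid)
    have "(if i = c then 1 else 0) = (T * B) $$ (c, i)" using B(1) i \<open>c < n\<close> by auto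
    also have "\<dots> = (\<Sum>j<n. T $$ (c, j) * B $$ (j, i))"
      using carrier Bc i \<open>c < n\<close> by (auto simp: scalar_prod_def atLeast0LessThan intro!: sum.cong)
    also have "\<dots> = (\<Sum>j<n. if j = c then B $$ (j, i) else 0)"
      using row by (intro sum.cong) auto
    also have "\<dots> = B\<^sup>T $$ (i, c)" using \<open>c < n\<close> i Bc by simp
    finally show "B\<^sup>T $$ (i, c) = (if i = c then 1 else 0)" ..
  qed
  ultimately show ?thesis using that[of "B\<^sup>T"] carrier Bc B(1) by simp
qed

text \<open>The reformulated data are those of the original SDP rotated by \<open>S\<close>, up to a change of the
  equations; \<open>S'\<close> is the transposed inverse of \<open>S\<close>.\<close>

locale sdp_transport =
  fixes n m :: nat and K :: "nat set" and A :: "real mat list" and b :: "real vec" and C :: "real mat"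
    and A' :: "real mat list" and b' :: "real vec" and C' S S' :: "real mat"
  assumes len: "length A' = m" and sym: "set A' \<subseteq> sym_mats n" and b': "b' \<in> carrier_vec m"
    and S: "S \<in> carrier_mat n n" "S' \<in> carrier_mat n n" "S * S'\<^sup>T = 1\<^sub>m n"
      "unit_cols n K S" "unit_cols n K S'"
    and C': "C' = congruence S C"
    and primal: "\<And>X i. X \<in> sym_mats n \<Longrightarrow> \<forall>i<m. mat_inner (A ! i) X = b $ i \<Longrightarrow> i < m \<Longrightarrow>
      mat_inner (A' ! i) (congruence S' X) = b' $ i"
    and dual: "\<And>Y i. Y \<in> sym_mats n \<Longrightarrow> \<forall>i<m. mat_inner (A' ! i) Y = 0 \<Longrightarrow> i < m \<Longrightarrow>
      mat_inner (A ! i) (S * Y * S\<^sup>T) = 0"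

text \<open>Induction along the operations: a rotation multiplies \<open>S\<close> and
  \<open>S'\<close>, while exchanges and combinations keep them and change only the equations. Row
  operations are invertible, which is what the backward clause for homogeneous solutions rests
  on.\<close>

lemma reformulation_transport:
  assumes A: "length A = m" "set A \<subseteq> sym_mats n" and b: "b \<in> carrier_vec m" and C: "C \<in> carrier_mat n n"
    and rs: "r + s < n"
  defines "K \<equiv> {..<n} - {s..<n - r}"
  assumes steps: "(reform_step n (admissible_mats n s r))\<^sup>*\<^sup>* (A, b, C) P"
  shows "\<exists>A' b' C' S S'. P = (A', b', C') \<and> sdp_transport n m K A b C A' b' C' S S'"
  using steps
proof (induction rule: rtranclp_induct)
  case base
  have "unit_cols n K (1\<^sub>m n)" by (auto simp: unit_cols_def K_def)
  moreover have "1\<^sub>m n * X * 1\<^sub>m n = X" if "X \<in> sym_mats n" for X :: "real mat"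
    using sym_mats_carrier[OF that] by simp
  ultimately have "sdp_transport n m K A b C A b C (1\<^sub>m n) (1\<^sub>m n)"
    using A b C by unfold_locales auto
  then show ?case by blast
next
  case (step P Q)
  obtain A' b' C' S S' where P: "P = (A', b', C')" and tr: "sdp_transport n m K A b C A' b' C' S S'"
    using step.IH by blast
  interpret tr: sdp_transport n m K A b C A' b' C' S S' by (rule tr)
  note A' = tr.len tr.sym and b' = tr.b' and S = tr.S and C' = tr.C'
  have A'i: "A' ! i \<in> sym_mats n" if "i < m" for i using A' nth_mem[of i A'] that by auto
  have KI: "K \<subseteq> {..<n}" by (auto simp: K_def)
  from step.hyps(2)[unfolded P] show ?case
  proof (cases rule: reform_step.cases)
    case (rotate T)
    obtain T' where T: "T \<in> carrier_mat n n" "T' \<in> carrier_mat n n" "T * T'\<^sup>T = 1\<^sub>m n"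
      "unit_cols n K T" "unit_cols n K T'"
      using admissible_unit_cols[OF rotate(2) rs rotate(4)] unfolding K_def by blast
    define A'' where "A'' = map (\<lambda>M. congruence T M) A'"
    have A'': "length A'' = m" "set A'' \<subseteq> sym_mats n"
      using A' sym_congruence[OF _ T(1)] by (auto simp: A''_def)
    have A''i: "A'' ! i = congruence T (A' ! i)" if "i < m" for i
      using that A' by (simp add: A''_def)
    have inv: "(S * T) * (S' * T')\<^sup>T = 1\<^sub>m n"
    proof -
      have "(S * T) * (S' * T')\<^sup>T = S * (T * (T'\<^sup>T * S'\<^sup>T))"
        using S T by (simp add: transpose_mult[of _ n n _ n] assoc_mult_mat[of _ n n _ n _ n])
      also have "T * (T'\<^sup>T * S'\<^sup>T) = (T * T'\<^sup>T) * S'\<^sup>T"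
        using S T by (intro assoc_mult_mat[symmetric]) auto
      finally show ?thesis using S T by simp
    qed
    have C'': "congruence T C' = congruence (S * T) C"
      unfolding C' using S T C by (simp add: transpose_mult[of _ n n _ n] assoc_mult_mat[of _ n n _ n _ n])
    have fwd': "mat_inner (A'' ! i) (congruence (S' * T') X) = b' $ i"
      if X: "X \<in> sym_mats n" "\<forall>i<m. mat_inner (A ! i) X = b $ i" and i: "i < m" for X i
    proof -
      have "congruence (S' * T') X = congruence T' (congruence S' X)"
        using S T sym_mats_carrier[OF X(1)]
        by (simp add: transpose_mult[of _ n n _ n] assoc_mult_mat[of _ n n _ n _ n])
      then have "mat_inner (A'' ! i) (congruence (S' * T') X)
          = mat_inner (A' ! i) (congruence S' X)"
        unfolding A''i[OF i]
        using mat_inner_congruence_dual[OF A'i[OF i] sym_congruence[OF X(1) S(2)] T(1-3)] by simp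
      then show ?thesis using tr.primal[OF X i] by simp
    qed
    have bwd': "mat_inner (A ! i) ((S * T) * Y * (S * T)\<^sup>T) = 0"
      if Y: "Y \<in> sym_mats n" "\<forall>i<m. mat_inner (A'' ! i) Y = 0" and i: "i < m" for Y i
    proof -
      have TY: "T * Y * T\<^sup>T \<in> sym_mats n"
        using sym_congruence[OF Y(1), of "T\<^sup>T"] T(1) by simp
      have "mat_inner (A' ! i) (T * Y * T\<^sup>T) = 0" if "i < m" for i
        using mat_inner_congruence[OF A'i[OF that] Y(1) T(1)] Y(2) A''i[OF that] that by metis
      then have "mat_inner (A ! i) (S * (T * Y * T\<^sup>T) * S\<^sup>T) = 0"
        using tr.dual[OF TY _ i] by blast
      moreover have "S * (T * Y * T\<^sup>T) * S\<^sup>T = (S * T) * Y * (S * T)\<^sup>T"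
        using S T sym_mats_carrier[OF Y(1)]
        by (simp add: transpose_mult[of _ n n _ n] assoc_mult_mat[of _ n n _ n _ n])
      ultimately show ?thesis by simp
    qed
    have "sdp_transport n m K A b C A'' b' (congruence T C') (S * T) (S' * T')"
      using S T unit_cols_mult[OF S(1) T(1) KI S(4) T(4)] unit_cols_mult[OF S(2) T(2) KI S(5) T(5)]
      by (intro sdp_transport.intro A'' b' inv C'' fwd' bwd') auto
    then show ?thesis using rotate(1) A''_def by blast
  next
    case (exchange i j)
    define A'' b'' where "A'' = A'[i := A' ! j, j := A' ! i]"
      and "b'' = update_vec (update_vec b' i (b' $ j)) j (b' $ i)"
    let ?\<tau> = "Transposition.transpose i j"
    have ij: "i < m" "j < m" using exchange A' by auto
    have \<tau>: "?\<tau> t < m" if "t < m" for t using that ij by (auto simp: Transposition.transpose_def)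
    have A''t: "A'' ! t = A' ! (?\<tau> t)" if "t < m" for t
      unfolding A''_def using exchange_nth[of i A' j t] ij that A' by simp
    have b''t: "b'' $ t = b' $ (?\<tau> t)" if "t < m" for t
      unfolding b''_def using exchange_index[of i b' j t] ij that b' by simp
    have len: "length A'' = m" "b'' \<in> carrier_vec m" using A' b' by (auto simp: A''_def b''_def update_vec_def)
    have "A'' ! t \<in> sym_mats n" if "t < m" for t using A''t[OF that] A'i[OF \<tau>[OF that]] by simp
    with len(1) have sym: "set A'' \<subseteq> sym_mats n" by (rule set_subset_nthI)
    have fwd': "mat_inner (A'' ! t) (congruence S' X) = b'' $ t"
      if X: "X \<in> sym_mats n" "\<forall>i<m. mat_inner (A ! i) X = b $ i" and t: "t < m" for X t
      unfolding A''t[OF t] b''t[OF t] by (rule tr.primal[OF X \<tau>[OF t]])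
    have bwd': "mat_inner (A ! t) (S * Y * S\<^sup>T) = 0"
      if Y: "Y \<in> sym_mats n" "\<forall>t<m. mat_inner (A'' ! t) Y = 0" and t: "t < m" for Y t
    proof -
      have "mat_inner (A' ! u) Y = 0" if "u < m" for u
        using Y(2) \<tau>[OF that] A''t[OF \<tau>[OF that]] by (metis transpose_involutory)
      then show ?thesis using tr.dual[OF Y(1) _ t] by blast
    qed
    have "sdp_transport n m K A b C A'' b'' C' S S'"
      by (intro sdp_transport.intro len sym S C' fwd' bwd')
    then show ?thesis using exchange(1) A''_def b''_def by blast
  next
    case (combine i z)
    define A'' b'' where "A'' = A'[i := mat_lincomb n A' z]" and "b'' = update_vec b' i (b' \<bullet> z)"
    have i: "i < m" and z: "z \<in> carrier_vec m" "z $ i \<noteq> 0" using combine A' by auto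
    have A''t: "A'' ! t = (if t = i then mat_lincomb n A' z else A' ! t)" if "t < m" for t
      using that A' i by (auto simp: A''_def)
    have b''t: "b'' $ t = (if t = i then b' \<bullet> z else b' $ t)" if "t < m" for t
      using that b' by (auto simp: b''_def update_vec_def)
    have len: "length A'' = m" "b'' \<in> carrier_vec m" using A' b' by (auto simp: A''_def b''_def update_vec_def)
    have sym: "set A'' \<subseteq> sym_mats n"
    proof -
      have "A'' ! t \<in> sym_mats n" if "t < m" for t
        using A''t[OF that] A'i[OF that] lincomb_sym[OF A'(2)] by simp
      with len(1) show ?thesis by (rule set_subset_nthI)
    qed
    have lin: "mat_inner (mat_lincomb n A' z) X = (\<Sum>t<m. z $ t * mat_inner (A' ! t) X)" if "X \<in> sym_mats n" for X
      using mat_inner_lincomb[OF A'(2) that] A'(1) by simp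
    have fwd': "mat_inner (A'' ! t) (congruence S' X) = b'' $ t"
      if X: "X \<in> sym_mats n" "\<forall>i<m. mat_inner (A ! i) X = b $ i" and t: "t < m" for X t
    proof -
      have *: "mat_inner (A' ! t) (congruence S' X) = b' $ t" if "t < m" for t
        by (rule tr.primal[OF X that])
      have "mat_inner (mat_lincomb n A' z) (congruence S' X) = b' \<bullet> z"
        unfolding lin[OF sym_congruence[OF X(1) S(2)]] scalar_prod_sum[OF z(1)] using * by simp
      then show ?thesis using * t A''t b''t by simp
    qed
    \<comment> \<open>All rows but the i-th are unchanged and vanish on \<open>Y\<close>; the new
      row i then reduces to \<open>z $ i\<close> times the old one, and \<open>z $ i\<close> is
      nonzero.\<close>
    have zero: "mat_inner (A' ! t) Y = 0" if Y: "Y \<in> sym_mats n" "\<forall>t<m. mat_inner (A'' ! t) Y = 0" and t: "t < m" for Y t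
    proof -
      have ne: "mat_inner (A' ! u) Y = 0" if "u < m" "u \<noteq> i" for u using Y(2) that A''t by (metis (full_types))
      have "mat_inner (A'' ! i) Y = 0" using Y(2) i by blast
      then have "0 = (\<Sum>u<m. z $ u * mat_inner (A' ! u) Y)"
        using A''t[OF i] lin[OF Y(1)] by simp
      also have "\<dots> = (\<Sum>u<m. if u = i then z $ u * mat_inner (A' ! u) Y else 0)"
        using ne by (intro sum.cong) auto
      also have "\<dots> = z $ i * mat_inner (A' ! i) Y" using i by simp
      finally show ?thesis using z(2) ne t by auto
    qed
    have bwd': "mat_inner (A ! t) (S * Y * S\<^sup>T) = 0"
      if "Y \<in> sym_mats n" "\<forall>t<m. mat_inner (A'' ! t) Y = 0" "t < m" for Y t
      using tr.dual[OF that(1) _ that(3)] zero[OF that(1,2)] by blast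
    have "sdp_transport n m K A b C A'' b'' C' S S'"
      by (intro sdp_transport.intro len sym S C' fwd' bwd')
    then show ?thesis using combine(1) A''_def b''_def by blast
  qed
qed

lemma zset_cong: "(\<And>j. j < i \<Longrightarrow> as j = as' j) \<Longrightarrow> zset I E as i = zset I E as' i"
  by (simp add: zset_def)

lemma frs_cong:
  assumes "\<And>j. j < k \<Longrightarrow> as j = as' j"
  shows "frs I E as k = frs I E as' k"
proof -
  have "zset I E as i = zset I E as' i" if "i < k" for i
    using that assms by (intro zset_cong) simp
  then show ?thesis using assms by (simp add: frs_def)
qed

section \<open>The primal-dual pair\<close>

text \<open>The midpoint of \<open>X\<close> and \<open>X0\<close> is again optimal. Were the
  diagonal of \<open>X\<close> nonzero at some p outside \<open>R\<close>, the midpoint would be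
  positive definite on \<open>R\<close> together with p, and its rank would exceed that of
  \<open>X0\<close>.\<close>

lemma max_rank_support:
  assumes X0: "X0 \<in> carrier_mat n n" "fm n X0 = diagf R d" and R: "R \<subseteq> {..<n}"
    and d: "\<And>i. i \<in> R \<Longrightarrow> 0 < d i" and mr: "max_rank n Q X0"
    and X: "X \<in> psd_cone n" and mid: "Q ((1/2) \<cdot>\<^sub>m (X + X0))"
  shows "fm n X \<in> vecs_on (R \<times> R)"
proof -
  let ?W = "(1/2) \<cdot>\<^sub>m (X + X0)"
  have Xc: "X \<in> carrier_mat n n" using X by (simp add: psd_cone_iff sym_mats_carrier)
  have zero: "X $$ (p, p) = 0" if p: "p < n" "p \<notin> R" for p
  proof (rule ccontr)
    assume "X $$ (p, p) \<noteq> 0"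
    then have pos: "0 < X $$ (p, p)" using psd_diag[OF X p(1)] by simp
    have fmW: "fm n ?W = (\<lambda>q. 1/2 * (fm n X q + 1 * fm n X0 q))"
      using Xc X0(1) by (simp add: fm_smult fm_add)
    have "card (insert p R) \<le> vec_space.rank n ?W"
    proof (rule rank_ge_pd_block)
      show "?W \<in> carrier_mat n n" "insert p R \<subseteq> {..<n}" using Xc X0 p R by auto
      fix x assume x: "x \<in> vecs_on (insert p R)" "x \<noteq> (\<lambda>_. 0)"
      have bfW: "bf {..<n} (fm n ?W) x x = 1/2 * (bf {..<n} (fm n X) x x + bf {..<n} (diagf R d) x x)"
        unfolding fmW X0(2) bf_eq_ip ip_scale_left ip_add_left by simp
      have nnX: "0 \<le> bf {..<n} (fm n X) x x" using X by (simp add: psd_cone_iff)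
      have nn: "0 \<le> d i * (x i)\<^sup>2" if "i \<in> R" for i using d[OF that] by simp
      show "0 < bf {..<n} (fm n ?W) x x"
      \<comment> \<open>Either \<open>x\<close> has a component in \<open>R\<close>, where
        \<open>X0\<close> is positive, or it is a multiple of the unit vector at p, where
        \<open>X\<close> is.\<close>
      proof (cases "\<exists>i\<in>R. x i \<noteq> 0")
        case True
        then obtain i where i: "i \<in> R" "x i \<noteq> 0" by blast
        have "finite R" using R finite_subset by blast
        have "0 < d i * (x i)\<^sup>2" using d[OF i(1)] i(2) by simp
        also have "\<dots> \<le> (\<Sum>i\<in>R. d i * (x i)\<^sup>2)" using nn i(1) \<open>finite R\<close> by (intro member_le_sum) auto
        also have "\<dots> = bf {..<n} (diagf R d) x x" using R by (simp add: bf_diagf)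
        finally show ?thesis unfolding bfW using nnX by simp
      next
        case False
        have xz: "x i = 0" if "i \<noteq> p" for i using False x(1) that by (auto simp: vecs_on_def)
        have "x p \<noteq> 0"
        proof
          assume "x p = 0"
          then have "x i = 0" for i using xz by (cases "i = p") simp_all
          then show False using x(2) by blast
        qed
        have eq: "x = (\<lambda>i. x p * (if i = p then 1 else 0))" using xz by auto
        have "bf {..<n} (fm n X) x x = bf {..<n} (fm n X) (\<lambda>i. x p * (if i = p then 1 else 0)) (\<lambda>i. x p * (if i = p then 1 else 0))"
          by (rule arg_cong2[of x _ x _ "bf {..<n} (fm n X)", OF eq eq])
        also have "\<dots> = x p * (x p * bf {..<n} (fm n X) (\<lambda>i. if i = p then 1 else 0) (\<lambda>i. if i = p then 1 else 0))"
          by (simp only: bf_scale_left bf_scale_right)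
        also have "\<dots> = x p * (x p * X $$ (p, p))" using p(1) by (simp add: bf_delta fm_def)
        finally have "0 < bf {..<n} (fm n X) x x"
          using pos \<open>x p \<noteq> 0\<close> by (auto simp: mult.assoc[symmetric] zero_less_mult_iff)
        moreover have "0 \<le> bf {..<n} (diagf R d) x x" using R nn by (simp add: bf_diagf sum_nonneg)
        ultimately show ?thesis unfolding bfW by simp
      qed
    qed
    also have "\<dots> \<le> vec_space.rank n X0" using mr mid unfolding max_rank_def by blast
    also have "\<dots> \<le> card R"
    proof (rule rank_le_support[OF X0(1) R])
      fix i j assume "i < n" "j < n" "X0 $$ (i, j) \<noteq> 0"
      then have "fm n X0 (i, j) \<noteq> 0" by (simp add: fm_def)
      then show "j \<in> R" unfolding X0(2) by (auto simp: diagf_def split: if_splits)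
    qed
    finally show False using p(2) R finite_subset[of R "{..<n}"] by (simp add: card_insert_if)
  qed
  have "fm n X (i, j) = 0" if "i \<notin> R \<or> j \<notin> R" for i j
    using that psd_zero_diag(1)[OF X _ zero] psd_zero_diag(2)[OF X _ zero] by (auto simp: fm_def)
  then show ?thesis unfolding vecs_on_def by auto
qed

locale sdp_pair =
  fixes n m r s :: nat and A :: "real mat list" and b :: "real vec" and C \<Lambda> \<Gamma> Xs Zs :: "real mat"
  assumes sdp: "is_sdp n m (A, b, C)"
    and r: "1 \<le> r" and s: "1 \<le> s" and rs: "r + s < n"
    and \<Lambda>: "diagonal_mat \<Lambda>" "\<Lambda> \<in> pd_mats r"
    and \<Gamma>: "diagonal_mat \<Gamma>" "\<Gamma> \<in> pd_mats s"
    and Xs: "Xs = diag_block_mat [0\<^sub>m s s, 0\<^sub>m (n - r - s) (n - r - s), \<Lambda>]"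
    and Zs: "Zs = diag_block_mat [\<Gamma>, 0\<^sub>m (n - r - s) (n - r - s), 0\<^sub>m r r]"
    and Xs_opt: "primal_optimal n (A, b, C) Xs"
    and Zs_opt: "dual_slack_optimal n (A, b, C) Zs"
begin

definition "dx = (\<lambda>i. Xs $$ (i, i))"
definition "dz = (\<lambda>i. Zs $$ (i, i))"

lemma data: "length A = m" "set A \<subseteq> sym_mats n" "b \<in> carrier_vec m" "C \<in> sym_mats n"
  using sdp by (auto simp: is_sdp_def)

lemma A_sym: "i < m \<Longrightarrow> A ! i \<in> sym_mats n"
  using data nth_mem[of i A] by auto

lemma lincomb_inner:
  "X \<in> sym_mats n \<Longrightarrow> mat_inner (mat_lincomb n A y) X = (\<Sum>i<m. y $ i * mat_inner (A ! i) X)"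
  using mat_inner_lincomb[OF data(2)] data(1) by simp

lemma \<Lambda>_carrier: "\<Lambda> \<in> carrier_mat r r" and \<Gamma>_carrier: "\<Gamma> \<in> carrier_mat s s"
  using \<Lambda> \<Gamma> by (auto simp: pd_mats_def sym_mats_def)

lemma Xs_carrier: "Xs \<in> carrier_mat n n" and Zs_carrier: "Zs \<in> carrier_mat n n"
  using rs \<Lambda>_carrier \<Gamma>_carrier unfolding Xs Zs by (auto simp: Let_def)

lemma Xs_entry: "i < n \<Longrightarrow> j < n \<Longrightarrow> Xs $$ (i, j) = (if i = j \<and> n - r \<le> i then \<Lambda> $$ (i - (n - r), i - (n - r)) else 0)"
  using rs \<Lambda>_carrier \<Lambda>(1) unfolding Xs diagonal_mat_def by (auto simp: Let_def)

lemma Zs_entry: "i < n \<Longrightarrow> j < n \<Longrightarrow> Zs $$ (i, j) = (if i = j \<and> i < s then \<Gamma> $$ (i, i) else 0)"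
  using rs \<Gamma>_carrier \<Gamma>(1) unfolding Zs diagonal_mat_def by (auto simp: Let_def)

lemma fm_Xs: "fm n Xs = diagf {n - r..<n} dx"
  by (auto simp: fm_def diagf_def dx_def Xs_entry)

lemma fm_Zs: "fm n Zs = diagf {..<s} dz"
  using rs by (auto simp: fm_def diagf_def dz_def Zs_entry)

lemma dx_pos: "i \<in> {n - r..<n} \<Longrightarrow> 0 < dx i"
  using pd_diag_pos[OF \<Lambda>(2), of "i - (n - r)"] rs by (auto simp: dx_def Xs_entry)

lemma dz_pos: "i \<in> {..<s} \<Longrightarrow> 0 < dz i"
  using pd_diag_pos[OF \<Gamma>(2), of i] rs by (auto simp: dz_def Zs_entry)

lemma Xs_sym: "Xs \<in> sym_mats n" and Zs_sym: "Zs \<in> sym_mats n"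
  by (simp_all add: sym_mats_iff Xs_carrier Zs_carrier fm_Xs fm_Zs symf_diagf)

lemma Rx: "{n - r..<n} \<subseteq> {..<n}" and Jz: "{..<s} \<subseteq> {..<n}"
  using rs by auto

lemma inner_Xs:
  assumes Z: "Z \<in> sym_mats n"
  shows "mat_inner Z Xs = (\<Sum>i\<in>{n - r..<n}. Z $$ (i, i) * dx i)"
proof -
  have "mat_inner Z Xs = (\<Sum>i\<in>{n - r..<n}. fm n Z (i, i) * dx i)"
    unfolding mat_inner_ip[OF sym_mats_carrier[OF Z] Xs_sym] fm_Xs by (rule ip_diagf[OF finite_lessThan Rx])
  then show ?thesis by (simp add: fm_def)
qed

lemma inner_commute:
  assumes "X \<in> sym_mats n" "Y \<in> sym_mats n"
  shows "mat_inner X Y = mat_inner Y X"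
  using mat_inner_ip[OF sym_mats_carrier[OF assms(1)] assms(2)] mat_inner_ip[OF sym_mats_carrier[OF assms(2)] assms(1)]
    ip_commute[of "{..<n} \<times> {..<n}" "fm n X" "fm n Y"] by simp

lemma inner_Zs:
  assumes X: "X \<in> sym_mats n"
  shows "mat_inner Zs X = (\<Sum>i<s. X $$ (i, i) * dz i)"
proof -
  have "mat_inner X Zs = (\<Sum>i<s. fm n X (i, i) * dz i)"
    unfolding mat_inner_ip[OF sym_mats_carrier[OF X] Zs_sym] fm_Zs by (rule ip_diagf[OF finite_lessThan Jz])
  then show ?thesis using rs inner_commute[OF X Zs_sym] by (simp add: fm_def)
qed

lemma psd_sym: "X \<in> psd_cone n \<Longrightarrow> X \<in> sym_mats n"
  by (simp add: psd_cone_iff)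

lemma inner_Zs_nonneg: "X \<in> psd_cone n \<Longrightarrow> 0 \<le> mat_inner Zs X"
  unfolding inner_Zs[OF psd_sym] using psd_diag dz_pos rs by (auto intro!: sum_nonneg mult_nonneg_nonneg simp: less_imp_le)

lemma inner_Xs_nonneg: "Z \<in> psd_cone n \<Longrightarrow> 0 \<le> mat_inner Z Xs"
  unfolding inner_Xs[OF psd_sym] using psd_diag dx_pos by (auto intro!: sum_nonneg mult_nonneg_nonneg simp: less_imp_le)

lemma inner_Zs_Xs: "mat_inner Zs Xs = 0"
  unfolding inner_Zs[OF Xs_sym] using rs by (auto simp: Xs_entry intro!: sum.neutral)

lemma inner_minus:
  assumes "M \<in> carrier_mat n n" "N \<in> carrier_mat n n" "X \<in> sym_mats n"
  shows "mat_inner (M - N) X = mat_inner M X - mat_inner N X"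
proof -
  have "M - N \<in> carrier_mat n n" using assms(2) by (rule minus_carrier_mat)
  from mat_inner_ip[OF this assms(3)] show ?thesis
    unfolding mat_inner_ip[OF assms(1,3)] mat_inner_ip[OF assms(2,3)] fm_minus[OF assms(1,2)] ip_diff_left .
qed

lemma Xs_feasible: "Xs \<in> psd_cone n" "\<And>i. i < m \<Longrightarrow> mat_inner (A ! i) Xs = b $ i"
  using Xs_opt data(1) by (auto simp: primal_optimal_def primal_feasible_def)

lemma scalar_b: "y \<in> carrier_vec m \<Longrightarrow> b \<bullet> y = mat_inner (mat_lincomb n A y) Xs"
  unfolding lincomb_inner[OF Xs_sym] scalar_prod_sum using Xs_feasible(2) by (simp add: scalar_prod_sum)

lemma slack_inner: "y \<in> carrier_vec m \<Longrightarrow> mat_inner (C - mat_lincomb n A y) Xs = mat_inner C Xs - b \<bullet> y"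
  by (simp add: inner_minus sym_mats_carrier[OF data(4)] Xs_sym scalar_b)

lemma Zs_slack: obtains y where "y \<in> carrier_vec m" "Zs = C - mat_lincomb n A y" "Zs \<in> psd_cone n"
proof -
  obtain y where y: "dual_optimal n (A, b, C) y" "Zs = C - mat_lincomb n A y"
    using Zs_opt by (auto simp: dual_slack_optimal_def)
  then show ?thesis
    using that[of y] data(1) by (auto simp: dual_optimal_def dual_feasible_def loewner_le_def)
qed

text \<open>On the solutions of the equations \<open>C\<close> and \<open>Zs\<close> differ by the
  constant \<open>b \<bullet> y\<close>, and evaluating at \<open>Xs\<close>, where
  \<open>Zs\<close> vanishes, identifies it. In particular there is no duality gap.\<close>

lemma objective:
  assumes "X \<in> sym_mats n" "\<And>i. i < m \<Longrightarrow> mat_inner (A ! i) X = b $ i"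
  shows "mat_inner C X = mat_inner Zs X + mat_inner C Xs"
proof -
  obtain y where y: "y \<in> carrier_vec m" "Zs = C - mat_lincomb n A y" using Zs_slack by blast
  have "mat_inner Zs X = mat_inner C X - mat_inner (mat_lincomb n A y) X"
    unfolding y(2) by (rule inner_minus[OF sym_mats_carrier[OF data(4)] lincomb_carrier assms(1)])
  moreover have "mat_inner (mat_lincomb n A y) X = b \<bullet> y"
    unfolding lincomb_inner[OF assms(1)] scalar_prod_sum[OF y(1)] using assms(2) by simp
  moreover have "mat_inner C Xs = b \<bullet> y"
    using slack_inner[OF y(1)] inner_Zs_Xs y(2) by simp
  ultimately show ?thesis by simp
qed

text \<open>By \<open>objective\<close>, minimizing \<open>C\<close> is minimizing the nonnegative
  pairing with \<open>Zs\<close>, and \<open>Xs\<close> attains zero.\<close>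

lemma primal_optimal_iff:
  "primal_optimal n (A, b, C) X \<longleftrightarrow>
    X \<in> psd_cone n \<and> (\<forall>i<m. mat_inner (A ! i) X = b $ i) \<and> mat_inner Zs X = 0"
proof -
  have obj: "mat_inner C X = mat_inner Zs X + mat_inner C Xs" if "primal_feasible n (A, b, C) X" for X
    using that data(1) by (intro objective psd_sym) (auto simp: primal_feasible_def)
  have nn: "0 \<le> mat_inner Zs X" if "primal_feasible n (A, b, C) X" for X
    using that by (intro inner_Zs_nonneg) (simp add: primal_feasible_def)
  have "primal_feasible n (A, b, C) Xs" using Xs_opt by (simp add: primal_optimal_def)
  then have "primal_optimal n (A, b, C) X \<longleftrightarrow> primal_feasible n (A, b, C) X \<and> mat_inner Zs X = 0"
    unfolding primal_optimal_def using obj nn inner_Zs_Xs by (smt (verit) split_conv)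
  then show ?thesis using data(1) by (simp add: primal_feasible_def)
qed

text \<open>By \<open>slack_inner\<close>, maximizing \<open>b \<bullet> y\<close> is minimizing the
  nonnegative pairing of the slack with \<open>Xs\<close>, and \<open>Zs\<close> attains
  zero.\<close>

lemma dual_optimal_iff:
  "dual_slack_optimal n (A, b, C) Z \<longleftrightarrow>
    Z \<in> psd_cone n \<and> (\<exists>y\<in>carrier_vec m. Z = C - mat_lincomb n A y) \<and> mat_inner Z Xs = 0"
proof
  assume "dual_slack_optimal n (A, b, C) Z"
  then obtain y where y: "dual_optimal n (A, b, C) y" "Z = C - mat_lincomb n A y"
    by (auto simp: dual_slack_optimal_def)
  then have yc: "y \<in> carrier_vec m" and psd: "Z \<in> psd_cone n"
    using data(1) by (auto simp: dual_optimal_def dual_feasible_def loewner_le_def)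
  obtain y' where y': "y' \<in> carrier_vec m" "Zs = C - mat_lincomb n A y'" "Zs \<in> psd_cone n" by (rule Zs_slack)
  have "b \<bullet> y' \<le> b \<bullet> y"
    using y(1) y' data(1) by (auto simp: dual_optimal_def dual_feasible_def loewner_le_def)
  then have "mat_inner Z Xs \<le> mat_inner Zs Xs"
    using slack_inner[OF yc] slack_inner[OF y'(1)] y(2) y'(2) by simp
  then show "Z \<in> psd_cone n \<and> (\<exists>y\<in>carrier_vec m. Z = C - mat_lincomb n A y) \<and> mat_inner Z Xs = 0"
    using psd yc y(2) inner_Xs_nonneg[OF psd] inner_Zs_Xs by auto
next
  assume Z: "Z \<in> psd_cone n \<and> (\<exists>y\<in>carrier_vec m. Z = C - mat_lincomb n A y) \<and> mat_inner Z Xs = 0"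
  then obtain y where y: "y \<in> carrier_vec m" "Z = C - mat_lincomb n A y" by blast
  have "dual_optimal n (A, b, C) y"
    unfolding dual_optimal_def prod.case
  proof (intro conjI allI impI)
    show "dual_feasible n (A, b, C) y"
      using y Z data(1) by (simp add: dual_feasible_def loewner_le_def)
    fix y' assume "dual_feasible n (A, b, C) y'"
    then have y': "y' \<in> carrier_vec m" "C - mat_lincomb n A y' \<in> psd_cone n"
      using data(1) by (auto simp: dual_feasible_def loewner_le_def)
    show "b \<bullet> y' \<le> b \<bullet> y"
      using slack_inner[OF y(1)] slack_inner[OF y'(1)] inner_Xs_nonneg[OF y'(2)] Z y(2) by simp
  qed
  then show "dual_slack_optimal n (A, b, C) Z" using y(2) by (auto simp: dual_slack_optimal_def)
qed

section \<open>Optimal solutions lie in the faces of the maximum rank ones\<close>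

lemma inner_midpoint:
  assumes "X \<in> sym_mats n" "Y \<in> sym_mats n" "M \<in> sym_mats n"
  shows "mat_inner M ((1/2) \<cdot>\<^sub>m (X + Y)) = (mat_inner M X + mat_inner M Y) / 2"
    and "mat_inner ((1/2) \<cdot>\<^sub>m (X + Y)) M = (mat_inner X M + mat_inner Y M) / 2"
    and "(1/2) \<cdot>\<^sub>m (X + Y) \<in> sym_mats n"
proof -
  note c = assms[THEN sym_mats_carrier]
  have fmid: "fm n ((1/2) \<cdot>\<^sub>m (X + Y)) = (\<lambda>q. 1/2 * (fm n X q + 1 * fm n Y q))"
    using c by (simp add: fm_smult fm_add)
  show sym: "(1/2) \<cdot>\<^sub>m (X + Y) \<in> sym_mats n"
    using assms unfolding sym_mats_iff fmid by (auto simp: symf_def)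
  show "mat_inner ((1/2) \<cdot>\<^sub>m (X + Y)) M = (mat_inner X M + mat_inner Y M) / 2"
    using mat_inner_ip[OF sym_mats_carrier[OF sym] assms(3)] mat_inner_ip[OF c(1) assms(3)]
      mat_inner_ip[OF c(2) assms(3)] unfolding fmid ip_scale_left ip_add_left by simp
  then show "mat_inner M ((1/2) \<cdot>\<^sub>m (X + Y)) = (mat_inner M X + mat_inner M Y) / 2"
    using inner_commute assms sym by metis
qed

lemma psd_midpoint:
  assumes "X \<in> psd_cone n" "Y \<in> psd_cone n"
  shows "(1/2) \<cdot>\<^sub>m (X + Y) \<in> psd_cone n"
proof -
  have sym: "X \<in> sym_mats n" "Y \<in> sym_mats n" using assms by (auto intro: psd_sym)
  have fmid: "fm n ((1/2) \<cdot>\<^sub>m (X + Y)) = (\<lambda>q. 1/2 * (fm n X q + 1 * fm n Y q))"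
    using sym by (simp add: fm_smult fm_add sym_mats_carrier)
  have "0 \<le> bf {..<n} (fm n ((1/2) \<cdot>\<^sub>m (X + Y))) x x" for x
    using assms unfolding fmid bf_eq_ip ip_scale_left ip_add_left by (simp add: psd_cone_iff bf_eq_ip)
  then show ?thesis using inner_midpoint(3)[OF sym sym(1)] by (simp add: psd_cone_iff)
qed

lemma primal_support:
  assumes "max_rank n (primal_optimal n (A, b, C)) Xs" "primal_optimal n (A, b, C) X"
  shows "fm n X \<in> vecs_on ({n - r..<n} \<times> {n - r..<n})"
proof (rule max_rank_support[OF Xs_carrier fm_Xs Rx dx_pos assms(1)])
  note X = assms(2)[unfolded primal_optimal_iff]
  then show psd: "X \<in> psd_cone n" by blast
  show "primal_optimal n (A, b, C) ((1/2) \<cdot>\<^sub>m (X + Xs))"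
    unfolding primal_optimal_iff
  proof (intro conjI allI impI)
    note mid = inner_midpoint(1)[OF psd_sym[OF psd] Xs_sym]
    show "(1/2) \<cdot>\<^sub>m (X + Xs) \<in> psd_cone n" by (rule psd_midpoint[OF psd Xs_feasible(1)])
    show "mat_inner (A ! i) ((1/2) \<cdot>\<^sub>m (X + Xs)) = b $ i" if "i < m" for i
      using X that unfolding mid[OF A_sym[OF that]] by (simp add: Xs_feasible(2))
    show "mat_inner Zs ((1/2) \<cdot>\<^sub>m (X + Xs)) = 0"
      using X unfolding mid[OF Zs_sym] by (simp add: inner_Zs_Xs)
  qed
qed

definition "span_A = {fm n (mat_lincomb n A y) | y. y \<in> carrier_vec m}"

lemma span_A_I: "y \<in> carrier_vec m \<Longrightarrow> fm n (mat_lincomb n A y) \<in> span_A"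
  by (auto simp: span_A_def)

lemma lin_sub_span_A: "lin_sub ({..<n} \<times> {..<n}) span_A"
  unfolding lin_sub_def
proof (intro conjI ballI allI)
  show "span_A \<subseteq> vecs_on ({..<n} \<times> {..<n})"
  proof
    fix u assume "u \<in> span_A"
    then obtain y where "u = fm n (mat_lincomb n A y)" unfolding span_A_def by blast
    then show "u \<in> vecs_on ({..<n} \<times> {..<n})" using fm_vecs_on by simp
  qed
  have "fm n (mat_lincomb n A (0\<^sub>v m)) = (\<lambda>_. 0)" unfolding fm_lincomb data(1) by simp
  then show "(\<lambda>_. 0) \<in> span_A" using span_A_I[OF zero_carrier_vec] by simp
  fix u v c assume "u \<in> span_A" "v \<in> span_A"
  then obtain y z where yz: "u = fm n (mat_lincomb n A y)" "v = fm n (mat_lincomb n A z)"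
    by (auto simp: span_A_def)
  have "(\<lambda>i. u i + c * v i) = fm n (mat_lincomb n A (vec m (\<lambda>i. y $ i + c * z $ i)))"
    unfolding yz fm_lincomb data(1) by (simp add: distrib_right sum.distrib sum_distrib_left mult.assoc)
  then show "(\<lambda>i. u i + c * v i) \<in> span_A" using span_A_I[OF vec_carrier] by simp
qed

lemma A_in_span: "i < m \<Longrightarrow> fm n (A ! i) \<in> span_A"
proof -
  assume i: "i < m"
  have "fm n (mat_lincomb n A (vec m (\<lambda>j. if j = i then 1 else 0))) p = fm n (A ! i) p" for p
  proof -
    have "fm n (mat_lincomb n A (vec m (\<lambda>j. if j = i then 1 else 0))) p = (\<Sum>j<m. if j = i then fm n (A ! j) p else 0)"
      unfolding fm_lincomb data(1) by (intro sum.cong) auto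
    then show ?thesis using i by simp
  qed
  then have "fm n (mat_lincomb n A (vec m (\<lambda>j. if j = i then 1 else 0))) = fm n (A ! i)" by blast
  then show ?thesis using span_A_I[OF vec_carrier, of "\<lambda>j. if j = i then 1 else 0"] by simp
qed

text \<open>Since \<open>Zs\<close> is itself a slack, the vector \<open>y\<close> can be replaced
  by membership of a difference in \<open>span_A\<close>. This gives the dual optimal set the shape
  of a primal one, for the orthogonal complement of \<open>span_A\<close>.\<close>

lemma dual_optimal_span:
  "dual_slack_optimal n (A, b, C) Z \<longleftrightarrow>
    Z \<in> psd_cone n \<and> (\<lambda>p. fm n Z p - fm n Zs p) \<in> span_A \<and> mat_inner Z Xs = 0"
proof -
  obtain y' where y': "y' \<in> carrier_vec m" "Zs = C - mat_lincomb n A y'" by (rule Zs_slack)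
  have Cc: "C \<in> carrier_mat n n" using data(4) by (rule sym_mats_carrier)
  have slack: "fm n (C - mat_lincomb n A y) p = fm n C p - (\<Sum>i<m. y $ i * fm n (A ! i) p)" for y p
    unfolding fm_minus[OF Cc lincomb_carrier] fm_lincomb data(1) ..
  have diff: "(\<Sum>i<m. vec m (\<lambda>i. u $ i - v $ i) $ i * fm n (A ! i) p)
      = (\<Sum>i<m. u $ i * fm n (A ! i) p) - (\<Sum>i<m. v $ i * fm n (A ! i) p)" for u v :: "real vec" and p
    by (simp add: left_diff_distrib sum_subtractf)
  have "(\<exists>y\<in>carrier_vec m. Z = C - mat_lincomb n A y) \<longleftrightarrow> (\<lambda>p. fm n Z p - fm n Zs p) \<in> span_A"
    if Z: "Z \<in> carrier_mat n n"
  proof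
    assume "\<exists>y\<in>carrier_vec m. Z = C - mat_lincomb n A y"
    then obtain y where y: "Z = C - mat_lincomb n A y" by blast
    have "(\<lambda>p. fm n Z p - fm n Zs p) = fm n (mat_lincomb n A (vec m (\<lambda>i. y' $ i - y $ i)))"
      unfolding y y'(2) slack fm_lincomb data(1) diff by auto
    then show "(\<lambda>p. fm n Z p - fm n Zs p) \<in> span_A" using span_A_I[OF vec_carrier] by simp
  next
    assume "(\<lambda>p. fm n Z p - fm n Zs p) \<in> span_A"
    then obtain y where y: "(\<lambda>p. fm n Z p - fm n Zs p) = fm n (mat_lincomb n A y)" by (auto simp: span_A_def)
    have "fm n Z p = fm n (C - mat_lincomb n A (vec m (\<lambda>i. y' $ i - y $ i))) p" for p
      using fun_cong[OF y, of p] unfolding slack diff y'(2) fm_lincomb data(1) by simp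
    then have "Z = C - mat_lincomb n A (vec m (\<lambda>i. y' $ i - y $ i))"
      using fm_inject[OF Z minus_carrier_mat[OF lincomb_carrier]] by blast
    then show "\<exists>y\<in>carrier_vec m. Z = C - mat_lincomb n A y" using vec_carrier by blast
  qed
  then show ?thesis unfolding dual_optimal_iff using psd_sym sym_mats_carrier by blast
qed

lemma dual_support:
  assumes "max_rank n (dual_slack_optimal n (A, b, C)) Zs" "dual_slack_optimal n (A, b, C) Z"
  shows "fm n Z \<in> vecs_on ({..<s} \<times> {..<s})"
proof (rule max_rank_support[OF Zs_carrier fm_Zs Jz dz_pos assms(1)])
  note Z = assms(2)[unfolded dual_optimal_span]
  then show psd: "Z \<in> psd_cone n" by blast
  have Zc: "Z \<in> carrier_mat n n" using psd_sym[OF psd] by (rule sym_mats_carrier)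
  have Zspsd: "Zs \<in> psd_cone n" using Zs_opt dual_optimal_iff by blast
  have "(\<lambda>p. fm n ((1/2) \<cdot>\<^sub>m (Z + Zs)) p - fm n Zs p) = (\<lambda>p. 1/2 * (fm n Z p - fm n Zs p))"
    unfolding fm_smult[OF add_carrier_mat[OF Zs_carrier]] fm_add[OF Zc Zs_carrier] by (auto simp: field_simps)
  moreover have "(\<lambda>p. 1/2 * (fm n Z p - fm n Zs p)) \<in> span_A"
    using Z by (intro lin_sub_scale[OF lin_sub_span_A]) blast
  ultimately show "dual_slack_optimal n (A, b, C) ((1/2) \<cdot>\<^sub>m (Z + Zs))"
    unfolding dual_optimal_span inner_midpoint(2)[OF psd_sym[OF psd] Zs_sym Xs_sym]
    using Z psd_midpoint[OF psd Zspsd] inner_Zs_Xs by simp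
qed

section \<open>The two facial reduction sequences\<close>

lemma matrix_of_psd:
  assumes "X \<in> vecs_on ({..<n} \<times> {..<n})" "symf X" "\<And>x. 0 \<le> bf {..<n} X x x"
  shows "mat n n X \<in> psd_cone n"
  using assms by (simp add: psd_cone_iff sym_mats_iff fm_mat)

text \<open>The instance \<open>U = span_A\<close> of \<open>reducing_sequence\<close>. The
  right-hand sides vanish because \<open>b \<bullet> y\<close> is the pairing of the combination
  with the feasible matrix \<open>Xs\<close>.\<close>

lemma primal_sequence:
  assumes mr: "max_rank n (primal_optimal n (A, b, C)) Xs"
  obtains k a where "\<And>i. i < k \<Longrightarrow> a i \<in> sym_mats n"
    "\<And>i. i < k \<Longrightarrow> \<exists>y\<in>carrier_vec m. a i = mat_lincomb n A y \<and> b \<bullet> y = 0"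
    "frs {..<n} (vecs_on ({..<n} - {..<s})) (\<lambda>i. fm n (a i)) k"
    "zset {..<n} (vecs_on ({..<n} - {..<s})) (\<lambda>i. fm n (a i)) k = vecs_on {n - r..<n}"
    "\<And>i. i < k \<Longrightarrow> \<exists>x\<in>zset {..<n} (vecs_on ({..<n} - {..<s})) (\<lambda>i. fm n (a i)) i. bf {..<n} (fm n (a i)) x x \<noteq> 0"
proof -
  let ?I = "{..<n}" and ?E = "vecs_on ({..<n} - {..<s})" and ?R = "{n - r..<n}"
  have disj: "?R \<inter> {..<s} = {}" using rs by auto
  have "\<exists>k as. (\<forall>i<k. as i \<in> span_A \<and> ip (?I \<times> ?I) (as i) (diagf ?R dx) = 0) \<and>
      frs ?I ?E as k \<and> zset ?I ?E as k = vecs_on ?R \<and>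
      (\<forall>i<k. \<exists>x\<in>zset ?I ?E as i. bf ?I (as i) x x \<noteq> 0)"
  proof (rule reducing_sequence[OF finite_lessThan lin_sub_span_A _ Rx Jz disj dx_pos, where dz = dz])
    show "symf u" if "u \<in> span_A" for u
      using that lincomb_sym[OF data(2)] by (auto simp: span_A_def sym_mats_iff)
    fix X assume X: "X \<in> vecs_on (?I \<times> ?I)" "symf X" "\<And>x. 0 \<le> bf ?I X x x"
      "\<And>u. u \<in> span_A \<Longrightarrow> ip (?I \<times> ?I) u X = ip (?I \<times> ?I) u (diagf ?R dx)"
      "ip (?I \<times> ?I) X (diagf {..<s} dz) = 0"
    have psd: "mat n n X \<in> psd_cone n" by (rule matrix_of_psd[OF X(1-3)])
    note sym = psd_sym[OF psd]
    have "mat_inner (A ! i) (mat n n X) = b $ i" if "i < m" for i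
      using X(4)[OF A_in_span[OF that]] Xs_feasible(2)[OF that]
      by (simp add: mat_inner_ip[OF sym_mats_carrier[OF A_sym[OF that]]] sym Xs_sym fm_mat[OF X(1)] fm_Xs)
    moreover have "mat_inner Zs (mat n n X) = 0"
      using X(5) by (simp add: mat_inner_ip[OF Zs_carrier sym] fm_mat[OF X(1)] fm_Zs ip_commute)
    ultimately have "primal_optimal n (A, b, C) (mat n n X)" using psd primal_optimal_iff by blast
    from primal_support[OF mr this] show "X \<in> vecs_on (?R \<times> ?R)" by (simp add: fm_mat[OF X(1)])
  next
    show "lin_sub ?I ?E" by (rule lin_sub_vecs) blast
    show "vecs_on ?R \<subseteq> ?E" using disj unfolding vecs_on_def by fastforce
  qed (assumption | rule subset_refl)+
  then obtain k as where as: "\<And>i. i < k \<Longrightarrow> as i \<in> span_A" "\<And>i. i < k \<Longrightarrow> ip (?I \<times> ?I) (as i) (diagf ?R dx) = 0"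
    "frs ?I ?E as k" "zset ?I ?E as k = vecs_on ?R"
    "\<And>i. i < k \<Longrightarrow> \<exists>x\<in>zset ?I ?E as i. bf ?I (as i) x x \<noteq> 0"
    by blast
  define a where "a = (\<lambda>i. mat n n (as i))"
  have fa: "fm n (a i) = as i" if "i < k" for i
    unfolding a_def using as(1)[OF that] lin_sub_vecs_on[OF lin_sub_span_A] by (intro fm_mat) blast
  have comb: "\<exists>y\<in>carrier_vec m. a i = mat_lincomb n A y \<and> b \<bullet> y = 0" if ik: "i < k" for i
  proof -
    obtain y where y: "y \<in> carrier_vec m" "as i = fm n (mat_lincomb n A y)" using as(1)[OF ik] by (auto simp: span_A_def)
    have "a i = mat_lincomb n A y" by (rule fm_inject[of _ n]) (use fa[OF ik] y in \<open>auto simp: a_def\<close>)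
    moreover have "b \<bullet> y = 0"
      unfolding scalar_b[OF y(1)] mat_inner_ip[OF lincomb_carrier Xs_sym] using as(2)[OF ik] y(2) by (simp add: fm_Xs)
    ultimately show ?thesis using y(1) by blast
  qed
  have "zset ?I ?E (\<lambda>i. fm n (a i)) i = zset ?I ?E as i" if "i \<le> k" for i
    by (rule zset_cong) (use fa that in simp)
  moreover have "frs ?I ?E (\<lambda>i. fm n (a i)) k = frs ?I ?E as k" by (rule frs_cong) (rule fa)
  moreover have "a i \<in> sym_mats n" if "i < k" for i using comb[OF that] lincomb_sym[OF data(2)] by auto
  ultimately show ?thesis using as(3-5) fa comb by (intro that[of k a]) auto
qed

text \<open>The instance where \<open>U\<close> consists of the symmetric matrices orthogonal to all
  equations, with the blocks of \<open>Xs\<close> and \<open>Zs\<close> interchanged.\<close>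

lemma dual_sequence:
  assumes mr: "max_rank n (dual_slack_optimal n (A, b, C)) Zs"
  obtains l Y where "\<And>j. j < l \<Longrightarrow> Y j \<in> sym_mats n"
    "\<And>j i. j < l \<Longrightarrow> i < m \<Longrightarrow> mat_inner (A ! i) (Y j) = 0" "\<And>j. j < l \<Longrightarrow> mat_inner C (Y j) = 0"
    "frs {..<n} (vecs_on ({..<n} - {n - r..<n})) (\<lambda>j. fm n (Y j)) l"
    "zset {..<n} (vecs_on ({..<n} - {n - r..<n})) (\<lambda>j. fm n (Y j)) l = vecs_on {..<s}"
proof -
  let ?I = "{..<n}" and ?E = "vecs_on ({..<n} - {n - r..<n})" and ?R = "{n - r..<n}"
  have disj: "{..<s} \<inter> ?R = {}" using rs by auto
  define V where "V = {u \<in> vecs_on (?I \<times> ?I). symf u}"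
  define W where "W = {u \<in> V. \<forall>i<m. ip (?I \<times> ?I) u (fm n (A ! i)) = 0}"
  have V: "lin_sub (?I \<times> ?I) V" unfolding V_def lin_sub_def by (auto simp: vecs_on_def symf_def)
  have W: "lin_sub (?I \<times> ?I) W"
    unfolding lin_sub_def
  proof (intro conjI ballI allI)
    show "W \<subseteq> vecs_on (?I \<times> ?I)" by (auto simp: W_def V_def)
    show "(\<lambda>_. 0) \<in> W" using lin_sub_zero[OF V] by (simp add: W_def)
    fix u v c assume "u \<in> W" "v \<in> W"
    then show "(\<lambda>i. u i + c * v i) \<in> W" using lin_sub_add[OF V, of u v c] unfolding W_def by (simp add: ip_add_left)
  qed
  have "\<exists>l ys. (\<forall>j<l. ys j \<in> W \<and> ip (?I \<times> ?I) (ys j) (diagf {..<s} dz) = 0) \<and>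
      frs ?I ?E ys l \<and> zset ?I ?E ys l = vecs_on {..<s} \<and>
      (\<forall>j<l. \<exists>x\<in>zset ?I ?E ys j. bf ?I (ys j) x x \<noteq> 0)"
  proof (rule reducing_sequence[OF finite_lessThan W _ Jz Rx disj dz_pos, where dz = dx])
    show "symf u" if "u \<in> W" for u using that by (simp add: W_def V_def)
    fix X assume X: "X \<in> vecs_on (?I \<times> ?I)" "symf X" "\<And>x. 0 \<le> bf ?I X x x"
      "\<And>u. u \<in> W \<Longrightarrow> ip (?I \<times> ?I) u X = ip (?I \<times> ?I) u (diagf {..<s} dz)"
      "ip (?I \<times> ?I) X (diagf ?R dx) = 0"
    have psd: "mat n n X \<in> psd_cone n" by (rule matrix_of_psd[OF X(1-3)])
    note sym = psd_sym[OF psd]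
    define D where "D = (\<lambda>p. X p - fm n Zs p)"
    \<comment> \<open>Agreeing with \<open>Zs\<close> on the complement \<open>W\<close> means lying
      in \<open>Zs\<close> plus the double complement, which is \<open>span_A\<close> again; so
      \<open>X\<close> is a dual slack.\<close>
    have "D \<in> span_A"
    proof (rule double_perp[OF _ lin_sub_span_A V])
      show "span_A \<subseteq> V"
      proof
        fix u assume "u \<in> span_A"
        then obtain y where "u = fm n (mat_lincomb n A y)" unfolding span_A_def by blast
        then show "u \<in> V" using fm_vecs_on lincomb_sym[OF data(2)] by (simp add: V_def sym_mats_iff)
      qed
      have "X \<in> V" "fm n Zs \<in> V" using X Zs_sym fm_vecs_on by (auto simp: V_def sym_mats_iff)
      then show "D \<in> V" unfolding D_def by (rule lin_sub_diff[OF V])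
      fix y assume y: "y \<in> V" "\<And>z. z \<in> span_A \<Longrightarrow> ip (?I \<times> ?I) z y = 0"
      have "ip (?I \<times> ?I) y (fm n (A ! i)) = 0" if "i < m" for i
        using y(2)[OF A_in_span[OF that]] ip_commute[of "?I \<times> ?I" y "fm n (A ! i)"] by simp
      then have "y \<in> W" using y(1) by (simp add: W_def)
      from X(4)[OF this] have "ip (?I \<times> ?I) X y = ip (?I \<times> ?I) (fm n Zs) y"
        unfolding fm_Zs ip_commute[of "?I \<times> ?I" y] .
      then show "ip (?I \<times> ?I) y D = 0" unfolding D_def ip_commute[of _ y] ip_diff_left by simp
    qed simp
    moreover have "mat_inner (mat n n X) Xs = 0"
      using X(5) by (simp add: mat_inner_ip[OF _ Xs_sym] fm_mat[OF X(1)] fm_Xs)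
    ultimately have "dual_slack_optimal n (A, b, C) (mat n n X)"
      unfolding dual_optimal_span fm_mat[OF X(1)] D_def using psd by blast
    from dual_support[OF mr this] show "X \<in> vecs_on ({..<s} \<times> {..<s})" by (simp add: fm_mat[OF X(1)])
  next
    show "lin_sub ?I ?E" by (rule lin_sub_vecs) blast
    have "{..<s} \<subseteq> ?I - ?R" using rs by auto
    then show "vecs_on {..<s} \<subseteq> ?E" unfolding vecs_on_def by blast
  qed (assumption | rule subset_refl)+
  then obtain l ys where ys: "\<And>j. j < l \<Longrightarrow> ys j \<in> W" "\<And>j. j < l \<Longrightarrow> ip (?I \<times> ?I) (ys j) (diagf {..<s} dz) = 0"
    "frs ?I ?E ys l" "zset ?I ?E ys l = vecs_on {..<s}"
    by blast
  define Y where "Y = (\<lambda>j. mat n n (ys j))"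
  have fY: "fm n (Y j) = ys j" if "j < l" for j
    unfolding Y_def using lin_sub_vecs_on[OF W ys(1)[OF that]] by (rule fm_mat)
  have Ysym: "Y j \<in> sym_mats n" if "j < l" for j
    using fY[OF that] ys(1)[OF that] by (simp add: sym_mats_iff W_def V_def Y_def)
  have YA: "mat_inner (A ! i) (Y j) = 0" if "j < l" "i < m" for i j
  proof -
    have "ip (?I \<times> ?I) (ys j) (fm n (A ! i)) = 0" using ys(1)[OF that(1)] that(2) by (simp add: W_def)
    then show ?thesis
      unfolding mat_inner_ip[OF sym_mats_carrier[OF A_sym[OF that(2)]] Ysym[OF that(1)]] fY[OF that(1)]
        ip_commute[of "?I \<times> ?I" "ys j"] .
  qed
  \<comment> \<open>\<open>C\<close> and \<open>Zs\<close> differ by a combination of the equations,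
    to which \<open>Y j\<close> is orthogonal.\<close>
  have YC: "mat_inner C (Y j) = 0" if j: "j < l" for j
  proof -
    obtain y' where y': "y' \<in> carrier_vec m" "Zs = C - mat_lincomb n A y'" by (rule Zs_slack)
    have "mat_inner Zs (Y j) = 0"
      using ys(2)[OF j]
      unfolding mat_inner_ip[OF Zs_carrier Ysym[OF j]] fm_Zs fY[OF j] ip_commute[of "?I \<times> ?I" "ys j"] .
    moreover have "mat_inner Zs (Y j) = mat_inner C (Y j) - mat_inner (mat_lincomb n A y') (Y j)"
      unfolding y'(2) by (rule inner_minus[OF sym_mats_carrier[OF data(4)] lincomb_carrier Ysym[OF j]])
    ultimately show ?thesis using YA[OF j] by (simp add: lincomb_inner[OF Ysym[OF j]])
  qed
  have "zset ?I ?E (\<lambda>j. fm n (Y j)) l = zset ?I ?E ys l" by (rule zset_cong) (rule fY)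
  moreover have "frs ?I ?E (\<lambda>j. fm n (Y j)) l = frs ?I ?E ys l" by (rule frs_cong) (rule fY)
  ultimately show ?thesis using ys Ysym YA YC by (intro that[of l Y]) auto
qed


section \<open>From a reformulation to maximum rank\<close>

lemma rank_le_block:
  assumes "fm n X \<in> vecs_on (R \<times> R)" "X \<in> carrier_mat n n" "R \<subseteq> {..<n}"
  shows "vec_space.rank n X \<le> card R"
proof (rule rank_le_support[OF assms(2,3)])
  fix i j assume "i < n" "j < n" "X $$ (i, j) \<noteq> 0"
  then have "fm n X (i, j) \<noteq> 0" by (simp add: fm_def)
  then show "j \<in> R" using assms(1) by (auto simp: vecs_on_def)
qed

lemma rank_ge_diag:
  assumes "X \<in> carrier_mat n n" "fm n X = diagf R d" "R \<subseteq> {..<n}" "\<And>i. i \<in> R \<Longrightarrow> 0 < d i"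
  shows "card R \<le> vec_space.rank n X"
proof (rule rank_ge_pd_block[OF assms(1,3)])
  fix x assume x: "x \<in> vecs_on R" "x \<noteq> (\<lambda>_. 0)"
  then obtain i where i: "x i \<noteq> 0" "i \<in> R" by (auto simp: vecs_on_def fun_eq_iff)
  have "finite R" using assms(3) finite_subset by blast
  have "0 < d i * (x i)\<^sup>2" using assms(4) i by simp
  also have "\<dots> \<le> (\<Sum>i\<in>R. d i * (x i)\<^sup>2)"
    using i \<open>finite R\<close> assms(4) by (intro member_le_sum) (auto simp: less_imp_le)
  finally show "0 < bf {..<n} (fm n X) x x" unfolding assms(2) bf_diagf[OF finite_lessThan assms(3)] .
qed

lemma congruence_unit_diag:
  assumes "X \<in> carrier_mat n n" "S \<in> carrier_mat n n" "unit_cols n K S" "c \<in> K" "K \<subseteq> {..<n}"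
  shows "(congruence S X) $$ (c, c) = X $$ (c, c)"
proof -
  have c: "c < n" using assms by blast
  have S: "mrow n S \<alpha> c = (if \<alpha> = c then 1 else 0)" if "\<alpha> < n" for \<alpha>
    using assms(3,4) c that by (simp add: mrow_def unit_cols_def)
  have "(congruence S X) $$ (c, c) = fm n (congruence S X) (c, c)" using c by (simp add: fm_def)
  also have "\<dots> = bf {..<n} (fm n X) (\<lambda>\<alpha>. mrow n S \<alpha> c) (\<lambda>\<alpha>. mrow n S \<alpha> c)"
    unfolding fm_congruence[OF assms(1,2)] by (simp add: basis_form_def bf_def)
  also have "\<dots> = bf {..<n} (fm n X) (\<lambda>\<alpha>. if \<alpha> = c then 1 else 0) (\<lambda>\<alpha>. if \<alpha> = c then 1 else 0)"
    unfolding bf_def using S by (intro sum.cong refl) simp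
  also have "\<dots> = X $$ (c, c)" using c by (simp add: bf_delta fm_def)
  finally show ?thesis .
qed

text \<open>In S X S^T only columns of \<open>S\<close> indexed by \<open>R\<close> occur, and these
  are unit vectors; the support cannot spread.\<close>

lemma supported_congruence:
  assumes "X \<in> carrier_mat n n" "S \<in> carrier_mat n n" "unit_cols n K S" "R \<subseteq> K" "K \<subseteq> {..<n}"
    and supp: "fm n X \<in> vecs_on (R \<times> R)"
  shows "fm n (S * X * S\<^sup>T) \<in> vecs_on (R \<times> R)"
proof -
  have St: "S\<^sup>T \<in> carrier_mat n n" using assms(2) by simp
  have fmc: "fm n (S * X * S\<^sup>T) = basis_form n (mrow n (S\<^sup>T)) (fm n X)"
    using fm_congruence[OF assms(1) St] by simp
  have "fm n (S * X * S\<^sup>T) (i, j) = 0" if ij: "i \<notin> R \<or> j \<notin> R" for i j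
  proof (cases "i < n \<and> j < n")
    case True
    have "fm n X (\<alpha>, \<beta>) * mrow n (S\<^sup>T) \<alpha> i * mrow n (S\<^sup>T) \<beta> j = 0"
      if "\<alpha> < n" "\<beta> < n" for \<alpha> \<beta>
    proof (cases "\<alpha> \<in> R \<and> \<beta> \<in> R")
      case True
      then have "\<alpha> \<in> K" "\<beta> \<in> K" using assms(4) by auto
      then have "mrow n (S\<^sup>T) \<alpha> i = (if i = \<alpha> then 1 else 0)"
        "mrow n (S\<^sup>T) \<beta> j = (if j = \<beta> then 1 else 0)"
        using \<open>i < n \<and> j < n\<close> that assms(2,3) by (auto simp: mrow_def unit_cols_def)
      then show ?thesis using True ij by auto
    next
      case False
      then have "fm n X (\<alpha>, \<beta>) = 0" using supp by (auto simp: vecs_on_def)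
      then show ?thesis by simp
    qed
    then show ?thesis unfolding fmc basis_form_def by (simp add: sum.neutral)
  next
    case False
    then show ?thesis by (auto simp: fm_def)
  qed
  then show ?thesis unfolding vecs_on_def by auto
qed

text \<open>An optimal solution is transported into the rotated coordinates, where the reducing
  sequence confines it to the face, and then pulled back. Both moves respect the face since the
  outer columns of \<open>S\<close> and \<open>S'\<close> are unit vectors; the rank is then at most
  the size of the block.\<close>

lemma max_rank_of_reformulation:
  assumes ref: "reformulation_using n (admissible_mats n s r) (A, b, C) (A', b', C')" and k: "k \<le> m" and b0: "\<forall>i<k. b' $ i = 0"
    and red: "reduces_to n (Zs # take k A') (lower_right_face n r)"
    and Ys: "set Ys \<subseteq> sym_mats n" "\<forall>j<length Ys. (\<forall>i<m. mat_inner (A' ! i) (Ys ! j) = 0) \<and> mat_inner C' (Ys ! j) = 0"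
    and redY: "reduces_to n (Xs # Ys) (upper_left_face n s)"
  shows "max_rank n (primal_optimal n (A, b, C)) Xs" "max_rank n (dual_slack_optimal n (A, b, C)) Zs"
proof -
  define K where "K = {..<n} - {s..<n - r}"
  have KI: "K \<subseteq> {..<n}" and RK: "{n - r..<n} \<subseteq> K" and JK: "{..<s} \<subseteq> K" using rs by (auto simp: K_def)
  have steps: "(reform_step n (admissible_mats n s r))\<^sup>*\<^sup>* (A, b, C) (A', b', C')"
    using ref by (simp add: reformulation_using_def)
  obtain S S' where tr: "sdp_transport n m K A b C A' b' C' S S'"
    using reformulation_transport[OF data(1-3) sym_mats_carrier[OF data(4)] rs steps, folded K_def] by blast
  interpret tr: sdp_transport n m K A b C A' b' C' S S' by (rule tr)
  note len = tr.len and S = tr.S and C' = tr.C'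
  have S'S: "S' * S\<^sup>T = 1\<^sub>m n"
    using transpose_mult[of S n n "S'\<^sup>T" n] S(1-3) by simp
  have rX: "card {n - r..<n} \<le> vec_space.rank n Xs" by (rule rank_ge_diag[OF Xs_carrier fm_Xs Rx dx_pos])
  have rZ: "card {..<s} \<le> vec_space.rank n Zs" by (rule rank_ge_diag[OF Zs_carrier fm_Zs Jz dz_pos])
  show "max_rank n (primal_optimal n (A, b, C)) Xs"
    unfolding max_rank_def
  proof (intro conjI allI impI)
    show "primal_optimal n (A, b, C) Xs" by (rule Xs_opt)
    fix X assume "primal_optimal n (A, b, C) X"
    then have X: "X \<in> psd_cone n" "\<And>i. i < m \<Longrightarrow> mat_inner (A ! i) X = b $ i" "mat_inner Zs X = 0"
      by (auto simp: primal_optimal_iff)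
    have Xs': "X \<in> sym_mats n" and Xc: "X \<in> carrier_mat n n" using psd_sym[OF X(1)] sym_mats_carrier by auto
    let ?X = "congruence S' X"
    have psd: "?X \<in> psd_cone n" by (rule psd_congruence[OF X(1) S(2)])
    \<comment> \<open>\<open>Zs\<close> sees only diagonal entries in the upper left block, and the
      rotation leaves these unchanged. So complementarity survives although \<open>Zs\<close> itself
      is not rotated.\<close>
    have "mat_inner Zs ?X = mat_inner Zs X"
      unfolding inner_Zs[OF psd_sym[OF psd]] inner_Zs[OF Xs']
      using congruence_unit_diag[OF Xc S(2) S(5) _ KI] JK by (intro sum.cong refl) auto
    then have Z0: "mat_inner Zs ?X = 0" using X(3) by simp
    have A0: "mat_inner M ?X = 0" if "M \<in> set (take k A')" for M
    proof -
      obtain i where "i < k" "M = A' ! i" using \<open>M \<in> set (take k A')\<close> k len by (auto simp: in_set_conv_nth)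
      then show ?thesis using tr.primal[OF Xs' _ less_le_trans[OF _ k]] X(2) b0 by simp
    qed
    have "?X \<in> psd_cone n \<inter> (\<Inter>Y\<in>set (Zs # take k A'). mat_perp n Y)"
      using psd psd_sym[OF psd] Z0 A0 by (auto simp: mat_perp_def)
    then have "?X \<in> lower_right_face n r" unfolding red[unfolded reduces_to_def] .
    then have "fm n ?X \<in> vecs_on ({n - r..<n} \<times> {n - r..<n})" using rs by (simp add: lower_right_face_alt)
    from supported_congruence[OF sym_mats_carrier[OF psd_sym[OF psd]] S(1) S(4) RK KI this]
    have "fm n X \<in> vecs_on ({n - r..<n} \<times> {n - r..<n})" by (simp add: congruence_cancel[OF Xc S(1-3)])
    from rank_le_block[OF this Xc Rx] show "vec_space.rank n X \<le> vec_space.rank n Xs" using rX by simp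
  qed
  show "max_rank n (dual_slack_optimal n (A, b, C)) Zs"
    unfolding max_rank_def
  proof (intro conjI allI impI)
    show "dual_slack_optimal n (A, b, C) Zs" by (rule Zs_opt)
    fix Z assume "dual_slack_optimal n (A, b, C) Z"
    then obtain y where Z: "Z \<in> psd_cone n" "y \<in> carrier_vec m" "Z = C - mat_lincomb n A y" "mat_inner Z Xs = 0"
      by (auto simp: dual_optimal_iff)
    have Zs': "Z \<in> sym_mats n" and Zc: "Z \<in> carrier_mat n n" using psd_sym[OF Z(1)] sym_mats_carrier by auto
    let ?Z = "congruence S Z"
    have psd: "?Z \<in> psd_cone n" by (rule psd_congruence[OF Z(1) S(1)])
    have "mat_inner ?Z Xs = mat_inner Z Xs"
      unfolding inner_Xs[OF psd_sym[OF psd]] inner_Xs[OF Zs']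
      using congruence_unit_diag[OF Zc S(1) S(4) _ KI] RK by (intro sum.cong refl) auto
    then have X0: "mat_inner Xs ?Z = 0" using Z(4) inner_commute[OF psd_sym[OF psd] Xs_sym] by simp
    \<comment> \<open>Moving the rotation over to \<open>Y\<close> splits the slack into
      \<open>C\<close> and a combination of the equations: the first pairs to
      \<open>mat_inner C' Y\<close>, the second vanishes by transport of homogeneous
      solutions.\<close>
    have Y0: "mat_inner Y ?Z = 0" if Y: "Y \<in> set Ys" for Y
    proof -
      have Ysym: "Y \<in> sym_mats n" using Ys(1) Y by blast
      have perp: "mat_inner (A' ! i) Y = 0" if "i < m" for i using Ys(2) Y that by (metis in_set_conv_nth)
      have CY: "mat_inner C' Y = 0" using Ys(2) Y by (metis in_set_conv_nth)
      let ?Y = "S * Y * S\<^sup>T"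
      have Y'sym: "?Y \<in> sym_mats n" using sym_congruence[OF Ysym, of "S\<^sup>T"] S(1) by simp
      have "mat_inner ?Z Y = mat_inner Z ?Y" by (rule mat_inner_congruence[OF Zs' Ysym S(1)])
      also have "\<dots> = mat_inner C ?Y - mat_inner (mat_lincomb n A y) ?Y"
        unfolding Z(3) by (rule inner_minus[OF sym_mats_carrier[OF data(4)] lincomb_carrier Y'sym])
      also have "mat_inner C ?Y = mat_inner C' Y"
        unfolding C' by (rule mat_inner_congruence[OF data(4) Ysym S(1), symmetric])
      also have "mat_inner (mat_lincomb n A y) ?Y = 0"
        unfolding lincomb_inner[OF Y'sym] using tr.dual[OF Ysym] perp by simp
      finally show ?thesis using CY inner_commute[OF psd_sym[OF psd] Ysym] by simp
    qed
    have "?Z \<in> psd_cone n \<inter> (\<Inter>Y\<in>set (Xs # Ys). mat_perp n Y)"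
      using psd psd_sym[OF psd] X0 Y0 by (auto simp: mat_perp_def)
    then have "?Z \<in> upper_left_face n s" unfolding redY[unfolded reduces_to_def] .
    then have "fm n ?Z \<in> vecs_on ({..<s} \<times> {..<s})" using rs by (simp add: upper_left_face_alt)
    from supported_congruence[OF sym_mats_carrier[OF psd_sym[OF psd]] S(2) S(5) JK KI this]
    have "fm n Z \<in> vecs_on ({..<s} \<times> {..<s})" by (simp add: congruence_cancel[OF Zc S(2,1) S'S])
    from rank_le_block[OF this Zc Jz] show "vec_space.rank n Z \<le> vec_space.rank n Zs" using rZ by simp
  qed
qed

section \<open>From maximum rank to a reformulation\<close>

text \<open>Biorthogonality says that \<open>T'\<^sup>T\<close> is a left inverse of
  \<open>T\<close>, hence a two-sided one. As all vectors are supported in the middle block,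
  \<open>T\<close> is block diagonal and its middle block is inverted by that of \<open>T'\<close>
  transposed.\<close>

lemma admissible_of_dual_bases:
  fixes e f :: "nat \<Rightarrow> nat \<Rightarrow> real"
  defines "p \<equiv> n - r - s"
  defines "T \<equiv> mat n n (\<lambda>(i, c). if c \<in> {s..<s + p} then e (c - s) i else if i = c then 1 else 0)"
    and "T' \<equiv> mat n n (\<lambda>(i, c). if c \<in> {s..<s + p} then f (c - s) i else if i = c then 1 else 0)"
  assumes e: "\<And>t. t < p \<Longrightarrow> e t \<in> vecs_on {s..<s + p}" and f: "\<And>t. t < p \<Longrightarrow> f t \<in> vecs_on {s..<s + p}"
    and bi: "\<And>t u. t < p \<Longrightarrow> u < p \<Longrightarrow> ip {..<n} (f t) (e u) = (if t = u then 1 else 0)"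
  shows "T * T'\<^sup>T = 1\<^sub>m n" "T \<in> admissible_mats n s r" "invertible_mat T"
proof -
  have n: "n = s + p + r" using rs by (simp add: p_def)
  have Tc: "T \<in> carrier_mat n n" "T' \<in> carrier_mat n n" by (simp_all add: T_def T'_def)
  have ez: "e t i = 0" "f t i = 0" if "t < p" "i \<notin> {s..<s + p}" for t i
    using e[OF that(1)] f[OF that(1)] that(2) unfolding vecs_on_def by auto
  have T'T: "T'\<^sup>T * T = 1\<^sub>m n"
  proof (rule eq_matI)
    fix c d assume "c < dim_row (1\<^sub>m n :: real mat)" "d < dim_col (1\<^sub>m n :: real mat)"
    then have cd: "c < n" "d < n" by auto
    have "(T'\<^sup>T * T) $$ (c, d) = (\<Sum>i<n. T' $$ (i, c) * T $$ (i, d))"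
      using cd Tc by (auto simp: scalar_prod_def atLeast0LessThan intro!: sum.cong)
    also have "\<dots> = (if c = d then 1 else 0)"
    proof (cases "c \<in> {s..<s + p}")
      case c: True
      show ?thesis
      proof (cases "d \<in> {s..<s + p}")
        case True
        have "(\<Sum>i<n. T' $$ (i, c) * T $$ (i, d)) = ip {..<n} (f (c - s)) (e (d - s))"
          unfolding ip_def T_def T'_def using c True cd by (intro sum.cong) auto
        also have "\<dots> = (if c - s = d - s then 1 else 0)" using c True by (intro bi) auto
        finally show ?thesis using c True by auto
      next
        case False
        have "(\<Sum>i<n. T' $$ (i, c) * T $$ (i, d)) = (\<Sum>i<n. if i = d then f (c - s) d else 0)"
          unfolding T_def T'_def using c False cd by (intro sum.cong) auto
        also have "\<dots> = f (c - s) d" using cd by simp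
        also have "\<dots> = 0" using c False by (intro ez(2)) auto
        finally show ?thesis using c False by auto
      qed
    next
      case c: False
      have "(\<Sum>i<n. T' $$ (i, c) * T $$ (i, d)) = (\<Sum>i<n. if i = c then T $$ (c, d) else 0)"
        unfolding T'_def using c cd by (intro sum.cong) auto
      also have "\<dots> = T $$ (c, d)" using cd by simp
      also have "\<dots> = (if c = d then 1 else 0)"
        unfolding T_def using c cd ez(1)[of "d - s" c] by auto
      finally show ?thesis .
    qed
    finally show "(T'\<^sup>T * T) $$ (c, d) = 1\<^sub>m n $$ (c, d)" using cd by simp
  qed (use Tc in auto)
  then show TT': "T * T'\<^sup>T = 1\<^sub>m n"
    using mat_mult_left_right_inverse[of "T'\<^sup>T" n T] Tc by simp
  show "invertible_mat T"
    unfolding invertible_mat_def inverts_mat_def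
    using TT' T'T Tc by (intro conjI exI[of _ "T'\<^sup>T"]) auto
  define U where "U = mat p p (\<lambda>(i, j). e j (s + i))"
  define V where "V = mat p p (\<lambda>(i, j). f j (s + i))"
  have UV: "U \<in> carrier_mat p p" "V \<in> carrier_mat p p" by (simp_all add: U_def V_def)
  have "V\<^sup>T * U = 1\<^sub>m p"
  proof (rule eq_matI)
    fix c d assume "c < dim_row (1\<^sub>m p :: real mat)" "d < dim_col (1\<^sub>m p :: real mat)"
    then have cd: "c < p" "d < p" by auto
    have "(V\<^sup>T * U) $$ (c, d) = (\<Sum>i<p. f c (s + i) * e d (s + i))"
      using cd by (auto simp: U_def V_def scalar_prod_def atLeast0LessThan intro!: sum.cong)
    also have "\<dots> = (\<Sum>i\<in>{s..<s + p}. f c i * e d i)"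
      by (rule sum.reindex_bij_witness[of _ "\<lambda>i. i - s" "\<lambda>i. s + i"]) auto
    also have "\<dots> = ip {..<n} (f c) (e d)"
      unfolding ip_def using n cd ez by (intro sum.mono_neutral_left) auto
    finally show "(V\<^sup>T * U) $$ (c, d) = 1\<^sub>m p $$ (c, d)" using bi cd by simp
  qed (simp_all add: U_def V_def)
  moreover from this have "U * V\<^sup>T = 1\<^sub>m p"
    using mat_mult_left_right_inverse[of "V\<^sup>T" p U] UV by simp
  ultimately have "invertible_mat U"
    unfolding invertible_mat_def inverts_mat_def
    using UV by (intro conjI exI[of _ "V\<^sup>T"]) auto
  moreover have "T = diag_block_mat [1\<^sub>m s, U, 1\<^sub>m r]"
  proof (rule eq_matI)
    fix i j assume "i < dim_row (diag_block_mat [1\<^sub>m s, U, 1\<^sub>m r])" "j < dim_col (diag_block_mat [1\<^sub>m s, U, 1\<^sub>m r])"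
    then have ij: "i < n" "j < n" using block_mat_entry(1)[OF UV(1) n] by auto
    show "T $$ (i, j) = diag_block_mat [1\<^sub>m s, U, 1\<^sub>m r] $$ (i, j)"
      unfolding block_mat_entry(2)[OF UV(1) n ij] using ij ez(1)[of "j - s" i] by (auto simp: T_def U_def)
  qed (use Tc block_mat_entry(1)[OF UV(1) n] in auto)
  ultimately show "T \<in> admissible_mats n s r"
    unfolding admissible_mats_def using UV(1) unfolding p_def by blast
qed

text \<open>Row operations come before the single rotation, so the sequence found in the original
  coordinates becomes the leading equations first, and one matrix \<open>T\<close> then makes both
  sequences regular.\<close>

lemma reformulation_of_max_rank:
  assumes mrP: "max_rank n (primal_optimal n (A, b, C)) Xs" and mrD: "max_rank n (dual_slack_optimal n (A, b, C)) Zs"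
  shows "\<exists>k l :: nat. 1 \<le> k \<and> k \<le> m \<and> 1 \<le> l \<and>
    (\<exists>A' b' C'. reformulation_using n (admissible_mats n s r) (A, b, C) (A', b', C') \<and> (\<forall>i<k. b' $ i = 0) \<and>
       regular_fr_seq n (Zs # take k A') \<and> reduces_to n (Zs # take k A') (lower_right_face n r) \<and>
       (\<exists>Ys. length Ys = l \<and> set Ys \<subseteq> sym_mats n \<and>
          (\<forall>j<l. (\<forall>i<m. mat_inner (A' ! i) (Ys ! j) = 0) \<and> mat_inner C' (Ys ! j) = 0) \<and>
          regular_fr_seq n (Xs # Ys) \<and> reduces_to n (Xs # Ys) (upper_left_face n s)))"
proof -
  let ?I = "{..<n}"
  define p where "p = n - r - s"
  have n: "n = s + p + r" and p: "0 < p" and nr: "n - r = s + p" using rs by (auto simp: p_def)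
  define Mid where "Mid = {s..<s + p}"
  have MI: "Mid \<subseteq> ?I" using n by (auto simp: Mid_def)
  obtain k a where a: "\<And>i. i < k \<Longrightarrow> a i \<in> sym_mats n"
    "\<And>i. i < k \<Longrightarrow> \<exists>y\<in>carrier_vec m. a i = mat_lincomb n A y \<and> b \<bullet> y = 0"
    and frsa: "frs ?I (vecs_on (?I - {..<s})) (\<lambda>i. fm n (a i)) k"
    and zseta: "zset ?I (vecs_on (?I - {..<s})) (\<lambda>i. fm n (a i)) k = vecs_on {n - r..<n}"
    and nza: "\<And>i. i < k \<Longrightarrow> \<exists>x\<in>zset ?I (vecs_on (?I - {..<s})) (\<lambda>i. fm n (a i)) i. bf ?I (fm n (a i)) x x \<noteq> 0"
    using primal_sequence[OF mrP] by metis
  obtain l Y where Y: "\<And>j. j < l \<Longrightarrow> Y j \<in> sym_mats n"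
    "\<And>j i. j < l \<Longrightarrow> i < m \<Longrightarrow> mat_inner (A ! i) (Y j) = 0" "\<And>j. j < l \<Longrightarrow> mat_inner C (Y j) = 0"
    and frsY: "frs ?I (vecs_on (?I - {n - r..<n})) (\<lambda>j. fm n (Y j)) l"
    and zsetY: "zset ?I (vecs_on (?I - {n - r..<n})) (\<lambda>j. fm n (Y j)) l = vecs_on {..<s}"
    using dual_sequence[OF mrD] by metis
  \<comment> \<open>Index \<open>s\<close> belongs to the middle block, nonempty because
    \<open>r + s < n\<close>; an empty sequence would leave its unit vector in the final
    kernel.\<close>
  let ?\<delta> = "\<lambda>i. if i = s then 1 else (0::real)"
  have "k \<noteq> 0"
  proof
    assume "k = 0"
    then have "vecs_on (?I - {..<s}) = vecs_on {n - r..<n}" using zseta by simp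
    moreover have "?\<delta> \<in> vecs_on (?I - {..<s})" "?\<delta> \<notin> vecs_on {n - r..<n}" using rs by (auto simp: vecs_on_def)
    ultimately show False by simp
  qed
  have "l \<noteq> 0"
  proof
    assume "l = 0"
    then have "vecs_on (?I - {n - r..<n}) = vecs_on {..<s}" using zsetY by simp
    moreover have "?\<delta> \<in> vecs_on (?I - {n - r..<n})" "?\<delta> \<notin> vecs_on {..<s}" using rs by (auto simp: vecs_on_def)
    ultimately show False by simp
  qed
  have MidJ: "vecs_on Mid \<subseteq> vecs_on (?I - {..<s})" and MidR: "vecs_on Mid \<subseteq> vecs_on (?I - {n - r..<n})"
    using n nr by (auto simp: vecs_on_def Mid_def)
  have linM: "lin_sub ?I (vecs_on Mid)" by (rule lin_sub_vecs[OF MI])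
  \<comment> \<open>Restricted to the middle block both flags end in zero, since a vector surviving
    there would also be supported in a disjoint outer block.\<close>
  have zM: "zset ?I (vecs_on Mid) F i = {\<lambda>_. 0}"
    if sub: "vecs_on Mid \<subseteq> E" and z: "zset ?I E F i = vecs_on R" and R: "R \<inter> Mid = {}" for E F i R
  proof (intro equalityI subsetI)
    fix x assume x: "x \<in> zset ?I (vecs_on Mid) F i"
    then have xM: "x \<in> vecs_on Mid" using zset_subset by blast
    have "x \<in> zset ?I E F i" using x sub unfolding zset_def by blast
    then have xR: "x \<in> vecs_on R" using z by simp
    have "x j = 0" for j using xM xR R unfolding vecs_on_def by blast
    then show "x \<in> {\<lambda>_. 0}" by auto
  next
    fix x :: "nat \<Rightarrow> real" assume "x \<in> {\<lambda>_. 0}"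
    then show "x \<in> zset ?I (vecs_on Mid) F i" by (simp add: zset_def lin_sub_zero[OF linM])
  qed
  have RM: "{n - r..<n} \<inter> Mid = {}" "{..<s} \<inter> Mid = {}" using nr by (auto simp: Mid_def)
  have "\<forall>v\<in>vecs_on Mid. (\<forall>g\<in>vecs_on Mid. ip ?I g v = 0) \<longrightarrow> v = (\<lambda>_. 0)"
    using ip_pos[OF finite_lessThan lin_sub_vecs_on[OF linM]] by (metis less_irrefl)
  from simultaneous_diagonalization[OF finite_lessThan linM linM
      frs_subset[OF frsa MidJ] zM[OF MidJ zseta RM(1)] frs_subset[OF frsY MidR] zM[OF MidR zsetY RM(2)] this]
  obtain q e f \<iota> \<kappa> where
    e0: "\<forall>t<q. e t \<in> zset ?I (vecs_on Mid) (\<lambda>i. fm n (a i)) (\<iota> t) \<and> \<iota> t < k \<and>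
      f t \<in> zset ?I (vecs_on Mid) (\<lambda>j. fm n (Y j)) (\<kappa> t) \<and> \<kappa> t < l"
    and bi: "\<forall>t<q. \<forall>u<q. ip ?I (f t) (e u) = (if t = u then 1 else 0)"
    and span: "\<forall>v\<in>vecs_on Mid. v = (\<lambda>i. \<Sum>t<q. ip ?I (f t) v * e t i)"
    and sys: "diag_system ?I (\<lambda>i. fm n (a i)) \<iota> e q" "diag_system ?I (\<lambda>j. fm n (Y j)) \<kappa> f q"
    by (elim exE conjE) (rule that, assumption+)
  have eM: "e t \<in> vecs_on Mid" and fM: "f t \<in> vecs_on Mid" if "t < q" for t
    using e0 that zset_subset by blast+
  \<comment> \<open>Trace count: the double sum of \<open>f t i * e t i\<close> is \<open>p\<close>
    when summed first over t, by the expansion of unit vectors, and \<open>q\<close> when summed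
    first over i, by biorthogonality.\<close>
  have "q = p"
  proof -
    have diag: "(\<Sum>t<q. f t i * e t i) = 1" if i: "i \<in> Mid" for i
    proof -
      let ?d = "\<lambda>j. if j = i then 1 else (0::real)"
      have "?d \<in> vecs_on Mid" using i by (auto simp: vecs_on_def)
      from fun_cong[OF bspec[OF span this], of i] have "1 = (\<Sum>t<q. ip ?I (f t) ?d * e t i)" by simp
      moreover have "ip ?I (f t) ?d = f t i" for t
        using ip_delta[of ?I i "f t"] i MI ip_commute[of ?I "f t" ?d] by auto
      ultimately show ?thesis by simp
    qed
    have "real p = (\<Sum>i\<in>Mid. \<Sum>t<q. f t i * e t i)" using diag by (simp add: Mid_def)
    also have "\<dots> = (\<Sum>t<q. \<Sum>i\<in>Mid. f t i * e t i)" by (rule sum.swap)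
    also have "\<dots> = (\<Sum>t<q. 1)"
    proof (intro sum.cong refl)
      fix t assume t: "t \<in> {..<q}"
      have "(\<Sum>i\<in>Mid. f t i * e t i) = ip ?I (f t) (e t)"
        unfolding ip_def using MI fM[of t] t by (intro sum.mono_neutral_left) (auto simp: vecs_on_def)
      then show "(\<Sum>i\<in>Mid. f t i * e t i) = 1" using bi t by simp
    qed
    finally show ?thesis by simp
  qed
  define T where "T = mat n n (\<lambda>(i, c). if c \<in> {s..<s + p} then e (c - s) i else if i = c then 1 else 0)"
  define T' where "T' = mat n n (\<lambda>(i, c). if c \<in> {s..<s + p} then f (c - s) i else if i = c then 1 else 0)"
  have Tc: "T \<in> carrier_mat n n" "T' \<in> carrier_mat n n" by (simp_all add: T_def T'_def)
  have T: "T * T'\<^sup>T = 1\<^sub>m n" "T \<in> admissible_mats n s r" "invertible_mat T"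
    using admissible_of_dual_bases[of e f, folded p_def, folded T_def T'_def] eM fM bi \<open>q = p\<close> by (auto simp: Mid_def)
  note e = e0[unfolded \<open>q = p\<close> Mid_def] and sys = sys[unfolded \<open>q = p\<close>]
  \<comment> \<open>The vector witnessing strict reduction at stage i is null for all earlier forms
    but not for \<open>a i\<close>, so \<open>a i\<close> is not their combination.\<close>
  have indep: "\<exists>u<n. \<exists>v<n. a i $$ (u, v) \<noteq> (\<Sum>j<i. c j * a j $$ (u, v))" if i: "i < k" for i c
  proof (rule ccontr)
    assume "\<not> ?thesis"
    then have eq: "a i $$ (u, v) = (\<Sum>j<i. c j * a j $$ (u, v))" if "u < n" "v < n" for u v using that by blast
    have fma: "fm n (a i) = (\<lambda>w. \<Sum>j<i. c j * fm n (a j) w)"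
      using eq by (auto simp: fm_def fun_eq_iff)
    obtain x where x: "x \<in> zset ?I (vecs_on (?I - {..<s})) (\<lambda>i. fm n (a i)) i" "bf ?I (fm n (a i)) x x \<noteq> 0"
      using nza[OF i] by blast
    have "bf ?I (fm n (a i)) x x = (\<Sum>j<i. c j * bf ?I (fm n (a j)) x x)"
      unfolding fma bf_eq_ip by (rule ip_sum_left)
    also have "\<dots> = 0" using x(1) by (simp add: zset_def)
    finally show False using x(2) by simp
  qed
  have "\<exists>A' b'. (reform_step n (admissible_mats n s r))\<^sup>*\<^sup>* (A, b, C) (A', b', C) \<and> length A' = m \<and>
      set A' \<subseteq> sym_mats n \<and> b' \<in> carrier_vec m \<and> k \<le> m \<and> (\<forall>i<k. A' ! i = a i \<and> b' $ i = 0) \<and>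
      row_span_le n A b A' b' \<and>
      (\<forall>Y\<in>sym_mats n. (\<forall>i<m. mat_inner (A ! i) Y = 0) \<longrightarrow> (\<forall>i<m. mat_inner (A' ! i) Y = 0))"
    by (rule row_operations[OF data(1-3)]) (rule a(2) indep, assumption)+
  then obtain A1 b1 where steps: "(reform_step n (admissible_mats n s r))\<^sup>*\<^sup>* (A, b, C) (A1, b1, C)"
    and A1: "length A1 = m" "set A1 \<subseteq> sym_mats n" "k \<le> m" "\<forall>i<k. A1 ! i = a i \<and> b1 $ i = 0"
    and perp: "\<forall>Y\<in>sym_mats n. (\<forall>i<m. mat_inner (A ! i) Y = 0) \<longrightarrow> (\<forall>i<m. mat_inner (A1 ! i) Y = 0)"
    by (elim exE conjE) (rule that, assumption+)
  define A2 where "A2 = map (\<lambda>M. congruence T M) A1"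
  define C2 where "C2 = congruence T C"
  have "reform_step n (admissible_mats n s r) (A1, b1, C) (A2, b1, C2)"
    unfolding A2_def C2_def by (rule reform_step.rotate[OF T(2) Tc(1) T(3)])
  then have ref: "reformulation_using n (admissible_mats n s r) (A, b, C) (A2, b1, C2)"
    using steps unfolding reformulation_using_def by (rule rtranclp.rtrancl_into_rtrancl[rotated])
  have take: "take k A2 = map (\<lambda>i. congruence T (a i)) [0..<k]"
    using A1 by (intro nth_equalityI) (auto simp: A2_def)
  have part: "{..<s} \<union> {n - r..<n} \<union> {s..<s + p} = {..<n}" "{n - r..<n} \<union> {..<s} \<union> {s..<s + p} = {..<n}"
    using n nr by auto
  have disj: "{..<s} \<inter> {n - r..<n} = {}" "{n - r..<n} \<inter> {..<s} = {}" "{..<s} \<inter> {s..<s + p} = {}" "{n - r..<n} \<inter> {s..<s + p} = {}"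
    using n nr by auto
  have eP: "e t \<in> zset ?I (vecs_on {s..<s + p}) (\<lambda>i. fm n (a i)) (\<iota> t)" "\<iota> t < k"
    and fP: "f t \<in> zset ?I (vecs_on {s..<s + p}) (\<lambda>j. fm n (Y j)) (\<kappa> t)" "\<kappa> t < l" if "t < p" for t
    using e that by blast+
  have Tent: "T $$ (i, c) = (if c \<in> {s..<s + p} then e (c - s) i else if i = c then 1 else 0)"
    "T' $$ (i, c) = (if c \<in> {s..<s + p} then f (c - s) i else if i = c then 1 else 0)" if "i < n" "c < n" for i c
    using that by (simp_all add: T_def T'_def)
  note primal = congruence_fr_blocks[OF part(1) disj(1,3,4) Zs_carrier fm_Zs dz_pos a(1) frsa zseta eP sys(1) Tc(1) Tent(1)]
  note dual = congruence_fr_blocks[OF part(2) disj(2,4,3) Xs_carrier fm_Xs dx_pos Y(1) frsY zsetY fP sys(2) Tc(2) Tent(2)]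
  let ?Ys = "map (\<lambda>j. congruence T' (Y j)) [0..<l]"
  have Yperp: "mat_inner (A2 ! i) (?Ys ! j) = 0" if "i < m" "j < l" for i j
  proof -
    have "A1 ! i \<in> sym_mats n" using A1 that(1) nth_mem[of i A1] by auto
    \<comment> \<open>Equations are rotated by \<open>T\<close> and dual matrices by its transposed
      inverse \<open>T'\<close>, so pairings are preserved.\<close>
    then have "mat_inner (A2 ! i) (?Ys ! j) = mat_inner (A1 ! i) (Y j)"
      using that A1(1) mat_inner_congruence_dual[OF _ Y(1)[OF that(2)] Tc T(1)] by (simp add: A2_def)
    then show ?thesis using perp Y(1,2) that by simp
  qed
  have YC: "mat_inner C2 (?Ys ! j) = 0" if "j < l" for j
    using that mat_inner_congruence_dual[OF data(4) Y(1)[OF that] Tc T(1)] Y(3) by (simp add: C2_def)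
  have Ysym: "set ?Ys \<subseteq> sym_mats n" using sym_congruence[OF Y(1) Tc(2)] by auto
  show ?thesis
  proof (rule exI[of _ k], rule exI[of _ l], intro conjI)
    show "1 \<le> k" "1 \<le> l" "k \<le> m" using \<open>k \<noteq> 0\<close> \<open>l \<noteq> 0\<close> A1(3) by auto
    show "\<exists>A' b' C'. reformulation_using n (admissible_mats n s r) (A, b, C) (A', b', C') \<and> (\<forall>i<k. b' $ i = 0) \<and>
       regular_fr_seq n (Zs # take k A') \<and> reduces_to n (Zs # take k A') (lower_right_face n r) \<and>
       (\<exists>Ys. length Ys = l \<and> set Ys \<subseteq> sym_mats n \<and>
          (\<forall>j<l. (\<forall>i<m. mat_inner (A' ! i) (Ys ! j) = 0) \<and> mat_inner C' (Ys ! j) = 0) \<and>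
          regular_fr_seq n (Xs # Ys) \<and> reduces_to n (Xs # Ys) (upper_left_face n s))"
    proof (rule exI[of _ A2], rule exI[of _ b1], rule exI[of _ C2], intro conjI)
      show "reformulation_using n (admissible_mats n s r) (A, b, C) (A2, b1, C2)" by (rule ref)
      show "\<forall>i<k. b1 $ i = 0" using A1(4) by blast
      show "regular_fr_seq n (Zs # take k A2)" unfolding take by (rule primal(1))
      have "lower_right_face n r = {X \<in> psd_cone n. fm n X \<in> vecs_on ({n - r..<n} \<times> {n - r..<n})}"
        using rs by (intro lower_right_face_alt) simp
      then show "reduces_to n (Zs # take k A2) (lower_right_face n r)" unfolding take using primal(2) by metis
      have "upper_left_face n s = {X \<in> psd_cone n. fm n X \<in> vecs_on ({..<s} \<times> {..<s})}"
        using rs by (intro upper_left_face_alt) simp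
      then have "reduces_to n (Xs # ?Ys) (upper_left_face n s)" using dual(2) by metis
      then show "\<exists>Ys. length Ys = l \<and> set Ys \<subseteq> sym_mats n \<and>
          (\<forall>j<l. (\<forall>i<m. mat_inner (A2 ! i) (Ys ! j) = 0) \<and> mat_inner C2 (Ys ! j) = 0) \<and>
          regular_fr_seq n (Xs # Ys) \<and> reduces_to n (Xs # Ys) (upper_left_face n s)"
        using Ysym Yperp YC dual(1) by (intro exI[of _ ?Ys] conjI) auto
    qed
  qed
qed

end

text \<open>Indices start at 0, so \<open>i<k\<close> ranges over the first k equations; with
  \<open>k \<le> m\<close> the list \<open>take k A'\<close> has exactly k members, as the
  operations keep the number of equations.\<close>

theorem theorem1:
  fixes n m r s :: nat
    and A :: "real mat list" and b :: "real vec" and C :: "real mat"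
    and \<Lambda> \<Gamma> Xs Zs :: "real mat"
  assumes sdp: "is_sdp n m (A, b, C)"
    and r: "1 \<le> r" and s: "1 \<le> s" and rs: "r + s < n"
    and \<Lambda>: "diagonal_mat \<Lambda>" "\<Lambda> \<in> pd_mats r"
    and \<Gamma>: "diagonal_mat \<Gamma>" "\<Gamma> \<in> pd_mats s"
    and Xs: "Xs = diag_block_mat [0\<^sub>m s s, 0\<^sub>m (n - r - s) (n - r - s), \<Lambda>]"
    and Zs: "Zs = diag_block_mat [\<Gamma>, 0\<^sub>m (n - r - s) (n - r - s), 0\<^sub>m r r]"
    and Xs_opt: "primal_optimal n (A, b, C) Xs"
    and Zs_opt: "dual_slack_optimal n (A, b, C) Zs"
  shows
    "(max_rank n (primal_optimal n (A, b, C)) Xs \<and>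
      max_rank n (dual_slack_optimal n (A, b, C)) Zs)
     \<longleftrightarrow>
     (\<exists>k l :: nat. 1 \<le> k \<and> k \<le> m \<and> 1 \<le> l \<and>
        (\<exists>A' b' C'.
           reformulation_using n (admissible_mats n s r) (A, b, C) (A', b', C') \<and>
           (\<forall>i<k. b' $ i = 0) \<and>
           regular_fr_seq n (Zs # take k A') \<and>
           reduces_to n (Zs # take k A') (lower_right_face n r) \<and>
           (\<exists>Ys. length Ys = l \<and> set Ys \<subseteq> sym_mats n \<and>
              (\<forall>j<l. (\<forall>i<m. mat_inner (A' ! i) (Ys ! j) = 0) \<and> mat_inner C' (Ys ! j) = 0) \<and>
              regular_fr_seq n (Xs # Ys) \<and>
              reduces_to n (Xs # Ys) (upper_left_face n s))))"
proof -
  interpret sdp_pair n m r s A b C \<Lambda> \<Gamma> Xs Zs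
    using assms by unfold_locales
  show ?thesis
    by (intro iffI conjI; (elim conjE, rule reformulation_of_max_rank; assumption)?;
        elim exE conjE, rule max_rank_of_reformulation, (assumption | simp)+)
qed

end
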